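(* Suppose that the spectral measure is absolutely continuous, $\mu_\rho(dx)=\psi_\rho(x)\,dx$, where the spectral density $\psi_\rho$ is piecewise continuous and its nodal set can be decomposed as a finite union of intervals and points $$\{\psi_\rho=0\}=\bigcup_{i=1}^p[a_i,b_i]\cup\bigcup_{j=1}^q\{c_j\}.$$ Then $$\lim_{n\to+\infty}\frac{\mathbb{E}[\mathcal{N}(f_n,[0,2\pi])]}{n}=\frac{\lambda(\{\psi_\rho=0\})}{\pi\sqrt{2}}+\frac{2\pi-\lambda(\{\psi_\rho=0\})}{\pi\sqrt{3}}.$$
   Context: Let $\mu_\rho$ be a symmetric probability measure on $[-\pi,\pi]$ (the spectral measure), regarded as a measure on the circle $\mathbb{R}/2\pi\mathbb{Z}$, and let $\rho(k)=\int_{-\pi}^{\pi}e^{-ikx}\,\mu_\rho(dx)$, $k\in\mathbb{Z}$. On a probability space $(\Omega,\mathcal{F},\mathbb{P})$ with expectation $\mathbb{E}$, let $(a_k)_{k\ge1}$ and $(b_k)_{k\ge1}$ be two independent centered stationary Gaussian sequences with $\mathbb{E}[a_ka_\ell]=\mathbb{E}[b_kb_\ell]=\rho(|k-\ell|)$ for $k,\ell\ge1$ (so each variable has variance $\rho(0)=1$). For $n\ge1$ set $f_n(x)=\frac{1}{\sqrt n}\sum_{k=1}^n a_k\cos(kx)+b_k\sin(kx)$. For a function $f$ and an interval $[a,b]$, $\mathcal{N}(f,[a,b])=\#\{t\in[a,b]: f(t)=0\}$. $\lambda$ is Lebesgue measure. The density $\psi_\rho$ is regarded as a $2\pi$-periodic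 function, and $\{\psi_\rho=0\}$ denotes its zero set in one period. *)

theory Defs
  imports "HOL-Probability.Probability"
begin

text \<open>A real Gaussian law is allowed to be degenerate (a Dirac mass when the variance vanishes);
  the library's \<^const>\<open>normal_density\<close> describes a probability law only for positive deviation.\<close>

definition gaussian_law :: "real \<Rightarrow> real \<Rightarrow> real measure" where
  "gaussian_law m s =
     (if s = 0 then return borel m else density lborel (\<lambda>x. ennreal (normal_density m s x)))"

definition gaussian_rv :: "'w measure \<Rightarrow> ('w \<Rightarrow> real) \<Rightarrow> bool" where
  "gaussian_rv M X \<longleftrightarrow>
     X \<in> borel_measurable M \<and> (\<exists>m s. 0 \<le> s \<and> distr M borel X = gaussian_law m s)"

text \<open>Joint Gaussianity of \<open>(X\<^sub>k)\<close>, \<open>k \<ge> 1\<close>: every finite linear combination is Gaussian. The value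
  at index 0 is irrelevant.\<close>

definition gaussian_sequence :: "'w measure \<Rightarrow> (nat \<Rightarrow> 'w \<Rightarrow> real) \<Rightarrow> bool" where
  "gaussian_sequence M X \<longleftrightarrow>
     (\<forall>I u. finite I \<longrightarrow> I \<subseteq> {1..} \<longrightarrow> gaussian_rv M (\<lambda>\<omega>. \<Sum>k\<in>I. u k * X k \<omega>))"

definition spectral_corr :: "real measure \<Rightarrow> int \<Rightarrow> complex" where
  "spectral_corr \<mu> k = (LINT x|\<mu>. exp (- \<i> * of_int k * complex_of_real x))"

text \<open>Stationarity is contained in the covariance condition: a centered Gaussian sequence is
  stationary iff its covariance depends on the lag only.\<close>

definition stationary_gaussian_sequence ::
  "'w measure \<Rightarrow> real measure \<Rightarrow> (nat \<Rightarrow> 'w \<Rightarrow> real) \<Rightarrow> bool" where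
  "stationary_gaussian_sequence M \<mu> X \<longleftrightarrow>
     gaussian_sequence M X \<and>
     (\<forall>k\<ge>1. (LINT \<omega>|M. X k \<omega>) = 0) \<and>
     (\<forall>k\<ge>1. \<forall>l\<ge>1. complex_of_real (LINT \<omega>|M. X k \<omega> * X l \<omega>)
                       = spectral_corr \<mu> \<bar>int k - int l\<bar>)"

text \<open>Independence of two whole sequences, seen as random elements of the product space.\<close>

definition indep_sequences ::
  "'w measure \<Rightarrow> (nat \<Rightarrow> 'w \<Rightarrow> real) \<Rightarrow> (nat \<Rightarrow> 'w \<Rightarrow> real) \<Rightarrow> bool" where
  "indep_sequences M X Y \<longleftrightarrow>
     prob_space.indep_var M
       (PiM {1..} (\<lambda>_. borel)) (\<lambda>\<omega>. \<lambda>k\<in>{1..}. X k \<omega>)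
       (PiM {1..} (\<lambda>_. borel)) (\<lambda>\<omega>. \<lambda>k\<in>{1..}. Y k \<omega>)"

definition trig_poly ::
  "(nat \<Rightarrow> 'w \<Rightarrow> real) \<Rightarrow> (nat \<Rightarrow> 'w \<Rightarrow> real) \<Rightarrow> nat \<Rightarrow> 'w \<Rightarrow> real \<Rightarrow> real" where
  "trig_poly a b n \<omega> x =
     1 / sqrt (real n) * (\<Sum>k=1..n. a k \<omega> * cos (real k * x) + b k \<omega> * sin (real k * x))"

text \<open>The counting measure is used so that an infinite zero set has \<open>\<infinity>\<close> zeros
  (\<^const>\<open>card\<close> would give 0).\<close>

definition num_zeros :: "(real \<Rightarrow> real) \<Rightarrow> real set \<Rightarrow> ennreal" where
  "num_zeros f A = emeasure (count_space UNIV) {t \<in> A. f t = 0}"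

text \<open>Piecewise continuity on \<open>[a, b]\<close>: finitely many discontinuities inside, with finite one-sided
  limits everywhere; the values at the discontinuities are arbitrary.\<close>

definition piecewise_continuous_on :: "real \<Rightarrow> real \<Rightarrow> (real \<Rightarrow> real) \<Rightarrow> bool" where
  "piecewise_continuous_on a b f \<longleftrightarrow>
     (\<exists>S. finite S \<and> (\<forall>x \<in> {a<..<b} - S. isCont f x)) \<and>
     (\<forall>x \<in> {a<..b}. \<exists>l. (f \<longlongrightarrow> l) (at_left x)) \<and>
     (\<forall>x \<in> {a..<b}. \<exists>l. (f \<longlongrightarrow> l) (at_right x))"

end

theory Submission
  imports Defs
begin

text \<open>The zeros of a smooth function are counted by its sign changes on finer and finer grids. For two
  jointly Gaussian centered variables the probability of opposite signs is the angle between them in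
  \<open>L\<^sup>2\<close>, divided by \<open>\<pi>\<close> (\<open>opposite_sign_prob\<close>). Therefore the expected number of zeros of a Gaussian
  function \<open>f\<close> on an interval is the length of the curve \<open>x \<mapsto> f(x) / \<parallel>f(x)\<parallel>\<close> on the unit sphere of
  \<open>L\<^sup>2\<close>, divided by \<open>\<pi>\<close>: the geometric form of the Kac-Rice formula. It is used as the pair of bounds
  \<open>expected_zeros_upper\<close> and \<open>expected_zeros_lower\<close> on intervals where the speed of the curve lies
  below or above a constant.

  For the polynomial \<open>f\<^sub>n\<close> the squared speed at \<open>x\<close> is \<open>(A B - E\<^sup>2) / A\<^sup>2\<close>, where \<open>A\<close> is the variance of
  \<open>f\<^sub>n(x)\<close>, \<open>B\<close> that of \<open>f\<^sub>n'(x)\<close>, and \<open>E\<close> their covariance. All three are integrals of the spectral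
  density \<open>\<psi>\<close> against kernels formed from the Dirichlet kernel translated to \<open>x\<close>. Two regimes occur.

  \<^item> If \<open>\<psi>\<close> is positive and continuous near \<open>x\<close>, the kernels are approximate identities: \<open>A\<close> is
    asymptotic to \<open>2\<pi> \<psi>(x)\<close> and \<open>B\<close> to \<open>n\<^sup>2 A / 3\<close>, as if the coefficients were independent. The speed
    is asymptotic to \<open>n / \<surd>3\<close> (\<open>speed_limit_positive\<close>).

  \<^item> If \<open>\<psi>\<close> vanishes near \<open>x\<close>, the peak of the kernels is invisible, and \<open>A\<close> is only of order \<open>1 / n\<close>.
    What remains are the tails, where the kernels oscillate with frequency \<open>n\<close>. The oscillating parts
    disappear by the Riemann-Lebesgue lemma, and the averages of the tails satisfy \<open>B \<approx> n\<^sup>2 A / 2\<close>.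
    The speed is asymptotic to \<open>n / \<surd>2\<close> (\<open>speed_limit_zero\<close>).

  These limits are locally uniform in the complement of a finite set: the discontinuities of \<open>\<psi>\<close>, the
  end points of the nodal intervals and the isolated nodal points. Around these points nothing is known about
  the speed, but few zeros are lost there. A function with \<open>j\<close> zeros in an interval of length \<open>r\<close> whose
  derivatives of order \<open>j\<close> are at most \<open>n\<^sup>j S\<close> is bounded by \<open>S (n r)\<^sup>j / j!\<close> on that interval, which is
  extremely small once \<open>j\<close> exceeds a multiple of \<open>n r\<close>. A Gaussian variable of variance at
  least \<open>c / n\<close> is rarely so small, so an interval of length \<open>r\<close> carries at most \<open>e\<^sup>2 n r + o(n)\<close> zeros in the
  mean (\<open>zeros_short_eventually\<close>). Letting \<open>r\<close> tend to zero and adding up the finitely many gaps between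
  the bad points gives the theorem.\<close>

section \<open>Zeros and sign changes on a grid\<close>

definition grid :: "real \<Rightarrow> real \<Rightarrow> nat \<Rightarrow> nat \<Rightarrow> real" where
  "grid u v m i = u + (v - u) * real i / real m"

definition sign_changes :: "(real \<Rightarrow> real) \<Rightarrow> real \<Rightarrow> real \<Rightarrow> nat \<Rightarrow> nat" where
  "sign_changes f u v m = card {i. i < m \<and> f (grid u v m i) * f (grid u v m (Suc i)) < 0}"

lemma grid_0 [simp]: "grid u v m 0 = u"
  by (simp add: grid_def)

lemma grid_end [simp]: "m > 0 \<Longrightarrow> grid u v m m = v"
  by (simp add: grid_def)

lemma grid_step: "m > 0 \<Longrightarrow> grid u v m (Suc i) - grid u v m i = (v - u) / real m"
  by (simp add: grid_def field_simps)

lemma grid_mono: "u \<le> v \<Longrightarrow> i \<le> j \<Longrightarrow> grid u v m i \<le> grid u v m j"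
  unfolding grid_def by (intro add_left_mono divide_right_mono mult_left_mono) auto

lemma grid_le: "u \<le> v \<Longrightarrow> i \<le> m \<Longrightarrow> grid u v m i \<le> v"
  using grid_mono[of u v i m m] by (cases "m = 0") (auto simp: grid_def)

lemma grid_ge: "u \<le> v \<Longrightarrow> u \<le> grid u v m i"
  using grid_mono[of u v 0 i m] by simp

text \<open>The zero count takes the value \<open>\<infinity>\<close> on infinite zero sets. Bounding it by its finite
  subsets, from below and from above, avoids a case distinction later on.\<close>
lemma num_zeros_ge_card:
  assumes "F \<subseteq> {t \<in> A. f t = 0}" "finite F"
  shows "of_nat (card F) \<le> num_zeros f A"
proof -
  have "emeasure (count_space UNIV) F \<le> emeasure (count_space UNIV) {t \<in> A. f t = 0}"
    using assms by (intro emeasure_mono) auto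
  thus ?thesis using assms by (simp add: num_zeros_def)
qed

lemma num_zeros_le_of_finite_subsets:
  assumes "\<And>F. F \<subseteq> {t \<in> A. f t = 0} \<Longrightarrow> finite F \<Longrightarrow> of_nat (card F) \<le> c"
  shows "num_zeros f A \<le> c"
proof (cases "finite {t \<in> A. f t = 0}")
  case True
  thus ?thesis using assms[of "{t \<in> A. f t = 0}"] by (simp add: num_zeros_def)
next
  case False
  have "of_nat k \<le> c" for k
  proof -
    obtain F where "finite F" "card F = k" "F \<subseteq> {t \<in> A. f t = 0}"
      using infinite_arbitrarily_large[OF False] by blast
    thus ?thesis using assms[of F] by simp
  qed
  hence "c = top"
    by (metis ennreal_Ex_less_of_nat leD less_top)
  thus ?thesis by simp
qed

lemma sign_change_imp_zero:
  fixes f :: "real \<Rightarrow> real"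
  assumes "continuous_on {x..y} f" "f x * f y < 0" "x \<le> y"
  shows "\<exists>z. x < z \<and> z < y \<and> f z = 0"
proof -
  have "\<exists>z. x \<le> z \<and> z \<le> y \<and> f z = 0"
  proof (cases "f x < 0")
    case True
    hence "f y > 0" using assms(2) by (simp add: mult_less_0_iff)
    thus ?thesis using True IVT'[of f x 0 y] assms by auto
  next
    case False
    hence "f x > 0" "f y < 0" using assms(2) by (auto simp: mult_less_0_iff)
    thus ?thesis using IVT2'[of f y 0 x] assms by auto
  qed
  then obtain z where z: "x \<le> z" "z \<le> y" "f z = 0" by blast
  have "z \<noteq> x" "z \<noteq> y" using z assms(2) by auto
  thus ?thesis using z by (intro exI[of _ z]) auto
qed

text \<open>Each cell with a sign change contains a zero in its interior, and the interiors are disjoint.\<close>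
lemma sign_changes_le_num_zeros:
  fixes f :: "real \<Rightarrow> real"
  assumes "continuous_on {u..v} f" "u \<le> v"
  shows "of_nat (sign_changes f u v m) \<le> num_zeros f {u..v}"
proof -
  define I where "I = {i. i < m \<and> f (grid u v m i) * f (grid u v m (Suc i)) < 0}"
  have "\<exists>z. \<forall>i\<in>I. grid u v m i < z i \<and> z i < grid u v m (Suc i) \<and> f (z i) = 0"
  proof (rule bchoice, rule ballI)
    fix i assume "i \<in> I"
    hence i: "i < m" "f (grid u v m i) * f (grid u v m (Suc i)) < 0" by (auto simp: I_def)
    have "{grid u v m i..grid u v m (Suc i)} \<subseteq> {u..v}"
      using grid_ge[OF assms(2), of m i] grid_le[OF assms(2), of "Suc i" m] i by auto
    hence "continuous_on {grid u v m i..grid u v m (Suc i)} f"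
      using assms(1) continuous_on_subset by blast
    thus "\<exists>z. grid u v m i < z \<and> z < grid u v m (Suc i) \<and> f z = 0"
      by (rule sign_change_imp_zero) (use i(2) grid_mono[OF assms(2), of i "Suc i" m] in auto)
  qed
  then obtain z where z: "\<And>i. i \<in> I \<Longrightarrow> grid u v m i < z i \<and> z i < grid u v m (Suc i) \<and> f (z i) = 0"
    by blast
  have mono: "z i < z j" if "i \<in> I" "j \<in> I" "i < j" for i j
    using z[OF that(1)] z[OF that(2)] grid_mono[OF assms(2), of "Suc i" j m] that(3) by auto
  have inj: "inj_on z I"
    by (intro inj_onI) (metis linorder_neqE_nat mono order_less_irrefl)
  have fin: "finite I" by (simp add: I_def)
  have "z ` I \<subseteq> {t \<in> {u..v}. f t = 0}"
  proof
    fix t assume "t \<in> z ` I"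
    then obtain i where i: "i \<in> I" "t = z i" by blast
    hence "i < m" by (simp add: I_def)
    thus "t \<in> {t \<in> {u..v}. f t = 0}"
      using z[OF i(1)] i(2) grid_ge[OF assms(2), of m i] grid_le[OF assms(2), of "Suc i" m] by auto
  qed
  from num_zeros_ge_card[OF this] fin have "of_nat (card (z ` I)) \<le> num_zeros f {u..v}" by simp
  thus ?thesis using card_image[OF inj] by (simp add: sign_changes_def I_def)
qed

lemma simple_zero_sign_change:
  fixes f :: "real \<Rightarrow> real"
  assumes "(f has_real_derivative l) (at z)" "f z = 0" "l \<noteq> 0"
  shows "\<exists>d>0. \<forall>s t. z - d < s \<longrightarrow> s < z \<longrightarrow> z < t \<longrightarrow> t < z + d \<longrightarrow> f s * f t < 0"
proof (cases "l > 0")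
  case True
  obtain d1 where d1: "d1 > 0" "\<And>h. 0 < h \<Longrightarrow> h < d1 \<Longrightarrow> f z < f (z + h)"
    using DERIV_pos_inc_right[OF assms(1) True] by blast
  obtain d2 where d2: "d2 > 0" "\<And>h. 0 < h \<Longrightarrow> h < d2 \<Longrightarrow> f (z - h) < f z"
    using DERIV_pos_inc_left[OF assms(1) True] by blast
  show ?thesis
  proof (intro exI[of _ "min d1 d2"] conjI allI impI)
    fix s t assume "z - min d1 d2 < s" "s < z" "z < t" "t < z + min d1 d2"
    thus "f s * f t < 0" using d1(2)[of "t - z"] d2(2)[of "z - s"] assms(2)
      by (simp add: mult_less_0_iff)
  qed (use d1 d2 in auto)
next
  case False
  hence neg: "l < 0" using assms(3) by simp
  obtain d1 where d1: "d1 > 0" "\<And>h. 0 < h \<Longrightarrow> h < d1 \<Longrightarrow> f z > f (z + h)"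
    using DERIV_neg_dec_right[OF assms(1) neg] by blast
  obtain d2 where d2: "d2 > 0" "\<And>h. 0 < h \<Longrightarrow> h < d2 \<Longrightarrow> f (z - h) > f z"
    using DERIV_neg_dec_left[OF assms(1) neg] by blast
  show ?thesis
  proof (intro exI[of _ "min d1 d2"] conjI allI impI)
    fix s t assume "z - min d1 d2 < s" "s < z" "z < t" "t < z + min d1 d2"
    thus "f s * f t < 0" using d1(2)[of "t - z"] d2(2)[of "z - s"] assms(2)
      by (simp add: mult_less_0_iff)
  qed (use d1 d2 in auto)
qed

lemma grid_cell:
  assumes "u < z" "z < v" "m > 0"
  obtains i where "i < m" "grid u v m i \<le> z" "z < grid u v m (Suc i)"
proof -
  define i where "i = nat \<lfloor>(z - u) * real m / (v - u)\<rfloor>"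
  have uv: "v - u > 0" using assms by simp
  have nn: "(z - u) * real m / (v - u) \<ge> 0" using assms by simp
  have i1: "real i \<le> (z - u) * real m / (v - u)"
    using nn by (simp add: i_def)
  have i2: "(z - u) * real m / (v - u) < real (Suc i)"
    using nn by (simp add: i_def) linarith
  have "(z - u) * real m / (v - u) < real m"
    using assms by (simp add: field_simps)
  hence "i < m" using i1 by linarith
  moreover have "grid u v m i \<le> z"
    using i1 uv assms(3) by (simp add: grid_def field_simps)
  moreover have "z < grid u v m (Suc i)"
    using i2 uv assms(3) by (simp add: grid_def field_simps)
  ultimately show ?thesis using that by blast
qed

text \<open>Near a simple zero the function changes its sign, so a fine grid sees each of finitely many
  zeros. The grid points must avoid the zeros; as the grids are countably many fixed points, a
  random function with no atom at \<open>0\<close> satisfies this almost surely.\<close>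
lemma sign_changes_tendsto_num_zeros:
  fixes f f' :: "real \<Rightarrow> real"
  assumes "u < v"
    and deriv: "\<And>x. (f has_real_derivative f' x) (at x)"
    and simple: "\<And>x. x \<in> {u..v} \<Longrightarrow> f x = 0 \<Longrightarrow> f' x \<noteq> 0"
    and nz: "\<And>m i. i \<le> m \<Longrightarrow> f (grid u v m i) \<noteq> 0"
  shows "(\<lambda>m. of_nat (sign_changes f u v m)) \<longlonglongrightarrow> num_zeros f {u..v}"
proof (rule order_tendstoI)
  have cont: "continuous_on {u..v} f"
    by (meson DERIV_isCont deriv continuous_at_imp_continuous_on)
  fix a :: ennreal
  show "eventually (\<lambda>m. of_nat (sign_changes f u v m) < a) sequentially" if "num_zeros f {u..v} < a"
    using sign_changes_le_num_zeros[OF cont] assms(1) that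
    by (intro always_eventually) (auto intro: le_less_trans)
  show "eventually (\<lambda>m. a < of_nat (sign_changes f u v m)) sequentially" if a: "a < num_zeros f {u..v}"
  proof -
    have "\<not> (\<forall>F. F \<subseteq> {t \<in> {u..v}. f t = 0} \<longrightarrow> finite F \<longrightarrow> of_nat (card F) \<le> a)"
    proof
      assume "\<forall>F. F \<subseteq> {t \<in> {u..v}. f t = 0} \<longrightarrow> finite F \<longrightarrow> of_nat (card F) \<le> a"
      hence "num_zeros f {u..v} \<le> a" by (intro num_zeros_le_of_finite_subsets) blast
      with a show False by simp
    qed
    then obtain F where F: "F \<subseteq> {t \<in> {u..v}. f t = 0}" "finite F" "a < of_nat (card F)"
      by (meson not_le)
    have "\<exists>d. \<forall>z\<in>F. d z > 0 \<and> (\<forall>s t. z - d z < s \<longrightarrow> s < z \<longrightarrow> z < t \<longrightarrow> t < z + d z \<longrightarrow> f s * f t < 0)"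
    proof (rule bchoice, rule ballI)
      fix z assume "z \<in> F"
      hence "z \<in> {u..v}" "f z = 0" using F(1) by auto
      from simple_zero_sign_change[OF deriv this(2) simple[OF this]]
      show "\<exists>d>0. \<forall>s t. z - d < s \<longrightarrow> s < z \<longrightarrow> z < t \<longrightarrow> t < z + d \<longrightarrow> f s * f t < 0"
        by simp
    qed
    then obtain d where d: "\<And>z. z \<in> F \<Longrightarrow> d z > 0"
      "\<And>z s t. z \<in> F \<Longrightarrow> z - d z < s \<Longrightarrow> s < z \<Longrightarrow> z < t \<Longrightarrow> t < z + d z \<Longrightarrow> f s * f t < 0"
      by blast
    define e where "e = Min (insert 1 (d ` F))"
    have e: "e > 0" "\<And>z. z \<in> F \<Longrightarrow> e \<le> d z"
      using F(2) d(1) by (auto simp: e_def)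
    have "(\<lambda>m. (v - u) / real m) \<longlonglongrightarrow> 0"
      by (rule tendsto_divide_0[OF tendsto_const]) (simp add: filterlim_real_sequentially filterlim_at_top_imp_at_infinity)
    hence "eventually (\<lambda>m. (v - u) / real m < e) sequentially"
      using e(1) order_tendstoD(2) by blast
    moreover have "eventually (\<lambda>m::nat. m > 0) sequentially" by (rule eventually_gt_at_top)
    ultimately show ?thesis
    proof eventually_elim
      case (elim m)
      define I where "I = {i. i < m \<and> f (grid u v m i) * f (grid u v m (Suc i)) < 0}"
      have "\<exists>g. \<forall>z\<in>F. g z < m \<and> grid u v m (g z) < z \<and> z < grid u v m (Suc (g z))"
      proof (rule bchoice, rule ballI)
        fix z assume z: "z \<in> F"
        have "f u \<noteq> 0" "f v \<noteq> 0" using nz[of 0 1] nz[of 1 1] by auto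
        hence "u < z" "z < v" using z F(1) by (auto simp: less_le)
        then obtain i where i: "i < m" "grid u v m i \<le> z" "z < grid u v m (Suc i)"
          using grid_cell elim(2) by blast
        moreover have "grid u v m i \<noteq> z" using nz[of i m] i(1) z F(1) by auto
        ultimately show "\<exists>i. i < m \<and> grid u v m i < z \<and> z < grid u v m (Suc i)" by auto
      qed
      then obtain g where g: "\<And>z. z \<in> F \<Longrightarrow> g z < m"
        "\<And>z. z \<in> F \<Longrightarrow> grid u v m (g z) < z" "\<And>z. z \<in> F \<Longrightarrow> z < grid u v m (Suc (g z))"
        by blast
      have close: "z - d z < grid u v m (g z)" "grid u v m (Suc (g z)) < z + d z" if "z \<in> F" for z
        using grid_step[OF elim(2), of u v "g z"] g(2,3)[OF that] e(2)[OF that] elim(1) by linarith+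
      \<comment> \<open>two zeros cannot share a cell: the left one forces a strict sign at the right one\<close>
      have no: "False" if "z \<in> F" "y \<in> F" "g z = g y" "z < y" for z y
      proof -
        have "y < z + d z"
          using g(3)[OF that(2)] close(2)[OF that(1)] that(3) by simp
        hence "f (grid u v m (g z)) * f y < 0"
          using d(2)[OF that(1) close(1)[OF that(1)] g(2)[OF that(1)] that(4)] by blast
        thus False using F(1) that(2) by auto
      qed
      have inj: "inj_on g F"
        by (intro inj_onI) (metis no linorder_neqE)
      have "g ` F \<subseteq> I"
        using d(2) close g by (auto simp: I_def)
      hence "card (g ` F) \<le> card I" by (intro card_mono) (auto simp: I_def)
      hence "card F \<le> sign_changes f u v m"
        using card_image[OF inj] by (simp add: sign_changes_def I_def)
      thus ?case using F(3) by (meson less_le_trans of_nat_mono)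
    qed
  qed
qed

section \<open>Functions with many zeros are small\<close>

text \<open>The bounds by the minimum and the maximum of \<open>Z\<close> keep the zeros of the derivative inside any
  interval containing \<open>Z\<close>, and make the new zero found in the induction step distinct from the
  others.\<close>
lemma rolle_zero_set:
  fixes f f' :: "real \<Rightarrow> real"
  assumes deriv: "\<And>x. (f has_real_derivative f' x) (at x)"
  shows "finite Z \<Longrightarrow> card Z = Suc k \<Longrightarrow> (\<And>z. z \<in> Z \<Longrightarrow> f z = 0) \<Longrightarrow>
    \<exists>Z'. finite Z' \<and> card Z' = k \<and> (\<forall>z\<in>Z'. f' z = 0 \<and> Min Z < z \<and> z < Max Z)"
proof (induction k arbitrary: Z)
  case 0
  show ?case by (intro exI[of _ "{}"]) auto
next
  case (Suc k)
  define m where "m = Max Z"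
  define Y where "Y = Z - {m}"
  have ne: "Z \<noteq> {}" using Suc.prems by auto
  have mZ: "m \<in> Z" unfolding m_def using Suc.prems(1) ne by simp
  have Y: "finite Y" "card Y = Suc k" "\<And>z. z \<in> Y \<Longrightarrow> f z = 0"
    using Suc.prems mZ by (auto simp: Y_def)
  have Yne: "Y \<noteq> {}" using Y by auto
  obtain Z' where Z': "finite Z'" "card Z' = k"
    "\<And>z. z \<in> Z' \<Longrightarrow> f' z = 0 \<and> Min Y < z \<and> z < Max Y"
    using Suc.IH[OF Y] by auto
  have My: "Max Y \<in> Y" using Y(1) Yne by simp
  hence lt: "Max Y < m"
    using Suc.prems(1) unfolding m_def Y_def
    by (metis DiffD1 DiffD2 Max_ge insertI1 less_le)
  have "\<exists>z. Max Y < z \<and> z < m \<and> f' z = 0"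
  proof -
    have "f (Max Y) = f m" using Y(3)[OF My] Suc.prems(3)[OF mZ] by simp
    moreover have "continuous_on {Max Y..m} f"
      by (meson DERIV_isCont deriv continuous_at_imp_continuous_on)
    moreover have "f differentiable (at x)" for x
      using deriv real_differentiable_def by blast
    ultimately obtain z where "Max Y < z" "z < m" "DERIV f z :> 0"
      using Rolle[OF lt] by blast
    thus ?thesis using DERIV_unique deriv by blast
  qed
  then obtain z where z: "Max Y < z" "z < m" "f' z = 0" by blast
  have le: "Min Z \<le> Min Y" using Suc.prems(1) Yne by (intro Min_antimono) (auto simp: Y_def)
  have le2: "Min Y \<le> Max Y" using Y(1) Yne by simp
  have "z \<notin> Z'" using Z'(3) z(1) by force
  thus ?case
    using Z' z lt le le2 by (intro exI[of _ "insert z Z'"]) (fastforce simp: m_def)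
qed

lemma generalized_rolle:
  fixes F :: "nat \<Rightarrow> real \<Rightarrow> real"
  assumes "\<And>j x. (F j has_real_derivative F (Suc j) x) (at x)"
    and "finite Z" "card Z = Suc k" "Z \<subseteq> {u..v}" "\<And>z. z \<in> Z \<Longrightarrow> F 0 z = 0"
  shows "\<exists>\<xi>\<in>{u..v}. F k \<xi> = 0"
  using assms
proof (induction k arbitrary: F Z)
  case 0
  then obtain z where "Z = {z}" by (metis One_nat_def card_1_singletonE)
  thus ?case using "0.prems" by auto
next
  case (Suc k)
  obtain Z' where Z': "finite Z'" "card Z' = Suc k"
    "\<And>z. z \<in> Z' \<Longrightarrow> F (Suc 0) z = 0 \<and> Min Z < z \<and> z < Max Z"
    using rolle_zero_set[of "F 0" "F (Suc 0)" Z "Suc k"] Suc.prems by blast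
  have ne: "Z \<noteq> {}" using Suc.prems by auto
  have "Min Z \<in> Z" "Max Z \<in> Z" using Suc.prems(2) ne by auto
  hence "Z' \<subseteq> {u..v}" using Z'(3) Suc.prems(4) by fastforce
  hence "\<exists>\<xi>\<in>{u..v}. (\<lambda>j. F (Suc j)) k \<xi> = 0"
    using Suc.IH[of "\<lambda>j. F (Suc j)" Z'] Suc.prems Z' by blast
  thus ?case by simp
qed

lemma higher_pderiv_monic:
  fixes p :: "real poly"
  assumes "degree p = k" "lead_coeff p = c"
  shows "(pderiv ^^ k) p = [:c * fact k:]"
  using assms
proof (induction k arbitrary: p c)
  case 0
  then show ?case by (metis degree_eq_zeroE coeff_pCons_0 fact_0 funpow_0 mult.right_neutral)
next
  case (Suc k)
  have "degree (pderiv p) = k" using Suc.prems by (simp add: degree_pderiv)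
  moreover have "lead_coeff (pderiv p) = of_nat (Suc k) * c"
    using Suc.prems calculation by (simp add: coeff_pderiv)
  ultimately have "(pderiv ^^ k) (pderiv p) = [:of_nat (Suc k) * c * fact k:]"
    using Suc.IH by blast
  thus ?case by (simp add: funpow_Suc_right del: funpow.simps) 
qed

text \<open>The error term of polynomial interpolation: \<open>F 0\<close> is interpolated by the zero polynomial at the
  \<open>k\<close> points of \<open>Z\<close>. Many zeros force a function with controlled derivatives to be tiny.\<close>
lemma bound_of_many_zeros:
  fixes F :: "nat \<Rightarrow> real \<Rightarrow> real"
  assumes deriv: "\<And>j x. (F j has_real_derivative F (Suc j) x) (at x)"
    and Z: "finite Z" "card Z = k" "Z \<subseteq> {u..v}" "\<And>z. z \<in> Z \<Longrightarrow> F 0 z = 0"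
    and x0: "x0 \<in> {u..v}"
    and B: "\<And>x. x \<in> {u..v} \<Longrightarrow> \<bar>F k x\<bar> \<le> B"
  shows "\<bar>F 0 x0\<bar> \<le> B * (v - u) ^ k / fact k"
proof (cases "x0 \<in> Z")
  case True
  have "0 \<le> B" using B[OF x0] by linarith
  thus ?thesis using True Z(4) x0 by simp
next
  case False
  define p :: "real poly" where "p = (\<Prod>z\<in>Z. [:- z, 1:])"
  have degp: "degree p = k"
    unfolding p_def using Z(2) by (subst degree_prod_eq_sum_degree) auto
  have lcp: "lead_coeff p = 1" unfolding p_def by (simp add: lead_coeff_prod)
  have evalp: "poly p x = (\<Prod>z\<in>Z. x - z)" for x by (simp add: p_def poly_prod)
  have px0: "poly p x0 \<noteq> 0" using False Z(1) by (auto simp: evalp)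
  \<comment> \<open>with this constant \<open>H 0\<close> has the additional zero \<open>x0\<close>\<close>
  define c where "c = F 0 x0 / poly p x0"
  define H where "H j x = F j x - c * poly ((pderiv ^^ j) p) x" for j x
  have "\<exists>\<xi>\<in>{u..v}. H k \<xi> = 0"
  proof (rule generalized_rolle)
    show "(H j has_real_derivative H (Suc j) x) (at x)" for j x
      unfolding H_def by (auto intro!: derivative_eq_intros deriv simp: poly_DERIV)
    show "finite (insert x0 Z)" "card (insert x0 Z) = Suc k" "insert x0 Z \<subseteq> {u..v}"
      using Z False x0 by auto
    show "H 0 z = 0" if "z \<in> insert x0 Z" for z
      using that Z(1,4) px0 by (auto simp: H_def c_def evalp)
  qed
  then obtain \<xi> where xi: "\<xi> \<in> {u..v}" "H k \<xi> = 0" by blast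
  hence "F k \<xi> = c * fact k"
    by (simp add: H_def higher_pderiv_monic[OF degp lcp])
  hence eq: "F 0 x0 * fact k = F k \<xi> * poly p x0" using px0 by (simp add: c_def field_simps)
  have "\<bar>poly p x0\<bar> \<le> (\<Prod>z\<in>Z. v - u)"
    unfolding evalp abs_prod using Z(3) x0 by (intro prod_mono) (auto simp: abs_le_iff subset_iff)
  hence "\<bar>poly p x0\<bar> \<le> (v - u) ^ k" using Z(2) by simp
  hence "\<bar>F k \<xi>\<bar> * \<bar>poly p x0\<bar> \<le> B * (v - u) ^ k"
    using B[OF xi(1)] by (intro mult_mono) auto
  hence "\<bar>F 0 x0 * fact k\<bar> \<le> B * (v - u) ^ k" by (simp add: eq abs_mult)
  thus ?thesis by (simp add: abs_mult field_simps)
qed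

section \<open>Gaussian spaces\<close>

lemma (in prob_space) expectation_indicator_comp:
  assumes [measurable]: "X \<in> borel_measurable M" "A \<in> sets borel"
  shows "expectation (\<lambda>\<omega>. indicat_real A (X \<omega>)) = prob {\<omega> \<in> space M. X \<omega> \<in> A}"
proof -
  have "expectation (\<lambda>\<omega>. indicat_real A (X \<omega>)) = expectation (indicat_real {\<omega> \<in> space M. X \<omega> \<in> A})"
    by (intro Bochner_Integration.integral_cong) (auto simp: indicator_def)
  thus ?thesis by simp
qed

lemma (in prob_space) integrable_unit_bound:
  fixes g :: "'a \<Rightarrow> 'b::{banach, second_countable_topology}"
  assumes "g \<in> borel_measurable M" "\<And>\<omega>. norm (g \<omega>) \<le> 1"
  shows "integrable M g"
  using assms by (intro integrable_const_bound[where B = 1]) auto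

text \<open>The hypothesis \<open>fact\<close> says that reweighting the probability by \<open>W\<close> leaves the characteristic
  function of \<open>X\<close> unchanged, so by Levy's uniqueness theorem it leaves the law of \<open>X\<close> unchanged.
  In this way a uniqueness theorem on the line gives information on the pair \<open>(X, W)\<close>.\<close>
lemma (in prob_space) weighted_expectation_indicator:
  fixes X W :: "'a \<Rightarrow> real"
  assumes X [measurable]: "X \<in> borel_measurable M" and W [measurable]: "W \<in> borel_measurable M"
    and W0: "\<And>\<omega>. 0 \<le> W \<omega>" and WB: "\<And>\<omega>. W \<omega> \<le> B"
    and pos: "0 < expectation W"
    and fact: "\<And>u. (LINT \<omega>|M. iexp (u * X \<omega>) * of_real (W \<omega>))
                   = (LINT \<omega>|M. iexp (u * X \<omega>)) * of_real (expectation W)"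
    and A [measurable]: "A \<in> sets borel"
  shows "expectation (\<lambda>\<omega>. indicat_real A (X \<omega>) * W \<omega>) = prob {\<omega> \<in> space M. X \<omega> \<in> A} * expectation W"
proof -
  define c where "c = expectation W"
  have c: "c > 0" using pos by (simp add: c_def)
  have Wint: "integrable M W"
    using W0 WB by (intro integrable_const_bound[where B = B]) auto
  define Q where "Q = density M (\<lambda>\<omega>. ennreal (W \<omega> / c))"
  have [measurable_cong]: "sets Q = sets M" by (simp add: Q_def)
  have "emeasure Q (space Q) = (\<integral>\<^sup>+\<omega>. ennreal (W \<omega> / c) \<partial>M)"
    by (simp add: Q_def emeasure_density cong: nn_integral_cong)
  also have "\<dots> = ennreal (LINT \<omega>|M. W \<omega> / c)"
    using Wint W0 c by (intro nn_integral_eq_integral) auto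
  also have "\<dots> = 1" using c by (simp add: c_def)
  finally interpret Q: prob_space Q by (intro prob_spaceI)
  have "char (distr Q borel X) = char (distr M borel X)"
  proof
    fix u
    have "char (distr Q borel X) u = (LINT \<omega>|Q. iexp (u * X \<omega>))"
      unfolding char_def by (subst integral_distr) auto
    also have "\<dots> = (LINT \<omega>|M. (W \<omega> / c) *\<^sub>R iexp (u * X \<omega>))"
      unfolding Q_def using W0 c by (subst integral_density) auto
    also have "\<dots> = (LINT \<omega>|M. (iexp (u * X \<omega>) * of_real (W \<omega>)) / of_real c)"
      by (intro Bochner_Integration.integral_cong) (auto simp: scaleR_conv_of_real)
    also have "\<dots> = (LINT \<omega>|M. iexp (u * X \<omega>))"
      using fact[of u] c by (simp add: c_def)
    also have "\<dots> = char (distr M borel X) u"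
      unfolding char_def by (subst integral_distr) auto
    finally show "char (distr Q borel X) u = char (distr M borel X) u" .
  qed
  hence eq: "distr Q borel X = distr M borel X"
    by (intro Levy_uniqueness real_distribution_distr Q.real_distribution_distr) auto
  have "prob {\<omega> \<in> space M. X \<omega> \<in> A} = (LINT \<omega>|M. indicat_real A (X \<omega>))"
    by (simp add: expectation_indicator_comp)
  also have "\<dots> = (LINT x|distr Q borel X. indicat_real A x)"
    unfolding eq by (subst integral_distr) auto
  also have "\<dots> = (LINT \<omega>|Q. indicat_real A (X \<omega>))"
    by (subst integral_distr) auto
  also have "\<dots> = (LINT \<omega>|M. (W \<omega> / c) *\<^sub>R indicator A (X \<omega>))"
    unfolding Q_def using W0 c by (subst integral_density) auto
  also have "\<dots> = expectation (\<lambda>\<omega>. indicat_real A (X \<omega>) * W \<omega>) / c"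
    by (subst integral_divide_zero[symmetric]) (intro Bochner_Integration.integral_cong, auto)
  finally show ?thesis using c by (simp add: c_def)
qed

text \<open>A linear space of centered Gaussian variables. Gaussianity is expressed by the characteristic
  function, which covers degenerate variables uniformly and behaves well under sums.\<close>
locale gaussian_space = prob_space M for M :: "'w measure" +
  fixes V :: "('w \<Rightarrow> real) set"
  assumes zero: "(\<lambda>_. 0) \<in> V"
    and lin: "\<And>X Y c d. X \<in> V \<Longrightarrow> Y \<in> V \<Longrightarrow> (\<lambda>\<omega>. c * X \<omega> + d * Y \<omega>) \<in> V"
    and meas: "\<And>X. X \<in> V \<Longrightarrow> X \<in> borel_measurable M"
    and sq_int: "\<And>X. X \<in> V \<Longrightarrow> integrable M (\<lambda>\<omega>. (X \<omega>)\<^sup>2)"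
    and char_exp: "\<And>X. X \<in> V \<Longrightarrow>
      (LINT \<omega>|M. iexp (X \<omega>)) = of_real (exp (- (LINT \<omega>|M. (X \<omega>)\<^sup>2) / 2))"
begin

definition ip :: "('w \<Rightarrow> real) \<Rightarrow> ('w \<Rightarrow> real) \<Rightarrow> real" where
  "ip X Y = (LINT \<omega>|M. X \<omega> * Y \<omega>)"

lemma scale: "X \<in> V \<Longrightarrow> (\<lambda>\<omega>. c * X \<omega>) \<in> V"
  using lin[of X X c 0] by simp

lemma sum_in:
  assumes "finite I" "\<And>k. k \<in> I \<Longrightarrow> X k \<in> V"
  shows "(\<lambda>\<omega>. \<Sum>k\<in>I. c k * X k \<omega>) \<in> V"
  using assms
proof (induction I rule: finite_induct)
  case (insert k I)
  thus ?case using lin[of "X k" "\<lambda>\<omega>. \<Sum>k\<in>I. c k * X k \<omega>" "c k" 1] by simp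
qed (simp add: zero)

lemma mult_int: "X \<in> V \<Longrightarrow> Y \<in> V \<Longrightarrow> integrable M (\<lambda>\<omega>. X \<omega> * Y \<omega>)"
proof (rule Bochner_Integration.integrable_bound)
  assume X: "X \<in> V" and Y: "Y \<in> V"
  note [measurable] = meas[OF X] meas[OF Y]
  show "integrable M (\<lambda>\<omega>. (X \<omega>)\<^sup>2 + (Y \<omega>)\<^sup>2)" using sq_int X Y by auto
  show "(\<lambda>\<omega>. X \<omega> * Y \<omega>) \<in> borel_measurable M" by measurable
  have "\<bar>x * y\<bar> \<le> x\<^sup>2 + y\<^sup>2" for x y :: real
    using sum_squares_bound[of x y] sum_squares_bound[of x "- y"] zero_le_power2[of x] zero_le_power2[of y]
    unfolding abs_le_iff by simp
  thus "AE \<omega> in M. norm (X \<omega> * Y \<omega>) \<le> norm ((X \<omega>)\<^sup>2 + (Y \<omega>)\<^sup>2)"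
    by (intro AE_I2) (smt (verit) real_norm_def)
qed

lemma ip_commute: "ip X Y = ip Y X"
  by (simp add: ip_def mult.commute)

lemma ip_lin_left:
  "X \<in> V \<Longrightarrow> Y \<in> V \<Longrightarrow> Z \<in> V \<Longrightarrow> ip (\<lambda>\<omega>. c * X \<omega> + d * Y \<omega>) Z = c * ip X Z + d * ip Y Z"
  using mult_int by (simp add: ip_def distrib_right mult.assoc)

lemma ip_scale_left: "ip (\<lambda>\<omega>. c * X \<omega>) Z = c * ip X Z"
  by (simp add: ip_def mult.assoc)

lemma ip_lin_right:
  "X \<in> V \<Longrightarrow> Y \<in> V \<Longrightarrow> Z \<in> V \<Longrightarrow> ip Z (\<lambda>\<omega>. c * X \<omega> + d * Y \<omega>) = c * ip Z X + d * ip Z Y"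
  by (simp add: ip_commute[of Z] ip_lin_left)

lemma ip_sum_left:
  assumes "finite I" "\<And>k. k \<in> I \<Longrightarrow> X k \<in> V" "Z \<in> V"
  shows "ip (\<lambda>\<omega>. \<Sum>k\<in>I. c k * X k \<omega>) Z = (\<Sum>k\<in>I. c k * ip (X k) Z)"
  using assms mult_int by (simp add: ip_def sum_distrib_right mult.assoc)

lemma ip_nonneg: "0 \<le> ip X X"
  by (simp add: ip_def)

lemma char_scale:
  assumes "X \<in> V"
  shows "(LINT \<omega>|M. iexp (u * X \<omega>)) = of_real (exp (- (u\<^sup>2 * ip X X) / 2))"
  using char_exp[OF scale[OF assms, of u]]
  by (simp add: ip_def power_mult_distrib power2_eq_square mult_ac)

lemma iexp_int: "X \<in> borel_measurable M \<Longrightarrow> integrable M (\<lambda>\<omega>. iexp (X \<omega>))"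
  using integrable_iexp[of X] by simp

lemma char_pair:
  assumes X: "X \<in> V" and Z: "Z \<in> V" and orth: "ip X Z = 0"
  shows "(LINT \<omega>|M. iexp (u * X \<omega>) * iexp (v * Z \<omega>))
    = of_real (exp (- (u\<^sup>2 * ip X X) / 2)) * of_real (exp (- (v\<^sup>2 * ip Z Z) / 2))"
proof -
  define T where "T = (\<lambda>\<omega>. u * X \<omega> + v * Z \<omega>)"
  have T: "T \<in> V" unfolding T_def using lin X Z by blast
  have "ip T T = u * ip X T + v * ip Z T"
    using X Z T unfolding T_def by (intro ip_lin_left)
  also have "ip X T = u * ip X X" unfolding T_def using ip_lin_right[OF X Z X, of u v] orth by simp
  also have "ip Z T = v * ip Z Z" unfolding T_def using ip_lin_right[OF X Z Z, of u v] orth by (simp add: ip_commute)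
  finally have ipT: "ip T T = u\<^sup>2 * ip X X + v\<^sup>2 * ip Z Z" by (simp add: power2_eq_square)
  have "(LINT \<omega>|M. iexp (u * X \<omega>) * iexp (v * Z \<omega>)) = (LINT \<omega>|M. iexp (T \<omega>))"
    by (simp add: T_def mult_exp_exp distrib_left)
  also have "\<dots> = of_real (exp (- ip T T / 2))" using char_scale[OF T, of 1] by simp
  also have "- ip T T / 2 = - (u\<^sup>2 * ip X X) / 2 + - (v\<^sup>2 * ip Z Z) / 2"
    unfolding ipT by (simp add: field_simps)
  finally show ?thesis unfolding exp_add of_real_mult .
qed

text \<open>Real and imaginary parts in the second variable, because the weights used for changes of measure
  have to be real.\<close>
lemma char_weighted:
  assumes X: "X \<in> V" and Z: "Z \<in> V" and orth: "ip X Z = 0"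
  shows "(LINT \<omega>|M. iexp (u * X \<omega>) * of_real (cos (v * Z \<omega>)))
      = of_real (exp (- (u\<^sup>2 * ip X X) / 2)) * of_real (exp (- (v\<^sup>2 * ip Z Z) / 2))" (is ?C)
    and "(LINT \<omega>|M. iexp (u * X \<omega>) * of_real (sin (v * Z \<omega>))) = 0" (is ?S)
proof -
  note [measurable] = meas[OF X] meas[OF Z]
  let ?p = "\<lambda>\<omega>. iexp (u * X \<omega>) * iexp (v * Z \<omega>)"
  let ?m = "\<lambda>\<omega>. iexp (u * X \<omega>) * iexp ((- v) * Z \<omega>)"
  have int': "integrable M (\<lambda>\<omega>. iexp (u * X \<omega>) * iexp (w * Z \<omega>))" for w
  proof (rule integrable_unit_bound)
    show "(\<lambda>\<omega>. iexp (u * X \<omega>) * iexp (w * Z \<omega>)) \<in> borel_measurable M" by measurable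
    show "cmod (iexp (u * X \<omega>) * iexp (w * Z \<omega>)) \<le> 1" for \<omega>
      by (simp only: norm_mult norm_exp_i_times mult_1 order_refl)
  qed
  note int = int'[of v] int'[of "- v"]
  have c: "complex_of_real (cos t) = (iexp t + iexp (- t)) / 2"
    and s: "complex_of_real (sin t) = (iexp t - iexp (- t)) / (2 * \<i>)" for t
    using cos_exp_eq[of "of_real t"] sin_exp_eq[of "of_real t"] by (simp_all add: cos_of_real sin_of_real)
  have avg: "(x + x) / 2 = x" for x :: complex by simp
  have "(LINT \<omega>|M. iexp (u * X \<omega>) * of_real (cos (v * Z \<omega>))) = (LINT \<omega>|M. (?p \<omega> + ?m \<omega>) / 2)"
    unfolding c by (intro Bochner_Integration.integral_cong) (auto simp: field_simps)
  also have "\<dots> = ((LINT \<omega>|M. ?p \<omega>) + (LINT \<omega>|M. ?m \<omega>)) / 2" using int by simp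
  finally show ?C unfolding char_pair[OF X Z orth] power2_minus by (simp only: avg)
  have "(LINT \<omega>|M. iexp (u * X \<omega>) * of_real (sin (v * Z \<omega>))) = (LINT \<omega>|M. (?p \<omega> - ?m \<omega>) / (2 * \<i>))"
    unfolding s by (intro Bochner_Integration.integral_cong) (auto simp: field_simps)
  also have "\<dots> = ((LINT \<omega>|M. ?p \<omega>) - (LINT \<omega>|M. ?m \<omega>)) / (2 * \<i>)" using int by simp
  finally show ?S unfolding char_pair[OF X Z orth] power2_minus by (simp only: diff_self div_0)
qed

lemma expectation_trig:
  assumes Z: "Z \<in> V"
  shows "expectation (\<lambda>\<omega>. cos (v * Z \<omega>)) = exp (- (v\<^sup>2 * ip Z Z) / 2)"
    and "expectation (\<lambda>\<omega>. sin (v * Z \<omega>)) = 0"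
proof -
  have "ip (\<lambda>_. 0) Z = 0" by (simp add: ip_def)
  note cw = char_weighted[OF zero Z this, of 0 v]
  have "(LINT \<omega>|M. complex_of_real (cos (v * Z \<omega>))) = of_real (exp (- (v\<^sup>2 * ip Z Z) / 2))"
    using cw(1) by simp
  thus "expectation (\<lambda>\<omega>. cos (v * Z \<omega>)) = exp (- (v\<^sup>2 * ip Z Z) / 2)"
    unfolding integral_complex_of_real of_real_eq_iff .
  have "(LINT \<omega>|M. complex_of_real (sin (v * Z \<omega>))) = 0"
    using cw(2) by simp
  thus "expectation (\<lambda>\<omega>. sin (v * Z \<omega>)) = 0"
    unfolding integral_complex_of_real of_real_eq_0_iff .
qed

text \<open>Uncorrelated elements of a Gaussian space are independent. The law is reweighted twice. The
  nonnegative weights \<open>1 + cos (v Z)\<close> and \<open>1 + sin (v Z)\<close> do not change the law of \<open>X\<close>, which gives the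
  expectation of \<open>e\<^sup>i\<^sup>v\<^sup>Z\<close> on the event \<open>X \<in> A\<close> for all \<open>v\<close>. This says that the weight \<open>1\<^sub>A (X)\<close>
  does not change the law of \<open>Z\<close>.\<close>
lemma indep_rectangle:
  assumes X: "X \<in> V" and Z: "Z \<in> V" and orth: "ip X Z = 0"
    and A [measurable]: "A \<in> sets borel" and B [measurable]: "B \<in> sets borel"
  shows "prob {\<omega> \<in> space M. X \<omega> \<in> A \<and> Z \<omega> \<in> B}
    = prob {\<omega> \<in> space M. X \<omega> \<in> A} * prob {\<omega> \<in> space M. Z \<omega> \<in> B}"
proof -
  note [measurable] = meas[OF X] meas[OF Z]
  have ci: "integrable M (\<lambda>\<omega>. cos (v * Z \<omega>))" "integrable M (\<lambda>\<omega>. sin (v * Z \<omega>))" for v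
    by (rule integrable_unit_bound; simp)+
  have Ii: "integrable M (\<lambda>\<omega>. indicator A (X \<omega>) :: real)"
    by (rule integrable_unit_bound) (auto simp: indicator_def)
  have Ici: "integrable M (\<lambda>\<omega>. indicator A (X \<omega>) * cos (v * Z \<omega>))"
       "integrable M (\<lambda>\<omega>. indicator A (X \<omega>) * sin (v * Z \<omega>))" for v
    by (rule integrable_unit_bound; simp add: indicator_def)+
  have Eci: "integrable M (\<lambda>\<omega>. iexp (u * X \<omega>) * of_real (g (v * Z \<omega>)))"
    if [measurable]: "g \<in> borel_measurable borel" and g: "\<And>x. \<bar>g x\<bar> \<le> 1" for g :: "real \<Rightarrow> real" and u v
  proof (rule integrable_unit_bound)
    show "(\<lambda>\<omega>. iexp (u * X \<omega>) * of_real (g (v * Z \<omega>))) \<in> borel_measurable M" by measurable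
    show "cmod (iexp (u * X \<omega>) * of_real (g (v * Z \<omega>))) \<le> 1" for \<omega>
      by (simp only: norm_mult norm_exp_i_times norm_of_real mult_1 g)
  qed
  note Eci = Eci[of cos, simplified] Eci[of sin, simplified]
  have Ei: "integrable M (\<lambda>\<omega>. iexp (u * X \<omega>))" for u
    by (intro iexp_int) measurable
  let ?PA = "prob {\<omega> \<in> space M. X \<omega> \<in> A}"
  have PA: "expectation (\<lambda>\<omega>. indicat_real A (X \<omega>)) = ?PA"
    by (simp add: expectation_indicator_comp)
  \<comment> \<open>the law of \<open>X\<close> is stable under the first weight; the second is treated in the same way below\<close>
  have cosA: "expectation (\<lambda>\<omega>. indicat_real A (X \<omega>) * cos (v * Z \<omega>)) = ?PA * exp (- (v\<^sup>2 * ip Z Z) / 2)" for v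
  proof -
    have e: "expectation (\<lambda>\<omega>. 1 + cos (v * Z \<omega>)) = 1 + exp (- (v\<^sup>2 * ip Z Z) / 2)"
      using ci by (simp add: expectation_trig[OF Z] prob_space)
    have "expectation (\<lambda>\<omega>. indicat_real A (X \<omega>) * (1 + cos (v * Z \<omega>))) = ?PA * expectation (\<lambda>\<omega>. 1 + cos (v * Z \<omega>))"
    proof (rule weighted_expectation_indicator[where B = 2])
      show "0 \<le> 1 + cos (v * Z \<omega>)" "1 + cos (v * Z \<omega>) \<le> 2" for \<omega>
        using cos_ge_minus_one[of "v * Z \<omega>"] cos_le_one[of "v * Z \<omega>"] by linarith+
      show "0 < expectation (\<lambda>\<omega>. 1 + cos (v * Z \<omega>))" unfolding e by (smt (verit) exp_gt_zero)
      fix u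
      have "(LINT \<omega>|M. iexp (u * X \<omega>) * of_real (1 + cos (v * Z \<omega>)))
          = (LINT \<omega>|M. iexp (u * X \<omega>)) + (LINT \<omega>|M. iexp (u * X \<omega>) * of_real (cos (v * Z \<omega>)))"
        using Eci Ei by (simp add: distrib_left)
      thus "(LINT \<omega>|M. iexp (u * X \<omega>) * of_real (1 + cos (v * Z \<omega>)))
          = (LINT \<omega>|M. iexp (u * X \<omega>)) * of_real (expectation (\<lambda>\<omega>. 1 + cos (v * Z \<omega>)))"
        unfolding e char_weighted[OF X Z orth] char_scale[OF X] by (simp add: distrib_left)
    qed measurable
    thus ?thesis unfolding e using Ii Ici by (simp add: distrib_left PA)
  qed
  have sinA: "expectation (\<lambda>\<omega>. indicat_real A (X \<omega>) * sin (v * Z \<omega>)) = 0" for v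
  proof -
    have e: "expectation (\<lambda>\<omega>. 1 + sin (v * Z \<omega>)) = 1"
      using ci by (simp add: expectation_trig[OF Z] prob_space)
    have "expectation (\<lambda>\<omega>. indicat_real A (X \<omega>) * (1 + sin (v * Z \<omega>))) = ?PA * expectation (\<lambda>\<omega>. 1 + sin (v * Z \<omega>))"
    proof (rule weighted_expectation_indicator[where B = 2])
      show "0 \<le> 1 + sin (v * Z \<omega>)" "1 + sin (v * Z \<omega>) \<le> 2" for \<omega>
        using sin_ge_minus_one[of "v * Z \<omega>"] sin_le_one[of "v * Z \<omega>"] by linarith+
      show "0 < expectation (\<lambda>\<omega>. 1 + sin (v * Z \<omega>))" unfolding e by simp
      fix u
      have "(LINT \<omega>|M. iexp (u * X \<omega>) * of_real (1 + sin (v * Z \<omega>)))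
          = (LINT \<omega>|M. iexp (u * X \<omega>)) + (LINT \<omega>|M. iexp (u * X \<omega>) * of_real (sin (v * Z \<omega>)))"
        using Eci Ei by (simp add: distrib_left)
      thus "(LINT \<omega>|M. iexp (u * X \<omega>) * of_real (1 + sin (v * Z \<omega>)))
          = (LINT \<omega>|M. iexp (u * X \<omega>)) * of_real (expectation (\<lambda>\<omega>. 1 + sin (v * Z \<omega>)))"
        unfolding e char_weighted[OF X Z orth] by simp
    qed measurable
    thus ?thesis unfolding e using Ii Ici by (simp add: distrib_left PA)
  qed
  show ?thesis
  proof (cases "?PA = 0")
    case True
    have "prob {\<omega> \<in> space M. X \<omega> \<in> A \<and> Z \<omega> \<in> B} \<le> ?PA" by (intro finite_measure_mono) auto
    thus ?thesis using True measure_nonneg[of M "{\<omega> \<in> space M. X \<omega> \<in> A \<and> Z \<omega> \<in> B}"] by simp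
  next
    case False
    \<comment> \<open>the roles change: the event \<open>X \<in> A\<close> is the weight and \<open>Z\<close> the variable\<close>
    have "expectation (\<lambda>\<omega>. indicat_real B (Z \<omega>) * indicator A (X \<omega>))
        = prob {\<omega> \<in> space M. Z \<omega> \<in> B} * expectation (\<lambda>\<omega>. indicat_real A (X \<omega>))"
    proof (rule weighted_expectation_indicator[where B = 1])
      show "0 < expectation (\<lambda>\<omega>. indicat_real A (X \<omega>))"
        unfolding PA using False by (simp add: zero_less_measure_iff)
      fix v
      have "iexp t * of_real x = of_real (x * cos t) + \<i> * of_real (x * sin t)" for t x :: real
        by (simp add: exp_Euler cos_of_real sin_of_real algebra_simps)
      hence "iexp (v * Z \<omega>) * of_real (indicator A (X \<omega>))
          = of_real (indicator A (X \<omega>) * cos (v * Z \<omega>)) + \<i> * of_real (indicator A (X \<omega>) * sin (v * Z \<omega>))" for \<omega>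
        by blast
      hence "(LINT \<omega>|M. iexp (v * Z \<omega>) * of_real (indicator A (X \<omega>)))
          = (LINT \<omega>|M. of_real (indicator A (X \<omega>) * cos (v * Z \<omega>)) + \<i> * of_real (indicator A (X \<omega>) * sin (v * Z \<omega>)))"
        by (intro Bochner_Integration.integral_cong) auto
      also have "\<dots> = of_real (?PA * exp (- (v\<^sup>2 * ip Z Z) / 2))"
        using Ici by (subst Bochner_Integration.integral_add)
          (simp_all only: integrable_of_real integrable_mult_right integral_complex_of_real integral_mult_right_zero cosA sinA, auto)
      finally show "(LINT \<omega>|M. iexp (v * Z \<omega>) * of_real (indicator A (X \<omega>)))
          = (LINT \<omega>|M. iexp (v * Z \<omega>)) * of_real (expectation (\<lambda>\<omega>. indicat_real A (X \<omega>)))"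
        unfolding char_scale[OF Z] PA by simp
    qed (auto simp: indicator_def)
    moreover have "expectation (\<lambda>\<omega>. indicat_real B (Z \<omega>) * indicator A (X \<omega>))
        = prob {\<omega> \<in> space M. X \<omega> \<in> A \<and> Z \<omega> \<in> B}"
    proof -
      have "expectation (\<lambda>\<omega>. indicat_real B (Z \<omega>) * indicator A (X \<omega>))
          = expectation (indicat_real {\<omega> \<in> space M. X \<omega> \<in> A \<and> Z \<omega> \<in> B})"
        by (intro Bochner_Integration.integral_cong) (auto simp: indicator_def)
      thus ?thesis by simp
    qed
    ultimately show ?thesis unfolding PA by simp
  qed
qed

lemma joint_distr_eq_pair:
  assumes X: "X \<in> V" and Z: "Z \<in> V" and orth: "ip X Z = 0"
  shows "distr M (borel \<Otimes>\<^sub>M borel) (\<lambda>\<omega>. (X \<omega>, Z \<omega>)) = distr M borel X \<Otimes>\<^sub>M distr M borel Z"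
proof -
  note [measurable] = meas[OF X] meas[OF Z]
  interpret DX: prob_space "distr M borel X" by (rule prob_space_distr) measurable
  interpret DZ: prob_space "distr M borel Z" by (rule prob_space_distr) measurable
  have "distr M borel X \<Otimes>\<^sub>M distr M borel Z = distr M (borel \<Otimes>\<^sub>M borel) (\<lambda>\<omega>. (X \<omega>, Z \<omega>))"
  proof (rule pair_measure_eqI)
    fix A B assume "A \<in> sets (distr M borel X)" "B \<in> sets (distr M borel Z)"
    hence [measurable]: "A \<in> sets borel" "B \<in> sets borel" by auto
    have "emeasure (distr M (borel \<Otimes>\<^sub>M borel) (\<lambda>\<omega>. (X \<omega>, Z \<omega>))) (A \<times> B)
        = emeasure M {\<omega> \<in> space M. X \<omega> \<in> A \<and> Z \<omega> \<in> B}"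
      by (subst emeasure_distr) (auto intro!: arg_cong[where f = "emeasure M"])
    also have "\<dots> = ennreal (prob {\<omega> \<in> space M. X \<omega> \<in> A} * prob {\<omega> \<in> space M. Z \<omega> \<in> B})"
      using indep_rectangle[OF X Z orth, of A B] by (simp add: emeasure_eq_measure)
    also have "\<dots> = emeasure M {\<omega> \<in> space M. X \<omega> \<in> A} * emeasure M {\<omega> \<in> space M. Z \<omega> \<in> B}"
      by (simp add: emeasure_eq_measure ennreal_mult)
    also have "\<dots> = emeasure (distr M borel X) A * emeasure (distr M borel Z) B"
      by (subst (1 2) emeasure_distr) (auto intro!: arg_cong2[where f = "(*)"] arg_cong[where f = "emeasure M"])
    finally show "emeasure (distr M borel X) A * emeasure (distr M borel Z) B =
      emeasure (distr M (borel \<Otimes>\<^sub>M borel) (\<lambda>\<omega>. (X \<omega>, Z \<omega>))) (A \<times> B)" by simp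
  next
    show "sigma_finite_measure (distr M borel X)" "sigma_finite_measure (distr M borel Z)" by unfold_locales
    show "sets (distr M borel X \<Otimes>\<^sub>M distr M borel Z) = sets (distr M (borel \<Otimes>\<^sub>M borel) (\<lambda>\<omega>. (X \<omega>, Z \<omega>)))"
      by (simp cong: sets_pair_measure_cong)
  qed
  thus ?thesis by simp
qed

lemma distr_std:
  assumes X: "X \<in> V" and "ip X X = 1"
  shows "distr M borel X = std_normal_distribution"
proof (rule Levy_uniqueness)
  note [measurable] = meas[OF X]
  show "real_distribution (distr M borel X)" by auto
  show "real_distribution std_normal_distribution" by (rule real_dist_normal_dist)
  show "char (distr M borel X) = char std_normal_distribution"
    unfolding char_std_normal_distribution
  proof
    fix u
    have "char (distr M borel X) u = (LINT \<omega>|M. iexp (u * X \<omega>))"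
      unfolding char_def by (subst integral_distr) auto
    thus "char (distr M borel X) u = complex_of_real (exp (- u\<^sup>2 / 2))"
      unfolding char_scale[OF X] assms(2) by simp
  qed
qed

end

section \<open>Small values and opposite signs of Gaussian pairs\<close>

lemma std_normal_interval_le:
  assumes "a \<le> b"
  shows "measure std_normal_distribution {a..b} \<le> (b - a) / 2"
proof -
  interpret real_distribution std_normal_distribution by (rule real_dist_normal_dist)
  have d: "std_normal_density x \<le> 1 / 2" for x
  proof -
    have "sqrt (2 * pi) \<ge> sqrt (2\<^sup>2)" using pi_gt3 by (intro real_sqrt_le_mono) simp
    hence "1 / sqrt (2 * pi) \<le> 1 / 2" by (intro divide_left_mono) auto
    moreover have "exp (- x\<^sup>2 / 2) \<le> 1" by simp
    ultimately have "1 / sqrt (2 * pi) * exp (- x\<^sup>2 / 2) \<le> 1 / 2 * 1" by (intro mult_mono) auto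
    thus ?thesis by (simp add: std_normal_density_def)
  qed
  have "emeasure std_normal_distribution {a..b} = (\<integral>\<^sup>+x. ennreal (std_normal_density x) * indicator {a..b} x \<partial>lborel)"
    by (subst emeasure_density) auto
  also have "\<dots> \<le> (\<integral>\<^sup>+x. ennreal (1 / 2) * indicator {a..b} x \<partial>lborel)"
    using d by (intro nn_integral_mono mult_right_mono ennreal_leI) auto
  also have "\<dots> = ennreal (1 / 2) * ennreal (b - a)"
    using assms by (subst nn_integral_cmult_indicator) auto
  also have "\<dots> = ennreal ((b - a) / 2)"
    using assms by (subst ennreal_mult[symmetric]) auto
  finally show ?thesis
    using assms by (simp add: emeasure_eq_measure)
qed

text \<open>Cauchy's functional equation: a nonnegative additive function is monotone, hence linear.\<close>
lemma additive_nonneg_imp_linear: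
  fixes g :: "real \<Rightarrow> real"
  assumes c: "c > 0" and nonneg: "\<And>t. 0 \<le> t \<Longrightarrow> t \<le> c \<Longrightarrow> 0 \<le> g t"
    and add: "\<And>s t. 0 \<le> s \<Longrightarrow> 0 \<le> t \<Longrightarrow> s + t \<le> c \<Longrightarrow> g (s + t) = g s + g t"
    and t: "0 \<le> t" "t \<le> c"
  shows "g t = t / c * g c"
proof -
  have mono: "g s \<le> g u" if "0 \<le> s" "s \<le> u" "u \<le> c" for s u
    using add[of s "u - s"] nonneg[of "u - s"] that by simp
  have g0: "g 0 = 0" using add[of 0 0] c by simp
  have mult: "g (real k * x) = real k * g x" if "0 \<le> x" "real k * x \<le> c" for k x
    using that(2)
  proof (induction k)
    case (Suc k)
    have "g (real k * x + x) = g (real k * x) + g x"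
      using Suc.prems that(1) by (intro add) (auto simp: algebra_simps)
    thus ?case using Suc that(1) by (simp add: algebra_simps)
  qed (simp add: g0)
  have "\<bar>g t - t / c * g c\<bar> \<le> g c / real m" if m: "m > 0" for m :: nat
  proof -
    \<comment> \<open>up to one step of size \<open>c / m\<close>, both sides agree with a multiple of \<open>g (c / m)\<close>\<close>
    define x where "x = c / real m"
    have x: "x > 0" "real m * x = c" using c m by (auto simp: x_def)
    have gx: "g c = real m * g x" using mult[of x m] x by simp
    define k where "k = nat \<lfloor>t / x\<rfloor>"
    have k1: "real k * x \<le> t" and k2: "t < real (Suc k) * x"
    proof -
      have "real k \<le> t / x" "t / x < real k + 1" using t x unfolding k_def by (auto; linarith)+
      thus "real k * x \<le> t" "t < real (Suc k) * x" using x by (auto simp: field_simps)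
    qed
    have lo: "real k * g x \<le> g t"
      using mult[of x k] mono[of "real k * x" t] k1 t x by simp
    have gxn: "0 \<le> g x" using nonneg[of x] x m c by (simp add: x_def field_simps)
    have hi: "g t \<le> (real k + 1) * g x"
    proof (cases "real (Suc k) * x \<le> c")
      case True
      thus ?thesis using mult[of x "Suc k"] mono[of t "real (Suc k) * x"] k2 t x by (simp add: add.commute)
    next
      case False
      hence "real m * x < real (Suc k) * x" using x by simp
      hence "real m < real (Suc k)" using x(1) mult_less_cancel_right_pos by blast
      hence "m \<le> k" by simp
      hence "g t \<le> real m * g x" using mono[of t c] t gx by simp
      also have "\<dots> \<le> (real k + 1) * g x" using \<open>m \<le> k\<close> gxn by (intro mult_right_mono) auto
      finally show ?thesis .
    qed
    have tc: "t / c * g c = t / x * g x" using gx x c m by (simp add: x_def field_simps)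
    have "real k \<le> t / x" "t / x \<le> real k + 1" using k1 k2 x by (auto simp: field_simps)
    hence "real k * g x \<le> t / x * g x" "t / x * g x \<le> (real k + 1) * g x"
      using mult_right_mono[OF _ gxn] by blast+
    hence "\<bar>g t - t / c * g c\<bar> \<le> g x" using lo hi tc by (simp add: abs_le_iff algebra_simps)
    also have "g x = g c / real m" using gx m by simp
    finally show ?thesis .
  qed
  hence "\<bar>g t - t / c * g c\<bar> \<le> 0"
    by (intro LIMSEQ_le_const[OF lim_const_over_n[of "g c"]]) (auto intro!: exI[of _ 1])
  thus ?thesis by simp
qed

context gaussian_space
begin

lemma ip_scale_right: "ip Z (\<lambda>\<omega>. c * X \<omega>) = c * ip Z X"
  by (simp add: ip_def mult.left_commute)

lemma prob_interval_le:
  assumes X: "X \<in> V" and v: "ip X X > 0" and ab: "a \<le> b"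
  shows "prob {\<omega> \<in> space M. a \<le> X \<omega> \<and> X \<omega> \<le> b} \<le> (b - a) / (2 * sqrt (ip X X))"
proof -
  note [measurable] = meas[OF X]
  define s where "s = sqrt (ip X X)"
  have s: "s > 0" "s * s = ip X X" using v by (auto simp: s_def)
  define Y where "Y = (\<lambda>\<omega>. (1 / s) * X \<omega>)"
  have Y: "Y \<in> V" unfolding Y_def using scale[OF X] .
  have "ip Y Y = (1 / s) * ((1 / s) * ip X X)"
    unfolding Y_def ip_scale_left ip_scale_right ..
  hence "ip Y Y = 1" using s(1) unfolding s(2)[symmetric] by simp
  from distr_std[OF Y this] have D: "distr M borel Y = std_normal_distribution" .
  have [measurable]: "Y \<in> borel_measurable M" using meas[OF Y] .
  have "{\<omega> \<in> space M. a \<le> X \<omega> \<and> X \<omega> \<le> b} = Y -` {a / s..b / s} \<inter> space M"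
    using s by (auto simp: Y_def field_simps)
  hence "prob {\<omega> \<in> space M. a \<le> X \<omega> \<and> X \<omega> \<le> b} = measure std_normal_distribution {a / s..b / s}"
    unfolding D[symmetric] by (simp add: measure_distr)
  also have "\<dots> \<le> (b / s - a / s) / 2" using ab s by (intro std_normal_interval_le) (simp add: divide_right_mono)
  finally show ?thesis using s by (simp add: s_def[symmetric] field_simps)
qed

lemma prob_abs_le:
  assumes "X \<in> V" "ip X X > 0" "0 \<le> t"
  shows "prob {\<omega> \<in> space M. \<bar>X \<omega>\<bar> \<le> t} \<le> t / sqrt (ip X X)"
proof -
  have "{\<omega> \<in> space M. \<bar>X \<omega>\<bar> \<le> t} = {\<omega> \<in> space M. - t \<le> X \<omega> \<and> X \<omega> \<le> t}" by auto
  thus ?thesis using prob_interval_le[OF assms(1,2), of "- t" t] assms(3) by simp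
qed

lemma AE_nonzero:
  assumes "X \<in> V" "ip X X > 0"
  shows "AE \<omega> in M. X \<omega> \<noteq> 0"
proof -
  note [measurable] = meas[OF assms(1)]
  have "prob {\<omega> \<in> space M. X \<omega> = 0} = 0"
    using prob_abs_le[OF assms, of 0] measure_nonneg[of M "{\<omega> \<in> space M. X \<omega> = 0}"]
    by (simp add: antisym)
  thus ?thesis by (subst AE_iff_measurable[OF _ refl]) (auto simp: emeasure_eq_measure)
qed

text \<open>The joint density of two Gaussian variables is bounded in terms of their Gram determinant. The
  proof conditions on \<open>X\<close> and uses that the component of \<open>Y\<close> orthogonal to \<open>X\<close> has variance equal to
  the Gram determinant divided by the variance of \<open>X\<close>.\<close>
lemma prob_both_abs_le:
  assumes X: "X \<in> V" and Y: "Y \<in> V" and g: "ip X X * ip Y Y - (ip X Y)\<^sup>2 > 0"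
    and s: "0 \<le> s" and t: "0 \<le> t"
  shows "prob {\<omega> \<in> space M. \<bar>X \<omega>\<bar> \<le> s \<and> \<bar>Y \<omega>\<bar> \<le> t}
    \<le> s * t / sqrt (ip X X * ip Y Y - (ip X Y)\<^sup>2)"
proof -
  define v where "v = ip X X"
  have v: "v > 0"
  proof (rule ccontr)
    assume "\<not> v > 0"
    hence "ip X X = 0" using ip_nonneg[of X] by (simp add: v_def)
    thus False using g by simp
  qed
  define c where "c = ip X Y / v"
  define Z where "Z = (\<lambda>\<omega>. 1 * Y \<omega> + (- c) * X \<omega>)"
  have Z: "Z \<in> V" unfolding Z_def using lin[OF Y X] .
  have orth: "ip X Z = 0"
    unfolding Z_def ip_lin_right[OF Y X X] using v by (simp add: c_def v_def)
  define w where "w = ip Z Z"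
  have "w = ip Y Z - c * ip X Z"
    unfolding w_def using ip_lin_left[OF Y X Z, of 1 "- c"] by (simp add: Z_def)
  also have "\<dots> = ip Y Y - c * ip X Y"
    unfolding orth by (subst Z_def, subst ip_lin_right[OF Y X Y]) (simp add: ip_commute)
  finally have vw: "v * w = ip X X * ip Y Y - (ip X Y)\<^sup>2"
    using v by (simp add: c_def v_def field_simps power2_eq_square)
  have w: "w > 0" using vw g v by (metis zero_less_mult_pos)
  note [measurable] = meas[OF X] meas[OF Y] meas[OF Z]
  define PX where "PX = distr M borel X"
  define PZ where "PZ = distr M borel Z"
  interpret DX: prob_space PX unfolding PX_def by (rule prob_space_distr) measurable
  interpret DZ: prob_space PZ unfolding PZ_def by (rule prob_space_distr) measurable
  have [measurable_cong, simp]: "sets PX = sets borel" "sets PZ = sets borel" by (auto simp: PX_def PZ_def)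
  \<comment> \<open>\<open>Y = Z + c X\<close> with \<open>X\<close> and \<open>Z\<close> independent\<close>
  define S where "S = {p :: real \<times> real. \<bar>fst p\<bar> \<le> s \<and> \<bar>snd p + c * fst p\<bar> \<le> t}"
  have [measurable]: "S \<in> sets (borel \<Otimes>\<^sub>M borel)" 
  proof -
    have "S = {p \<in> space (borel \<Otimes>\<^sub>M borel). \<bar>fst p\<bar> \<le> s \<and> \<bar>snd p + c * fst p\<bar> \<le> t}"
      by (simp add: S_def space_pair_measure)
    also have "\<dots> \<in> sets (borel \<Otimes>\<^sub>M borel)" by measurable
    finally show ?thesis .
  qed
  have S': "S \<in> sets (PX \<Otimes>\<^sub>M PZ)" by measurable
  have "emeasure M {\<omega> \<in> space M. \<bar>X \<omega>\<bar> \<le> s \<and> \<bar>Y \<omega>\<bar> \<le> t}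
      = emeasure (distr M (borel \<Otimes>\<^sub>M borel) (\<lambda>\<omega>. (X \<omega>, Z \<omega>))) S"
  proof -
    have "(\<lambda>\<omega>. (X \<omega>, Z \<omega>)) -` S \<inter> space M = {\<omega> \<in> space M. \<bar>X \<omega>\<bar> \<le> s \<and> \<bar>Y \<omega>\<bar> \<le> t}"
      by (auto simp: S_def Z_def)
    thus ?thesis by (simp add: emeasure_distr)
  qed
  also have "\<dots> = emeasure (PX \<Otimes>\<^sub>M PZ) S"
    unfolding joint_distr_eq_pair[OF X Z orth] PX_def PZ_def ..
  also have "\<dots> = (\<integral>\<^sup>+x. emeasure PZ (Pair x -` S) \<partial>PX)"
    by (rule DZ.emeasure_pair_measure_alt[OF S'])
  also have "\<dots> \<le> (\<integral>\<^sup>+x. ennreal (t / sqrt w) * indicator {- s..s} x \<partial>PX)"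
  proof (intro nn_integral_mono)
    fix x
    show "emeasure PZ (Pair x -` S) \<le> ennreal (t / sqrt w) * indicator {- s..s} x"
    proof (cases "\<bar>x\<bar> \<le> s")
      case True
      have "Pair x -` S = {- t - c * x..t - c * x}" using True by (auto simp: S_def)
      hence "emeasure PZ (Pair x -` S) = prob {\<omega> \<in> space M. - t - c * x \<le> Z \<omega> \<and> Z \<omega> \<le> t - c * x}"
        unfolding PZ_def by (simp add: emeasure_distr emeasure_eq_measure[symmetric])
          (auto intro!: arg_cong[where f = "emeasure M"])
      also have "\<dots> \<le> ennreal (t / sqrt w)"
        using prob_interval_le[OF Z, of "- t - c * x" "t - c * x"] w t
        by (intro ennreal_leI) (simp add: w_def)
      finally show ?thesis using True by (simp add: abs_le_iff)
    next
      case False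
      hence "Pair x -` S = {}" by (auto simp: S_def)
      thus ?thesis by simp
    qed
  qed
  also have "\<dots> = ennreal (t / sqrt w) * emeasure PX {- s..s}"
    by (intro nn_integral_cmult_indicator) simp
  also have "emeasure PX {- s..s} = prob {\<omega> \<in> space M. \<bar>X \<omega>\<bar> \<le> s}"
    unfolding PX_def by (simp add: emeasure_distr emeasure_eq_measure[symmetric])
      (auto intro!: arg_cong[where f = "emeasure M"])
  also have "ennreal (t / sqrt w) * \<dots> \<le> ennreal (t / sqrt w) * ennreal (s / sqrt v)"
    using prob_abs_le[OF X _ s] v by (intro mult_left_mono ennreal_leI) (auto simp: v_def)
  also have "\<dots> = ennreal (s * t / sqrt (v * w))"
    using s t v w by (simp add: ennreal_mult[symmetric] real_sqrt_mult mult_ac)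
  finally show ?thesis
    unfolding vw[symmetric] using s t v w by (simp add: emeasure_eq_measure)
qed

definition rot :: "('w \<Rightarrow> real) \<Rightarrow> ('w \<Rightarrow> real) \<Rightarrow> real \<Rightarrow> 'w \<Rightarrow> real" where
  "rot X Z \<phi> = (\<lambda>\<omega>. cos \<phi> * X \<omega> + sin \<phi> * Z \<omega>)"

lemma ip_lin_lin:
  assumes "X \<in> V" "Z \<in> V"
  shows "ip (\<lambda>\<omega>. a * X \<omega> + b * Z \<omega>) (\<lambda>\<omega>. c * X \<omega> + d * Z \<omega>)
    = a * c * ip X X + (a * d + b * c) * ip X Z + b * d * ip Z Z"
  using assms lin[OF assms] by (simp add: ip_lin_left ip_lin_right ip_commute[of Z X] algebra_simps)

text \<open>The law of an orthonormal pair is rotation invariant, so the probability that the signs at the two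
  ends of an arc differ depends on the angle of the arc only. Along a half turn the sign changes
  exactly once; hence this probability is additive in the angle and equal to \<open>1\<close> at \<open>\<pi>\<close>. Being
  nonnegative and additive, it is linear.\<close>
lemma orthonormal_sign_prob:
  assumes X: "X \<in> V" and Z: "Z \<in> V" and XX: "ip X X = 1" and ZZ: "ip Z Z = 1" and XZ: "ip X Z = 0"
    and th: "0 \<le> \<theta>" "\<theta> \<le> pi"
  shows "prob {\<omega> \<in> space M. X \<omega> * rot X Z \<theta> \<omega> < 0} = \<theta> / pi"
proof -
  define q where "q \<theta> = measure (std_normal_distribution \<Otimes>\<^sub>M std_normal_distribution)
    {p. fst p * (cos \<theta> * fst p + sin \<theta> * snd p) < 0}" for \<theta>
  have R: "rot X Z \<phi> \<in> V" for \<phi> unfolding rot_def by (rule lin[OF X Z])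
  have RR: "ip (rot X Z \<phi>) (rot X Z \<phi>) = 1" for \<phi>
    unfolding rot_def ip_lin_lin[OF X Z] XX ZZ XZ
    by (simp flip: power2_eq_square)
  have nz: "AE \<omega> in M. rot X Z \<phi> \<omega> \<noteq> 0" for \<phi>
    by (rule AE_nonzero[OF R]) (simp add: RR)
  have Rm [measurable]: "rot X Z \<phi> \<in> borel_measurable M" for \<phi> by (rule meas[OF R])
  \<comment> \<open>the law of an orthonormal pair is invariant under rotation\<close>
  have law: "prob {\<omega> \<in> space M. rot X Z \<phi> \<omega> * rot X Z (\<phi> + \<theta>) \<omega> < 0} = q \<theta>" for \<phi> \<theta>
  proof -
    let ?U = "rot X Z \<phi>" and ?W = "rot X Z (\<phi> + pi / 2)"
    have orth: "ip ?U ?W = 0"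
      unfolding rot_def ip_lin_lin[OF X Z] XX ZZ XZ by (simp add: cos_add sin_add)
    have eq: "rot X Z (\<phi> + \<theta>) \<omega> = cos \<theta> * ?U \<omega> + sin \<theta> * ?W \<omega>" for \<omega>
      by (simp add: rot_def cos_add sin_add algebra_simps)
    let ?S = "{p :: real \<times> real. fst p * (cos \<theta> * fst p + sin \<theta> * snd p) < 0}"
    have "?S = {p \<in> space (borel \<Otimes>\<^sub>M borel). fst p * (cos \<theta> * fst p + sin \<theta> * snd p) < 0}"
      by (simp add: space_pair_measure)
    also have "\<dots> \<in> sets (borel \<Otimes>\<^sub>M borel)" by measurable
    finally have [measurable]: "?S \<in> sets (borel \<Otimes>\<^sub>M borel)" .
    have "q \<theta> = measure (distr M (borel \<Otimes>\<^sub>M borel) (\<lambda>\<omega>. (?U \<omega>, ?W \<omega>))) ?S"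
      unfolding joint_distr_eq_pair[OF R R orth] distr_std[OF R RR] q_def ..
    also have "\<dots> = prob {\<omega> \<in> space M. ?U \<omega> * rot X Z (\<phi> + \<theta>) \<omega> < 0}"
      by (subst measure_distr) (auto simp: eq intro!: arg_cong[where f = prob])
    finally show ?thesis by simp
  qed
  have R0: "rot X Z 0 = X" by (simp add: rot_def)
  have add: "q (s + t) = q s + q t" if st: "0 \<le> s" "0 \<le> t" "s + t \<le> pi" for s t
  proof -
    have q0: "q 0 = 0" using law[of 0 0]
      by (simp add: zero_le_mult_iff not_less[symmetric] del: not_less) 
    consider "s = 0" | "t = 0" | "s > 0" "t > 0" "s + t = pi" | "s > 0" "t > 0" "s + t < pi"
      using st by linarith
    thus ?thesis
    proof cases
      case 1 thus ?thesis using q0 by simp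
    next
      case 2 thus ?thesis using q0 by simp
    next
      case 3
      have eq: "rot X Z (s + t) \<omega> = - rot X Z 0 \<omega>" for \<omega> using 3 by (simp add: rot_def)
      let ?A = "{\<omega> \<in> space M. rot X Z 0 \<omega> * rot X Z (0 + s) \<omega> < 0}"
      let ?B = "{\<omega> \<in> space M. rot X Z s \<omega> * rot X Z (s + t) \<omega> < 0}"
      let ?C = "{\<omega> \<in> space M. rot X Z 0 \<omega> * rot X Z (0 + (s + t)) \<omega> < 0}"
      have "AE \<omega> in M. (\<omega> \<in> ?C) = (\<omega> \<in> ?A \<union> ?B)"
        using nz[of 0] nz[of s]
      proof eventually_elim
        case (elim \<omega>)
        thus ?case by (cases "rot X Z 0 \<omega> < 0"; cases "rot X Z s \<omega> < 0") (simp_all add: eq mult_less_0_iff zero_less_mult_iff)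
      qed
      hence "prob ?C = prob (?A \<union> ?B)" by (intro measure_eq_AE) auto
      also have "\<dots> = prob ?A + prob ?B"
      proof (intro finite_measure_Union)
        show "?A \<inter> ?B = {}" by (auto simp: eq mult_less_0_iff zero_less_mult_iff)
      qed auto
      finally show ?thesis unfolding law .
    next
      case 4
      let ?A = "{\<omega> \<in> space M. rot X Z 0 \<omega> * rot X Z (0 + s) \<omega> < 0}"
      let ?B = "{\<omega> \<in> space M. rot X Z s \<omega> * rot X Z (s + t) \<omega> < 0}"
      let ?C = "{\<omega> \<in> space M. rot X Z 0 \<omega> * rot X Z (0 + (s + t)) \<omega> < 0}"
      have pos: "sin s > 0" "sin t > 0" "sin (s + t) > 0" using 4 by (auto intro!: sin_gt_zero)
      \<comment> \<open>on an arc shorter than a half turn, the middle value is a positive combination of the end values\<close>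
      have id: "sin (s + t) * rot X Z s \<omega> = sin t * rot X Z 0 \<omega> + sin s * rot X Z (s + t) \<omega>" for \<omega>
      proof -
        have "sin (s + t) * cos s = sin t + sin s * cos (s + t)"
        proof -
          have "sin t = sin ((s + t) - s)" by simp
          thus ?thesis unfolding sin_diff by (simp add: algebra_simps)
        qed
        moreover have "sin (s + t) * rot X Z s \<omega> = (sin (s + t) * cos s) * X \<omega> + sin (s + t) * sin s * Z \<omega>"
          by (simp add: rot_def distrib_left mult.assoc)
        ultimately show ?thesis by (simp add: rot_def distrib_left distrib_right mult_ac)
      qed
      have no1: "\<not> (rot X Z 0 \<omega> < 0 \<and> rot X Z s \<omega> > 0 \<and> rot X Z (s + t) \<omega> < 0)" for \<omega>
      proof
        assume a: "rot X Z 0 \<omega> < 0 \<and> rot X Z s \<omega> > 0 \<and> rot X Z (s + t) \<omega> < 0"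
        have "sin (s + t) * rot X Z s \<omega> > 0" "sin t * rot X Z 0 \<omega> < 0" "sin s * rot X Z (s + t) \<omega> < 0"
          using a pos by (auto simp: mult_pos_neg)
        thus False using id[of \<omega>] by linarith
      qed
      have no2: "\<not> (rot X Z 0 \<omega> > 0 \<and> rot X Z s \<omega> < 0 \<and> rot X Z (s + t) \<omega> > 0)" for \<omega>
      proof
        assume a: "rot X Z 0 \<omega> > 0 \<and> rot X Z s \<omega> < 0 \<and> rot X Z (s + t) \<omega> > 0"
        have "sin (s + t) * rot X Z s \<omega> < 0" "sin t * rot X Z 0 \<omega> > 0" "sin s * rot X Z (s + t) \<omega> > 0"
          using a pos by (auto simp: mult_pos_neg)
        thus False using id[of \<omega>] by linarith
      qed
      have "AE \<omega> in M. (\<omega> \<in> ?C) = (\<omega> \<in> ?A \<union> ?B)"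
        using nz[of 0] nz[of s] nz[of "s + t"]
      proof eventually_elim
        case (elim \<omega>)
        thus ?case using no1[of \<omega>] no2[of \<omega>] by (auto simp: mult_less_0_iff linorder_neq_iff)
      qed
      hence "prob ?C = prob (?A \<union> ?B)" by (intro measure_eq_AE) auto
      also have "\<dots> = prob ?A + prob ?B"
      proof (intro finite_measure_Union)
        show "?A \<inter> ?B = {}"
          using no1 no2 by (auto simp: mult_less_0_iff)
      qed auto
      finally show ?thesis unfolding law .
    qed
  qed
  have qpi: "q pi = 1"
  proof -
    have "prob {\<omega> \<in> space M. rot X Z 0 \<omega> * rot X Z (0 + pi) \<omega> < 0} = 1"
    proof (subst prob_Collect_eq_1)
      show "AE \<omega> in M. rot X Z 0 \<omega> * rot X Z (0 + pi) \<omega> < 0"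
        using nz[of 0] by eventually_elim (auto simp: rot_def zero_less_mult_iff linorder_neq_iff)
    qed measurable
    thus ?thesis unfolding law .
  qed
  have "q \<theta> = \<theta> / pi * q pi"
    by (rule additive_nonneg_imp_linear[OF pi_gt_zero _ add th]) (simp add: q_def)
  thus ?thesis using law[of 0 \<theta>] qpi by (simp add: R0)
qed

text \<open>Normalisation turns the pair into two points of the unit circle of an orthonormal pair, at the
  angle whose cosine is the correlation.\<close>
lemma opposite_sign_prob:
  assumes X: "X \<in> V" and Y: "Y \<in> V" and g: "ip X X * ip Y Y - (ip X Y)\<^sup>2 > 0"
  shows "prob {\<omega> \<in> space M. X \<omega> * Y \<omega> < 0} = arccos (ip X Y / sqrt (ip X X * ip Y Y)) / pi"
proof -
  have prod: "ip X X * ip Y Y > 0" using g by (smt (verit) zero_le_power2)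
  hence vX: "ip X X > 0" and vY: "ip Y Y > 0"
    using ip_nonneg[of X] ip_nonneg[of Y] by (auto simp: zero_less_mult_iff)
  define sX where "sX = sqrt (ip X X)"
  define sY where "sY = sqrt (ip Y Y)"
  have s: "sX > 0" "sY > 0" "sX * sX = ip X X" "sY * sY = ip Y Y" using vX vY by (auto simp: sX_def sY_def)
  define r where "r = ip X Y / (sX * sY)"
  have r2: "r\<^sup>2 < 1"
    using g s prod by (simp add: r_def power_divide power_mult_distrib power2_eq_square[of sX] power2_eq_square[of sY])
  hence r1: "-1 < r" "r < 1" by (auto simp: abs_square_less_1 abs_less_iff)
  define d where "d = sqrt (1 - r\<^sup>2)"
  have d: "d > 0" "d * d = 1 - r\<^sup>2" using r2 by (auto simp: d_def)
  define X' where "X' = (\<lambda>\<omega>. (1 / sX) * X \<omega>)"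
  define Z where "Z = (\<lambda>\<omega>. (1 / (sY * d)) * Y \<omega> + (- r / (sX * d)) * X \<omega>)"
  have X': "X' \<in> V" and Z: "Z \<in> V" unfolding X'_def Z_def by (rule scale[OF X], rule lin[OF Y X])
  have "ip X' X' = (1 / sX) * ((1 / sX) * ip X X)"
    unfolding X'_def ip_scale_left ip_scale_right ..
  hence XX': "ip X' X' = 1" using s(1) unfolding s(3)[symmetric] by simp
  have XY: "ip X Y = r * sX * sY" using s by (simp add: r_def)
  have XZ: "ip X' Z = 0"
    unfolding X'_def ip_scale_left Z_def ip_lin_right[OF Y X X] XY s(3)[symmetric]
    using s d by (simp add: field_simps)
  have ZZ: "ip Z Z = 1"
  proof -
    have "ip Z Z = (1 / (sY * d))\<^sup>2 * (sY * sY) + 2 * (1 / (sY * d)) * (- r / (sX * d)) * (r * sX * sY)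
        + (- r / (sX * d))\<^sup>2 * (sX * sX)"
      unfolding Z_def ip_lin_lin[OF Y X] ip_commute[of Y X] XY s(3,4) by (simp add: power2_eq_square)
    also have "\<dots> = (1 - r\<^sup>2) / (d * d)"
      using s(1,2) d(1) by (simp add: field_simps power2_eq_square)
    finally show ?thesis using d r2 by simp
  qed
  have th: "0 \<le> arccos r" "arccos r \<le> pi" "cos (arccos r) = r" "sin (arccos r) = d"
    using r1 by (auto intro: arccos_lbound arccos_ubound simp: sin_arccos d_def)
  have "rot X' Z (arccos r) \<omega> = (1 / sY) * Y \<omega>" for \<omega>
    unfolding rot_def th using s(1,2) d(1) by (simp add: X'_def Z_def field_simps)
  hence "X \<omega> * Y \<omega> < 0 \<longleftrightarrow> X' \<omega> * rot X' Z (arccos r) \<omega> < 0" for \<omega>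
    using s by (simp add: X'_def divide_less_0_iff mult_less_0_iff zero_less_mult_iff)
  hence "prob {\<omega> \<in> space M. X \<omega> * Y \<omega> < 0} = arccos r / pi"
    using orthonormal_sign_prob[OF X' Z XX' ZZ XZ th(1,2)] by simp
  thus ?thesis by (simp add: r_def sX_def sY_def real_sqrt_mult)
qed

end

section \<open>Expected zeros of a smooth Gaussian sum\<close>

lemma ennreal_mult_diff_split:
  assumes "0 \<le> k" "a \<le> b" "b \<le> d"
  shows "ennreal (k * (d - a)) = ennreal (k * (b - a)) + ennreal (k * (d - b))"
  using assms by (subst ennreal_plus[symmetric]) (auto simp: right_diff_distrib intro: mult_left_mono)

text \<open>A random function with a finite expansion in Gaussian variables. The bound on the second derivative
  of the coefficients serves to estimate the function near a double zero.\<close>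
locale gaussian_sum = gaussian_space M V for M :: "'w measure" and V +
  fixes I :: "'i set" and X :: "'i \<Rightarrow> 'w \<Rightarrow> real" and \<phi> \<phi>' \<phi>'' :: "'i \<Rightarrow> real \<Rightarrow> real" and B :: real
  assumes fin: "finite I" and XV: "\<And>k. k \<in> I \<Longrightarrow> X k \<in> V"
    and deriv1: "\<And>k x. (\<phi> k has_real_derivative \<phi>' k x) (at x)"
    and deriv2: "\<And>k x. (\<phi>' k has_real_derivative \<phi>'' k x) (at x)"
    and bound: "\<And>k x. k \<in> I \<Longrightarrow> \<bar>\<phi>'' k x\<bar> \<le> B"
begin

definition f :: "real \<Rightarrow> 'w \<Rightarrow> real" where "f x = (\<lambda>\<omega>. \<Sum>k\<in>I. \<phi> k x * X k \<omega>)"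
definition f' :: "real \<Rightarrow> 'w \<Rightarrow> real" where "f' x = (\<lambda>\<omega>. \<Sum>k\<in>I. \<phi>' k x * X k \<omega>)"
definition f'' :: "real \<Rightarrow> 'w \<Rightarrow> real" where "f'' x = (\<lambda>\<omega>. \<Sum>k\<in>I. \<phi>'' k x * X k \<omega>)"

text \<open>The normalised function \<open>x \<mapsto> f x / \<parallel>f x\<parallel>\<close> is a curve on the unit sphere of \<open>L\<^sup>2\<close>; \<open>speed\<close> is the norm
  of its derivative, and \<open>gram\<close> is the squared norm of the wedge product of \<open>f x\<close> and \<open>f' x\<close>.\<close>
definition var :: "real \<Rightarrow> real" where "var x = ip (f x) (f x)"
definition gram :: "real \<Rightarrow> real" where
  "gram x = ip (f x) (f x) * ip (f' x) (f' x) - (ip (f x) (f' x))\<^sup>2"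
definition speed :: "real \<Rightarrow> real" where "speed x = sqrt (gram x) / var x"

definition expected_zeros :: "real \<Rightarrow> real \<Rightarrow> ennreal" where
  "expected_zeros u v = (\<integral>\<^sup>+\<omega>. num_zeros (\<lambda>x. f x \<omega>) {u..v} \<partial>M)"

definition flip :: "real \<Rightarrow> real \<Rightarrow> real" where
  "flip x y = prob {\<omega> \<in> space M. f x \<omega> * f y \<omega> < 0}"

lemma f_in: "f x \<in> V" and f'_in: "f' x \<in> V"
  unfolding f_def f'_def by (rule sum_in[OF fin XV]; assumption)+

lemma f_meas [measurable]: "f x \<in> borel_measurable M" and f'_meas [measurable]: "f' x \<in> borel_measurable M"
  by (rule meas[OF f_in], rule meas[OF f'_in])

lemma f_deriv: "((\<lambda>x. f x \<omega>) has_real_derivative f' x \<omega>) (at x)"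
  and f'_deriv: "((\<lambda>x. f' x \<omega>) has_real_derivative f'' x \<omega>) (at x)"
  unfolding f_def f'_def f''_def by (auto intro!: derivative_eq_intros deriv1 deriv2)

lemma f''_bound: "\<bar>f'' x \<omega>\<bar> \<le> B * (\<Sum>k\<in>I. \<bar>X k \<omega>\<bar>)"
proof -
  have "\<bar>f'' x \<omega>\<bar> \<le> (\<Sum>k\<in>I. \<bar>\<phi>'' k x * X k \<omega>\<bar>)" unfolding f''_def by (rule sum_abs)
  also have "\<dots> \<le> (\<Sum>k\<in>I. B * \<bar>X k \<omega>\<bar>)"
    unfolding abs_mult using bound by (intro sum_mono mult_right_mono) auto
  finally show ?thesis by (simp add: sum_distrib_left)
qed

lemma ip_sum_sum:
  "ip (\<lambda>\<omega>. \<Sum>k\<in>I. c k * X k \<omega>) (\<lambda>\<omega>. \<Sum>k\<in>I. d k * X k \<omega>) = (\<Sum>k\<in>I. \<Sum>l\<in>I. c k * d l * ip (X k) (X l))"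
proof -
  have "ip (\<lambda>\<omega>. \<Sum>k\<in>I. c k * X k \<omega>) (\<lambda>\<omega>. \<Sum>k\<in>I. d k * X k \<omega>)
      = (\<Sum>k\<in>I. c k * ip (X k) (\<lambda>\<omega>. \<Sum>k\<in>I. d k * X k \<omega>))"
    by (rule ip_sum_left[OF fin XV sum_in[OF fin XV]])
  also have "\<dots> = (\<Sum>k\<in>I. c k * (\<Sum>l\<in>I. d l * ip (X l) (X k)))"
    by (intro sum.cong refl) (simp add: ip_commute[of "X _" "\<lambda>\<omega>. \<Sum>k\<in>I. d k * X k \<omega>"] ip_sum_left[OF fin XV XV])
  finally show ?thesis
    by (simp add: sum_distrib_left mult_ac ip_commute[of "X _" "X _"])
qed

lemma isCont_phi: "isCont (\<phi> k) x" "isCont (\<phi>' k) x"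
  using deriv1 deriv2 DERIV_isCont by blast+

lemma isCont_var: "isCont var x"
  unfolding var_def[abs_def] f_def ip_sum_sum
  by (intro continuous_intros isCont_phi)

lemma isCont_gram: "isCont gram x"
  unfolding gram_def[abs_def] f_def f'_def ip_sum_sum
  by (intro continuous_intros isCont_phi)

lemma flip_nonneg: "0 \<le> flip x y" by (simp add: flip_def)

lemma flip_commute: "flip x y = flip y x"
  by (simp add: flip_def mult.commute)

lemma flip_same: "flip x x = 0"
proof -
  have "{\<omega> \<in> space M. f x \<omega> * f x \<omega> < 0} = {}" by (auto simp: not_less)
  thus ?thesis by (simp add: flip_def)
qed

end

locale nondegenerate_gaussian_sum = gaussian_sum +
  assumes nondeg: "\<And>x. gram x > 0"
begin

lemma var_pos: "var x > 0"
proof (rule ccontr)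
  assume "\<not> var x > 0"
  hence "ip (f x) (f x) = 0" using ip_nonneg[of "f x"] by (simp add: var_def)
  thus False using nondeg[of x] by (simp add: gram_def)
qed

lemma speed_pos: "speed x > 0"
  using var_pos nondeg by (simp add: speed_def)

lemma AE_f_nonzero: "AE \<omega> in M. f x \<omega> \<noteq> 0"
  using AE_nonzero[OF f_in] var_pos by (simp add: var_def)

text \<open>If the signs at \<open>x\<close> and \<open>z\<close> differ, then the almost surely nonzero value at \<open>y\<close> has a sign
  opposite to one of them.\<close>
lemma flip_triangle: "flip x z \<le> flip x y + flip y z"
proof -
  let ?A = "{\<omega> \<in> space M. f x \<omega> * f y \<omega> < 0}" and ?B = "{\<omega> \<in> space M. f y \<omega> * f z \<omega> < 0}"
  have "flip x z \<le> prob (?A \<union> ?B)"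
    unfolding flip_def
  proof (rule finite_measure_mono_AE)
    show "AE \<omega> in M. \<omega> \<in> {\<omega> \<in> space M. f x \<omega> * f z \<omega> < 0} \<longrightarrow> \<omega> \<in> ?A \<union> ?B"
      using AE_f_nonzero[of y]
    proof eventually_elim
      case (elim \<omega>)
      thus ?case by (cases "f y \<omega> < 0") (auto simp: mult_less_0_iff)
    qed
  qed measurable
  also have "\<dots> \<le> flip x y + flip y z"
    unfolding flip_def by (intro measure_Un_le) measurable
  finally show ?thesis .
qed

text \<open>Of the \<open>m\<close> grid points, each satisfies both conditions with a probability of order \<open>m\<^sup>-\<^sup>3\<close>, because the
  Gram determinant of value and derivative is bounded away from zero.\<close>
lemma prob_near_double_zero:
  assumes uv: "u < v"
  shows "\<exists>C. \<forall>m>0. \<forall>K\<ge>0. prob (\<Union>i<m. {\<omega> \<in> space M. \<bar>f (grid u v m i) \<omega>\<bar> \<le> K * ((v - u) / m)\<^sup>2 \<and>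
      \<bar>f' (grid u v m i) \<omega>\<bar> \<le> K * ((v - u) / m)}) \<le> C * K\<^sup>2 / (real m)\<^sup>2"
proof -
  have "continuous_on {u..v} gram" using isCont_gram by (simp add: continuous_at_imp_continuous_on)
  then obtain x0 where x0: "x0 \<in> {u..v}" "\<And>x. x \<in> {u..v} \<Longrightarrow> gram x0 \<le> gram x"
    using continuous_attains_inf[of "{u..v}" gram] uv by auto
  show ?thesis
  proof (intro exI[of _ "(v - u) ^ 3 / sqrt (gram x0)"] allI impI)
    fix m :: nat and K :: real assume m: "m > 0" and K: "K \<ge> 0"
    define h where "h = (v - u) / real m"
    have h: "h > 0" using uv m by (simp add: h_def)
    let ?E = "\<lambda>i. {\<omega> \<in> space M. \<bar>f (grid u v m i) \<omega>\<bar> \<le> K * h\<^sup>2 \<and> \<bar>f' (grid u v m i) \<omega>\<bar> \<le> K * h}"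
    have "prob (\<Union>i<m. ?E i) \<le> (\<Sum>i<m. prob (?E i))"
      by (intro finite_measure_subadditive_finite) auto
    also have "\<dots> \<le> (\<Sum>i<m. K * h\<^sup>2 * (K * h) / sqrt (gram x0))"
    proof (intro sum_mono)
      fix i assume i: "i \<in> {..<m}"
      let ?x = "grid u v m i"
      have "prob (?E i) \<le> K * h\<^sup>2 * (K * h) / sqrt (gram ?x)"
        unfolding gram_def
        by (intro prob_both_abs_le f_in f'_in) (use nondeg[of ?x] K h in \<open>auto simp: gram_def\<close>)
      also have "\<dots> \<le> K * h\<^sup>2 * (K * h) / sqrt (gram x0)"
        using nondeg K h x0(2)[of ?x] grid_ge[of u v m i] grid_le[of u v i m] uv i
        by (intro divide_left_mono real_sqrt_le_mono) auto
      finally show "prob (?E i) \<le> K * h\<^sup>2 * (K * h) / sqrt (gram x0)" .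
    qed
    also have "\<dots> = (v - u) ^ 3 / sqrt (gram x0) * K\<^sup>2 / (real m)\<^sup>2"
    proof -
      have "real n * (K * (w / real n)\<^sup>2 * (K * (w / real n)) / s) = w ^ 3 / s * K\<^sup>2 / (real n)\<^sup>2" if "n > 0" for n w s
        using that by (cases "s = 0") (simp_all add: field_simps power2_eq_square power3_eq_cube)
      thus ?thesis using m by (simp add: h_def)
    qed
    finally show "prob (\<Union>i<m. {\<omega> \<in> space M. \<bar>f (grid u v m i) \<omega>\<bar> \<le> K * ((v - u) / m)\<^sup>2 \<and>
      \<bar>f' (grid u v m i) \<omega>\<bar> \<le> K * ((v - u) / m)}) \<le> (v - u) ^ 3 / sqrt (gram x0) * K\<^sup>2 / (real m)\<^sup>2"
      unfolding h_def .
  qed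
qed

text \<open>Bulinskaya's argument. If \<open>K\<close> bounds the second derivative, a double zero makes both \<open>f\<close> and \<open>f'\<close>
  small at a neighbouring point of every grid, at the scales of \<open>prob_near_double_zero\<close>; for fixed \<open>K\<close>
  this has probability zero.\<close>
lemma AE_zeros_simple:
  assumes uv: "u < v"
  shows "AE \<omega> in M. \<forall>t\<in>{u..v}. f t \<omega> = 0 \<longrightarrow> f' t \<omega> \<noteq> 0"
proof -
  obtain C where C: "\<And>m K. m > 0 \<Longrightarrow> K \<ge> 0 \<Longrightarrow>
     prob (\<Union>i<m. {\<omega> \<in> space M. \<bar>f (grid u v m i) \<omega>\<bar> \<le> K * ((v - u) / m)\<^sup>2 \<and>
      \<bar>f' (grid u v m i) \<omega>\<bar> \<le> K * ((v - u) / m)}) \<le> C * K\<^sup>2 / (real m)\<^sup>2"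
    using prob_near_double_zero[OF uv] by blast
  define E where "E K m = (\<Union>i<m. {\<omega> \<in> space M. \<bar>f (grid u v m i) \<omega>\<bar> \<le> K * ((v - u) / m)\<^sup>2 \<and>
      \<bar>f' (grid u v m i) \<omega>\<bar> \<le> K * ((v - u) / m)})" for K :: real and m :: nat
  have Em [measurable]: "E K m \<in> sets M" for K m unfolding E_def by measurable
  \<comment> \<open>\<open>N K\<close>: on every grid there is a point that looks like a double zero with constant \<open>K\<close>\<close>
  define N where "N K = (\<Inter>m\<in>{1..}. E K m)" for K
  have Nm [measurable]: "N K \<in> sets M" for K unfolding N_def by (intro sets.countable_INT) auto
  have N0: "prob (N K) = 0" if "K \<ge> 0" for K
  proof -
    have "prob (N K) \<le> C * K\<^sup>2 / (real m)\<^sup>2" if "m \<ge> 1" for m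
    proof -
      have "prob (N K) \<le> prob (E K m)" using that by (intro finite_measure_mono) (auto simp: N_def)
      also have "\<dots> \<le> C * K\<^sup>2 / (real m)\<^sup>2" unfolding E_def using C[of m K] that \<open>K \<ge> 0\<close> by simp
      finally show ?thesis .
    qed
    moreover have "(\<lambda>m. C * K\<^sup>2 / (real m)\<^sup>2) \<longlonglongrightarrow> 0"
      by (intro tendsto_divide_0[OF tendsto_const] filterlim_at_top_imp_at_infinity
          filterlim_pow_at_top filterlim_real_sequentially) auto
    ultimately have "prob (N K) \<le> 0" by (intro LIMSEQ_le_const) auto
    thus ?thesis by (simp add: antisym)
  qed
  have "AE \<omega> in M. \<forall>K::nat. \<omega> \<notin> N (real K)"
    by (subst AE_all_countable, intro allI AE_not_in null_setsI) (auto simp: emeasure_eq_measure N0)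
  moreover have "AE \<omega> in M. \<omega> \<in> space M" by (rule AE_space)
  ultimately show ?thesis
  proof eventually_elim
    case (elim \<omega>)
    show ?case
    proof (intro ballI impI notI)
      fix t assume t: "t \<in> {u..v}" "f t \<omega> = 0" "f' t \<omega> = 0"
      obtain K :: nat where K: "B * (\<Sum>k\<in>I. \<bar>X k \<omega>\<bar>) \<le> real K"
        using real_arch_simple by blast
      have b2: "\<bar>f'' x \<omega>\<bar> \<le> real K" for x using f''_bound[of x \<omega>] K by linarith
      have b1: "\<bar>f' x \<omega>\<bar> \<le> real K * \<bar>x - t\<bar>" for x
        using field_differentiable_bound[of UNIV "\<lambda>x. f' x \<omega>" "\<lambda>x. f'' x \<omega>" "real K" x t]
          f'_deriv b2 t(3) by (simp add: has_field_derivative_at_within)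
      have b0: "\<bar>f x \<omega>\<bar> \<le> real K * \<bar>x - t\<bar>\<^sup>2" for x
      proof -
        have "norm (f x \<omega> - f t \<omega>) \<le> (real K * \<bar>x - t\<bar>) * norm (x - t)"
        proof (rule field_differentiable_bound[of "cball t \<bar>x - t\<bar>"])
          fix z assume z: "z \<in> cball t \<bar>x - t\<bar>"
          show "((\<lambda>x. f x \<omega>) has_field_derivative f' z \<omega>) (at z within cball t \<bar>x - t\<bar>)"
            using f_deriv by (rule has_field_derivative_at_within)
          have "real K * \<bar>z - t\<bar> \<le> real K * \<bar>x - t\<bar>"
            using z by (intro mult_left_mono) (auto simp: dist_real_def)
          thus "norm (f' z \<omega>) \<le> real K * \<bar>x - t\<bar>" using b1[of z] by simp
        qed (auto simp: dist_real_def)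
        thus ?thesis using t(2) by (simp add: power2_eq_square)
      qed
      have "\<omega> \<in> E (real K) m" if m: "m \<ge> 1" for m
      proof -
        have mp: "m > 0" using m by simp
        have "\<exists>i<m. grid u v m i \<le> t \<and> t \<le> grid u v m (Suc i)"
        proof (cases "u < t \<and> t < v")
          case True
          then obtain i where "i < m" "grid u v m i \<le> t" "t < grid u v m (Suc i)"
            using grid_cell mp by blast
          thus ?thesis by (intro exI[of _ i]) auto
        next
          case False
          hence "t = u \<or> t = v" using t(1) by auto
          thus ?thesis
          proof
            assume "t = u"
            thus ?thesis using mp grid_ge[of u v m 1] uv by (intro exI[of _ 0]) auto
          next
            assume "t = v"
            thus ?thesis using mp grid_le[of u v "m - 1" m] uv by (intro exI[of _ "m - 1"]) auto
          qed
        qed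
        then obtain i where i: "i < m" "grid u v m i \<le> t" "t \<le> grid u v m (Suc i)" by blast
        have close: "\<bar>grid u v m i - t\<bar> \<le> (v - u) / real m"
          using i grid_step[OF mp, of u v i] by linarith
        have "\<bar>f (grid u v m i) \<omega>\<bar> \<le> real K * ((v - u) / real m)\<^sup>2"
          using b0[of "grid u v m i"] mult_left_mono[OF power_mono[OF close, of 2], of "real K"] by simp
        moreover have "\<bar>f' (grid u v m i) \<omega>\<bar> \<le> real K * ((v - u) / real m)"
          using b1[of "grid u v m i"] mult_left_mono[OF close, of "real K"] by simp
        ultimately show ?thesis using i(1) elim(2) by (auto simp: E_def)
      qed
      hence "\<omega> \<in> N (real K)" by (auto simp: N_def)
      thus False using elim(1) by blast
    qed
  qed
qed

lemma sign_changes_eq_sum: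
  "(of_nat (sign_changes g u v m) :: ennreal) =
     (\<Sum>i<m. indicator {y. y < (0::real)} (g (grid u v m i) * g (grid u v m (Suc i))))"
proof -
  have "sign_changes g u v m = (\<Sum>i<m. if g (grid u v m i) * g (grid u v m (Suc i)) < 0 then 1 else 0)"
    unfolding sign_changes_def by (subst sum.If_cases) (auto intro!: arg_cong[where f = card])
  hence "(of_nat (sign_changes g u v m) :: ennreal)
      = (\<Sum>i<m. of_nat (if g (grid u v m i) * g (grid u v m (Suc i)) < 0 then 1 else 0))"
    by (simp only: of_nat_sum)
  also have "\<dots> = (\<Sum>i<m. indicator {y. y < (0::real)} (g (grid u v m i) * g (grid u v m (Suc i))))"
    by (intro sum.cong) (auto simp: indicator_def)
  finally show ?thesis .
qed

lemma sign_changes_meas [measurable]: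
  "(\<lambda>\<omega>. of_nat (sign_changes (\<lambda>x. f x \<omega>) u v m) :: ennreal) \<in> borel_measurable M"
  unfolding sign_changes_eq_sum by measurable

lemma expected_sign_changes:
  "(\<integral>\<^sup>+\<omega>. of_nat (sign_changes (\<lambda>x. f x \<omega>) u v m) \<partial>M)
     = ennreal (\<Sum>i<m. flip (grid u v m i) (grid u v m (Suc i)))"
proof -
  have "(\<integral>\<^sup>+\<omega>. of_nat (sign_changes (\<lambda>x. f x \<omega>) u v m) \<partial>M)
    = (\<Sum>i<m. \<integral>\<^sup>+\<omega>. indicator {y. y < (0::real)} (f (grid u v m i) \<omega> * f (grid u v m (Suc i)) \<omega>) \<partial>M)"
    unfolding sign_changes_eq_sum by (intro nn_integral_sum) measurable
  also have "\<dots> = (\<Sum>i<m. ennreal (flip (grid u v m i) (grid u v m (Suc i))))"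
  proof (intro sum.cong refl)
    fix i
    let ?S = "{\<omega> \<in> space M. f (grid u v m i) \<omega> * f (grid u v m (Suc i)) \<omega> < 0}"
    have "(\<integral>\<^sup>+\<omega>. indicator {y. y < (0::real)} (f (grid u v m i) \<omega> * f (grid u v m (Suc i)) \<omega>) \<partial>M)
      = (\<integral>\<^sup>+\<omega>. indicator ?S \<omega> \<partial>M)"
      by (intro nn_integral_cong) (auto simp: indicator_def)
    also have "\<dots> = emeasure M ?S" by (intro nn_integral_indicator) measurable
    finally show "(\<integral>\<^sup>+\<omega>. indicator {y. y < (0::real)} (f (grid u v m i) \<omega> * f (grid u v m (Suc i)) \<omega>) \<partial>M)
      = ennreal (flip (grid u v m i) (grid u v m (Suc i)))" by (simp add: flip_def emeasure_eq_measure)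
  qed
  finally show ?thesis by (simp add: flip_nonneg)
qed

lemma AE_sign_changes_tendsto:
  assumes "u < v"
  shows "AE \<omega> in M. (\<lambda>m. of_nat (sign_changes (\<lambda>x. f x \<omega>) u v m)) \<longlonglongrightarrow> num_zeros (\<lambda>x. f x \<omega>) {u..v}"
proof -
  have "AE \<omega> in M. \<forall>m i. f (grid u v m i) \<omega> \<noteq> 0"
    by (simp add: AE_all_countable AE_f_nonzero)
  with AE_zeros_simple[OF assms] show ?thesis
  proof eventually_elim
    case (elim \<omega>)
    thus ?case by (intro sign_changes_tendsto_num_zeros[OF assms f_deriv]) auto
  qed
qed

text \<open>Upper integrals of nonmeasurable functions are not additive. The sign changes on a fixed grid are
  measurable, and so is their limit.\<close>
lemma AE_num_zeros_measurable:
  assumes "u < v"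
  shows "\<exists>g\<in>borel_measurable M. AE \<omega> in M. num_zeros (\<lambda>x. f x \<omega>) {u..v} = g \<omega>"
proof (rule bexI)
  show "AE \<omega> in M. num_zeros (\<lambda>x. f x \<omega>) {u..v} = liminf (\<lambda>m. of_nat (sign_changes (\<lambda>x. f x \<omega>) u v m))"
    using AE_sign_changes_tendsto[OF assms]
    by eventually_elim (simp add: lim_imp_Liminf)
qed measurable

text \<open>Fatou's lemma, applied to the sign changes on finer and finer grids.\<close>
lemma expected_zeros_le:
  assumes "u < v" and le: "\<And>m. m > 0 \<Longrightarrow> (\<Sum>i<m. flip (grid u v m i) (grid u v m (Suc i))) \<le> c"
  shows "expected_zeros u v \<le> ennreal c"
proof -
  have "expected_zeros u v = (\<integral>\<^sup>+\<omega>. liminf (\<lambda>m. of_nat (sign_changes (\<lambda>x. f x \<omega>) u v m)) \<partial>M)"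
    unfolding expected_zeros_def using AE_sign_changes_tendsto[OF assms(1)]
    by (intro nn_integral_cong_AE) (auto elim!: eventually_mono simp: lim_imp_Liminf)
  also have "\<dots> \<le> liminf (\<lambda>m. \<integral>\<^sup>+\<omega>. of_nat (sign_changes (\<lambda>x. f x \<omega>) u v m) \<partial>M)"
    by (intro nn_integral_liminf) measurable
  also have "\<dots> \<le> liminf (\<lambda>m. ennreal c)"
    unfolding expected_sign_changes using le
    by (intro Liminf_mono eventually_mono[OF eventually_gt_at_top[of 0]] ennreal_leI) auto
  finally show ?thesis by (simp add: Liminf_const)
qed

text \<open>Opposite signs at the ends of an interval force a zero: the bound of sign changes by zeros on the
  grid with a single cell.\<close>
lemma flip_le_expected_zeros:
  assumes "u < v"
  shows "ennreal (flip u v) \<le> expected_zeros u v"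
proof -
  have "ennreal (flip u v) = (\<integral>\<^sup>+\<omega>. of_nat (sign_changes (\<lambda>x. f x \<omega>) u v 1) \<partial>M)"
    by (simp add: expected_sign_changes)
  also have "\<dots> \<le> expected_zeros u v"
    unfolding expected_zeros_def
  proof (intro nn_integral_mono)
    fix \<omega>
    have "continuous_on {u..v} (\<lambda>x. f x \<omega>)"
      using DERIV_isCont[OF f_deriv] by (auto intro: continuous_at_imp_continuous_on)
    thus "of_nat (sign_changes (\<lambda>x. f x \<omega>) u v 1) \<le> num_zeros (\<lambda>x. f x \<omega>) {u..v}"
      using assms by (intro sign_changes_le_num_zeros) auto
  qed
  finally show ?thesis .
qed

text \<open>A zero at the common end point \<open>v\<close> would be counted twice, but almost surely there is none.\<close>
lemma expected_zeros_additive: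
  assumes "u < v" "v < w"
  shows "expected_zeros u w = expected_zeros u v + expected_zeros v w"
proof -
  obtain g1 where g1: "g1 \<in> borel_measurable M" "AE \<omega> in M. num_zeros (\<lambda>x. f x \<omega>) {u..v} = g1 \<omega>"
    using AE_num_zeros_measurable[OF assms(1)] by blast
  obtain g2 where g2: "g2 \<in> borel_measurable M" "AE \<omega> in M. num_zeros (\<lambda>x. f x \<omega>) {v..w} = g2 \<omega>"
    using AE_num_zeros_measurable[OF assms(2)] by blast
  note [measurable] = g1(1) g2(1)
  have "AE \<omega> in M. num_zeros (\<lambda>x. f x \<omega>) {u..w} = g1 \<omega> + g2 \<omega>"
    using g1(2) g2(2) AE_f_nonzero[of v]
  proof eventually_elim
    case (elim \<omega>)
    have "{t \<in> {u..w}. f t \<omega> = 0} = {t \<in> {u..v}. f t \<omega> = 0} \<union> {t \<in> {v..w}. f t \<omega> = 0}"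
      using assms by auto
    moreover have "{t \<in> {u..v}. f t \<omega> = 0} \<inter> {t \<in> {v..w}. f t \<omega> = 0} = {}"
      using elim(3) by (auto dest: antisym)
    ultimately show ?case unfolding elim(1,2)[symmetric] num_zeros_def
      by (simp add: plus_emeasure)
  qed
  hence "expected_zeros u w = (\<integral>\<^sup>+\<omega>. g1 \<omega> + g2 \<omega> \<partial>M)"
    unfolding expected_zeros_def by (rule nn_integral_cong_AE)
  also have "\<dots> = (\<integral>\<^sup>+\<omega>. g1 \<omega> \<partial>M) + (\<integral>\<^sup>+\<omega>. g2 \<omega> \<partial>M)"
    by (rule nn_integral_add) measurable
  also have "\<dots> = expected_zeros u v + expected_zeros v w"
    unfolding expected_zeros_def using nn_integral_cong_AE[OF g1(2)] nn_integral_cong_AE[OF g2(2)] by simp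
  finally show ?thesis .
qed

text \<open>By \<open>opposite_sign_prob\<close>, \<open>flip x y\<close> is the angle between \<open>f x\<close> and \<open>f y\<close> divided by \<open>\<pi>\<close>, so its rate of
  growth is the speed of the normalised curve. The sine of the angle is the square root of a Gram
  determinant, which does not change when \<open>f y\<close> is replaced by \<open>f y - f x\<close>; after division by \<open>y - x\<close>
  the difference quotients converge to \<open>f' x\<close>.\<close>
lemma flip_derivative: "((\<lambda>y. flip x y / \<bar>y - x\<bar>) \<longlongrightarrow> speed x / pi) (at x)"
proof -
  define G where "G y = var x * var y - (ip (f x) (f y))\<^sup>2" for y
  \<comment> \<open>\<open>D y\<close> is the difference quotient of \<open>f\<close>\<close>
  define D where "D y = (\<lambda>\<omega>. \<Sum>k\<in>I. ((\<phi> k y - \<phi> k x) / (y - x)) * X k \<omega>)" for y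
  have DV: "D y \<in> V" for y unfolding D_def by (rule sum_in[OF fin XV])
  have quot: "((\<lambda>y. (\<phi> k y - \<phi> k x) / (y - x)) \<longlongrightarrow> \<phi>' k x) (at x)" for k
    using deriv1[of k x] by (simp add: has_field_derivative_iff)
  have DD: "((\<lambda>y. ip (D y) (D y)) \<longlongrightarrow> ip (f' x) (f' x)) (at x)"
    unfolding D_def f'_def ip_sum_sum by (intro tendsto_intros quot)
  have fD: "((\<lambda>y. ip (f x) (D y)) \<longlongrightarrow> ip (f x) (f' x)) (at x)"
    unfolding D_def f'_def f_def ip_sum_sum by (intro tendsto_intros quot)
  have "((\<lambda>y. var x * ip (D y) (D y) - (ip (f x) (D y))\<^sup>2) \<longlongrightarrow> gram x) (at x)"
    unfolding gram_def var_def by (intro tendsto_intros DD fD)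
  moreover have Geq: "var x * ip (D y) (D y) - (ip (f x) (D y))\<^sup>2 = G y / (y - x)\<^sup>2" if "y \<noteq> x" for y
  proof -
    have fy: "f y = (\<lambda>\<omega>. 1 * f x \<omega> + (y - x) * D y \<omega>)"
      using that by (auto simp: f_def D_def sum_distrib_left sum.distrib[symmetric] field_simps intro!: sum.cong)
    have "ip (f x) (f y) = var x + (y - x) * ip (f x) (D y)"
      by (subst fy, subst ip_lin_right[OF f_in DV f_in]) (simp add: var_def)
    moreover have "var y = var x + 2 * (y - x) * ip (f x) (D y) + (y - x)\<^sup>2 * ip (D y) (D y)"
      unfolding var_def by (subst (1 2) fy, subst ip_lin_lin[OF f_in DV]) (simp add: power2_eq_square)
    moreover have "p * (p + 2 * d * E + d\<^sup>2 * F) - (p + d * E)\<^sup>2 = d\<^sup>2 * (p * F - E\<^sup>2)" for p d E F :: real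
      by (simp add: power2_eq_square algebra_simps)
    ultimately have "G y = (y - x)\<^sup>2 * (var x * ip (D y) (D y) - (ip (f x) (D y))\<^sup>2)"
      unfolding G_def by metis
    thus ?thesis using that by simp
  qed
  hence "eventually (\<lambda>y. var x * ip (D y) (D y) - (ip (f x) (D y))\<^sup>2 = G y / (y - x)\<^sup>2) (at x)"
    by (auto simp: eventually_at_filter)
  ultimately have Glim: "((\<lambda>y. G y / (y - x)\<^sup>2) \<longlongrightarrow> gram x) (at x)"
    by (rule Lim_transform_eventually)
  have varlim: "(var \<longlongrightarrow> var x) (at x)" using isCont_var by (simp add: isCont_def)
  have covlim: "((\<lambda>y. ip (f x) (f y)) \<longlongrightarrow> var x) (at x)"
    unfolding var_def f_def ip_sum_sum
    by (intro tendsto_intros) (use isCont_phi in \<open>auto simp: isCont_def\<close>)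
  define r where "r y = ip (f x) (f y) / sqrt (var x * var y)" for y
  define s where "s y = sqrt (1 - (r y)\<^sup>2)" for y
  have rlim: "(r \<longlongrightarrow> 1) (at x)"
  proof -
    have "(r \<longlongrightarrow> var x / sqrt (var x * var x)) (at x)"
      unfolding r_def using var_pos[of x] by (intro tendsto_intros covlim varlim) auto
    thus ?thesis using var_pos[of x] by simp
  qed
  have s_eq: "s y / \<bar>y - x\<bar> = sqrt (G y / (y - x)\<^sup>2 / (var x * var y))" if "y \<noteq> x" for y
  proof -
    have "1 - (r y)\<^sup>2 = G y / (var x * var y)"
      using var_pos[of x] var_pos[of y] by (simp add: r_def G_def power_divide field_simps)
    hence "s y / \<bar>y - x\<bar> = sqrt (G y / (var x * var y)) / sqrt ((y - x)\<^sup>2)"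
      by (simp only: s_def real_sqrt_abs)
    also have "\<dots> = sqrt (G y / (var x * var y) / (y - x)\<^sup>2)"
      by (rule real_sqrt_divide[symmetric])
    finally show ?thesis by (simp add: mult.commute)
  qed
  have "((\<lambda>y. sqrt (G y / (y - x)\<^sup>2 / (var x * var y))) \<longlongrightarrow> sqrt (gram x / (var x * var x))) (at x)"
    using var_pos[of x] by (intro tendsto_intros Glim varlim) auto
  moreover have "sqrt (gram x / (var x * var x)) = speed x"
    using var_pos[of x] by (simp add: speed_def real_sqrt_divide)
  moreover have "eventually (\<lambda>y. sqrt (G y / (y - x)\<^sup>2 / (var x * var y)) = s y / \<bar>y - x\<bar>) (at x)"
    unfolding eventually_at_filter using s_eq by (intro always_eventually allI impI) (rule sym)
  ultimately have slim: "((\<lambda>y. s y / \<bar>y - x\<bar>) \<longlongrightarrow> speed x) (at x)"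
    by (simp add: Lim_transform_eventually)
  have s0: "(s \<longlongrightarrow> 0) (at x)"
  proof -
    have "(s \<longlongrightarrow> sqrt (1 - 1\<^sup>2)) (at x)" unfolding s_def by (intro tendsto_intros rlim)
    thus ?thesis by simp
  qed
  have "eventually (\<lambda>y. s y / \<bar>y - x\<bar> > 0) (at x)"
    using slim speed_pos[of x] by (rule order_tendstoD)
  hence snz: "eventually (\<lambda>y. s y \<noteq> 0) (at x)" by eventually_elim auto
  \<comment> \<open>the angle is the arc sine of \<open>s y\<close>, and small angles are asymptotic to their sines\<close>
  have "((\<lambda>t. arcsin t / t) \<longlongrightarrow> 1) (at 0)"
    using DERIV_arcsin[of 0] by (simp add: has_field_derivative_iff)
  moreover have "filterlim s (at 0) (at x)"
    using s0 snz by (simp add: filterlim_at)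
  ultimately have "((\<lambda>y. arcsin (s y) / s y) \<longlongrightarrow> 1) (at x)"
    by (rule filterlim_compose)
  hence "((\<lambda>y. arcsin (s y) / s y * (s y / \<bar>y - x\<bar>) / pi) \<longlongrightarrow> 1 * speed x / pi) (at x)"
    by (intro tendsto_intros slim) auto
  moreover have "eventually (\<lambda>y. arcsin (s y) / s y * (s y / \<bar>y - x\<bar>) / pi = flip x y / \<bar>y - x\<bar>) (at x)"
  proof -
    have "eventually (\<lambda>y. G y / (y - x)\<^sup>2 > 0) (at x)"
      using Glim nondeg[of x] by (rule order_tendstoD)
    moreover have "eventually (\<lambda>y. r y > 0) (at x)"
      using rlim by (rule order_tendstoD) simp
    moreover have "eventually (\<lambda>y. y \<noteq> x) (at x)" by (simp add: eventually_at_filter)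
    ultimately show ?thesis using snz
    proof eventually_elim
      case (elim y)
      have G: "G y > 0" using elim(1,3) by (simp add: zero_less_divide_iff)
      have fl: "flip x y = arccos (r y) / pi"
        unfolding flip_def r_def var_def using G
        by (intro opposite_sign_prob f_in) (simp add: G_def var_def)
      have "(r y)\<^sup>2 \<le> 1"
        using G var_pos[of x] var_pos[of y] by (simp add: r_def G_def power_divide field_simps)
      hence "r y \<le> 1" by (simp add: abs_square_le_1)
      hence "arccos (r y) = arcsin (s y)"
        using elim(2) unfolding s_def by (intro arccos_arcsin_sqrt_pos) auto
      thus ?case using elim(4) fl by simp
    qed
  qed
  ultimately show ?thesis
    by (simp add: Lim_transform_eventually)
qed

text \<open>The expected number of zeros is the length of the normalised curve divided by \<open>\<pi>\<close>; together with the
  next lemma this is used in the form of bounds on intervals with almost constant speed. The derivative of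
  \<open>flip\<close> is known at each point separately. Bisection and the triangle inequality for \<open>flip\<close> turn
  this into a bound for \<open>flip a b\<close> on all subintervals, hence for the expected number of sign changes.\<close>
lemma expected_zeros_upper:
  assumes uv: "u < v" and sp: "\<And>x. x \<in> {u..v} \<Longrightarrow> speed x < c"
  shows "expected_zeros u v \<le> ennreal (c * (v - u) / pi)"
proof -
  have *: "u \<le> a \<longrightarrow> a \<le> b \<longrightarrow> b \<le> v \<longrightarrow> flip a b \<le> c / pi * (b - a)" if "a \<le> b" for a b
    using that
  proof (induction a b rule: Bolzano)
    case (trans a b d)
    thus ?case using flip_triangle[of a d b] by (auto simp: algebra_simps diff_divide_distrib)
  next
    case (local x)
    show ?case
    proof (cases "x \<in> {u..v}")
      case False
      show ?thesis
      proof (cases "x < u")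
        case True
        show ?thesis by (rule exI[of _ 1]) (use True in auto)
      next
        case F: False
        show ?thesis by (rule exI[of _ 1]) (use False F in auto)
      qed
    next
      case True
      have "eventually (\<lambda>y. flip x y / \<bar>y - x\<bar> < c / pi) (at x)"
        using flip_derivative by (rule order_tendstoD) (use sp[OF True] in \<open>simp add: divide_strict_right_mono\<close>)
      then obtain d where d: "d > 0" "\<And>y. y \<noteq> x \<Longrightarrow> \<bar>y - x\<bar> < d \<Longrightarrow> flip x y / \<bar>y - x\<bar> < c / pi"
        unfolding eventually_at by (auto simp: dist_real_def)
      have le: "flip x y \<le> c / pi * \<bar>y - x\<bar>" if "\<bar>y - x\<bar> < d" for y
        using d(2)[of y] that by (cases "y = x") (auto simp: flip_same field_simps)
      show ?thesis
      proof (intro exI[of _ d] conjI allI impI d(1))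
        fix a b assume ab: "a \<le> x \<and> x \<le> b \<and> b - a < d"
        have "flip a b \<le> flip x a + flip x b" using flip_triangle[of a b x] by (simp add: flip_commute)
        also have "\<dots> \<le> c / pi * \<bar>a - x\<bar> + c / pi * \<bar>b - x\<bar>"
          using ab by (intro add_mono le) auto
        also have "\<dots> = c / pi * (\<bar>a - x\<bar> + \<bar>b - x\<bar>)" by (rule distrib_left[symmetric])
        also have "\<bar>a - x\<bar> + \<bar>b - x\<bar> = b - a" using ab by auto
        finally show "flip a b \<le> c / pi * (b - a)" .
      qed
    qed
  qed
  show ?thesis
  proof (rule expected_zeros_le[OF uv])
    fix m :: nat assume m: "m > 0"
    have "(\<Sum>i<m. flip (grid u v m i) (grid u v m (Suc i))) \<le> (\<Sum>i<m. c / pi * ((v - u) / real m))"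
    proof (intro sum_mono)
      fix i assume "i \<in> {..<m}"
      thus "flip (grid u v m i) (grid u v m (Suc i)) \<le> c / pi * ((v - u) / real m)"
        unfolding grid_step[OF m, of u v i, symmetric]
        using *[of "grid u v m i" "grid u v m (Suc i)"] uv grid_ge[of u v m i] grid_le[of u v "Suc i" m]
          grid_mono[of u v i "Suc i" m] by auto
    qed
    also have "\<dots> = c * (v - u) / pi" using m by simp
    finally show "(\<Sum>i<m. flip (grid u v m i) (grid u v m (Suc i))) \<le> c * (v - u) / pi" .
  qed
qed

text \<open>Here the bisection runs on the expected number of zeros itself, which is additive and at least
  \<open>flip\<close>; \<open>flip\<close> satisfies no reverse triangle inequality.\<close>
lemma expected_zeros_lower:
  assumes uv: "u < v" and sp: "\<And>x. x \<in> {u..v} \<Longrightarrow> c < speed x" and c: "0 \<le> c"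
  shows "ennreal (c * (v - u) / pi) \<le> expected_zeros u v"
proof -
  have *: "u \<le> a \<longrightarrow> a < b \<longrightarrow> b \<le> v \<longrightarrow> ennreal (c / pi * (b - a)) \<le> expected_zeros a b" if "a \<le> b" for a b
    using that
  proof (induction a b rule: Bolzano)
    case (trans a b d)
    show ?case
    proof (intro impI)
      assume asm: "u \<le> a" "a < d" "d \<le> v"
      show "ennreal (c / pi * (d - a)) \<le> expected_zeros a d"
      proof (cases "a < b \<and> b < d")
        case True
        have "ennreal (c / pi * (d - a)) = ennreal (c / pi * (b - a)) + ennreal (c / pi * (d - b))"
          using True c by (intro ennreal_mult_diff_split) auto
        also have "\<dots> \<le> expected_zeros a b + expected_zeros b d"
          using trans asm True by (intro add_mono) auto
        finally show ?thesis using expected_zeros_additive[of a b d] True by simp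
      next
        case False
        hence "a = b \<or> b = d" using trans by auto
        thus ?thesis using trans asm by auto
      qed
    qed
  next
    case (local x)
    show ?case
    proof (cases "x \<in> {u..v}")
      case False
      show ?thesis
      proof (cases "x < u")
        case True
        show ?thesis by (rule exI[of _ 1]) (use True in auto)
      next
        case F: False
        show ?thesis by (rule exI[of _ 1]) (use False F in auto)
      qed
    next
      case True
      have "eventually (\<lambda>y. c / pi < flip x y / \<bar>y - x\<bar>) (at x)"
        using flip_derivative by (rule order_tendstoD) (use sp[OF True] in \<open>simp add: divide_strict_right_mono\<close>)
      then obtain d where d: "d > 0" "\<And>y. y \<noteq> x \<Longrightarrow> \<bar>y - x\<bar> < d \<Longrightarrow> c / pi < flip x y / \<bar>y - x\<bar>"
        unfolding eventually_at by (auto simp: dist_real_def)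
      have le: "c / pi * \<bar>y - x\<bar> \<le> flip x y" if "y \<noteq> x" "\<bar>y - x\<bar> < d" for y
        using d(2)[of y] that by (auto simp: field_simps)
      show ?thesis
      proof (intro exI[of _ d] conjI allI impI d(1))
        fix a b assume ab: "a \<le> x \<and> x \<le> b \<and> b - a < d" and asm: "u \<le> a" "a < b" "b \<le> v"
        have left: "ennreal (c / pi * (x - a)) \<le> expected_zeros a x" if "a < x"
        proof -
          have "c / pi * (x - a) \<le> flip a x" using le[of a] that ab by (simp add: flip_commute)
          thus ?thesis using flip_le_expected_zeros[OF that] by (meson ennreal_leI order_trans)
        qed
        have right: "ennreal (c / pi * (b - x)) \<le> expected_zeros x b" if "x < b"
        proof -
          have "c / pi * (b - x) \<le> flip x b" using le[of b] that ab by simp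
          thus ?thesis using flip_le_expected_zeros[OF that] by (meson ennreal_leI order_trans)
        qed
        show "ennreal (c / pi * (b - a)) \<le> expected_zeros a b"
        proof (cases "a < x \<and> x < b")
          case T: True
          have "ennreal (c / pi * (b - a)) = ennreal (c / pi * (x - a)) + ennreal (c / pi * (b - x))"
            using T c by (intro ennreal_mult_diff_split) auto
          also have "\<dots> \<le> expected_zeros a x + expected_zeros x b"
            using T left right by (intro add_mono) auto
          finally show ?thesis using expected_zeros_additive[of a x b] T by simp
        next
          case F: False
          hence "a = x \<or> x = b" using ab by auto
          thus ?thesis using left right asm by auto
        qed
      qed
    qed
  qed
  show ?thesis using *[of u v] uv by simp
qed

end

section \<open>Expected zeros in a short interval\<close>

lemma power_over_fact_le_exp:
  fixes y :: real
  assumes "0 \<le> y" and j: "exp 2 * y \<le> real j"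
  shows "y ^ j / fact j \<le> exp (- real j)"
proof -
  have "real j ^ j / fact j \<le> exp (real j)"
  proof -
    have "(\<Sum>i\<in>{j}. real j ^ i /\<^sub>R fact i) \<le> (\<Sum>i. real j ^ i /\<^sub>R fact i)"
      using summable_exp_generic[of "real j"] by (intro sum_le_suminf) auto
    thus ?thesis by (simp add: exp_def divide_inverse mult.commute)
  qed
  moreover have "(exp 2 * y) ^ j \<le> real j ^ j" using assms by (intro power_mono) auto
  ultimately have "(exp 2 * y) ^ j / fact j \<le> exp (real j)"
    by (meson divide_right_mono fact_ge_zero order_trans)
  hence "exp (2 * real j) * (y ^ j / fact j) \<le> exp (real j)"
    by (simp add: power_mult_distrib exp_of_nat2_mult[symmetric] mult.commute)
  hence "y ^ j / fact j \<le> exp (real j) / exp (2 * real j)"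
    by (simp add: field_simps)
  thus ?thesis by (simp flip: exp_diff)
qed

context gaussian_space
begin

text \<open>Put \<open>y = d (v - u)\<close>. If there are \<open>j \<ge> e\<^sup>2 y\<close> zeros, then \<open>bound_of_many_zeros\<close> gives
  \<open>\<bar>F 0 x0\<bar> \<le> S y\<^sup>j / j! \<le> S e\<^sup>-\<^sup>j\<close>. So either \<open>S\<close> is at least \<open>e\<^sup>j\<^sup>/\<^sup>2\<close>, which is unlikely by Markov's
  inequality, or the Gaussian variable \<open>F 0 x0\<close> is at most \<open>e\<^sup>-\<^sup>j\<^sup>/\<^sup>2\<close> in absolute value, which is
  unlikely because its density is bounded. Summation over \<open>j\<close> gives a geometric series. The bound
  takes into account only the variance at one point of the interval.\<close>
lemma expected_zeros_short_interval:
  fixes F :: "nat \<Rightarrow> real \<Rightarrow> 'w \<Rightarrow> real" and S :: "'w \<Rightarrow> real"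
  assumes deriv: "\<And>j x \<omega>. ((\<lambda>x. F j x \<omega>) has_real_derivative F (Suc j) x \<omega>) (at x)"
    and bound: "\<And>j x \<omega>. \<bar>F j x \<omega>\<bar> \<le> d ^ j * S \<omega>" and d: "0 \<le> d"
    and S: "integrable M S"
    and x0: "x0 \<in> {u..v}" and FV: "F 0 x0 \<in> V" and var: "ip (F 0 x0) (F 0 x0) > 0"
  shows "(\<integral>\<^sup>+\<omega>. num_zeros (\<lambda>x. F 0 x \<omega>) {u..v} \<partial>M)
    \<le> ennreal (exp 2 * d * (v - u) + 1
        + (expectation S + 1 / sqrt (ip (F 0 x0) (F 0 x0))) / (1 - exp (- 1 / 2)))"
proof -
  note [measurable] = meas[OF FV] borel_measurable_integrable[OF S]
  have S0: "0 \<le> S \<omega>" for \<omega> using bound[of 0 0 \<omega>] by (simp add: order_trans[OF abs_ge_zero])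
  define y where "y = d * (v - u)"
  have y: "0 \<le> y" using d x0 by (simp add: y_def)
  define j0 where "j0 = nat \<lceil>exp 2 * y\<rceil>"
  have j0: "exp 2 * y \<le> real j0" "real j0 \<le> exp 2 * y + 1"
    using y by (auto simp: j0_def)
  define A where "A j = {\<omega> \<in> space M. \<bar>F 0 x0 \<omega>\<bar> \<le> S \<omega> * exp (- real j)}" for j :: nat
  have [measurable]: "A j \<in> sets M" for j unfolding A_def by measurable
  define T where "T = expectation S + 1 / sqrt (ip (F 0 x0) (F 0 x0))"
  have T0: "0 \<le> T" unfolding T_def using S0 ip_nonneg by (intro add_nonneg_nonneg) auto
  \<comment> \<open>every zero beyond the first \<open>j0\<close> costs a factor \<open>e\<close> in the size of the value at \<open>x0\<close>\<close>
  have pointwise: "num_zeros (\<lambda>x. F 0 x \<omega>) {u..v} \<le> of_nat j0 + (\<Sum>j. indicator (A j) \<omega>)"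
    if \<omega>: "\<omega> \<in> space M" for \<omega>
  proof (rule num_zeros_le_of_finite_subsets)
    fix Z assume Z: "Z \<subseteq> {t \<in> {u..v}. F 0 t \<omega> = 0}" "finite Z"
    have inA: "\<omega> \<in> A j" if j: "j0 \<le> j" "j \<le> card Z" for j
    proof -
      obtain Y where Y: "Y \<subseteq> Z" "card Y = j" using j(2) obtain_subset_with_card_n by metis
      have "\<bar>F 0 x0 \<omega>\<bar> \<le> (d ^ j * S \<omega>) * (v - u) ^ j / fact j"
        by (rule bound_of_many_zeros[of "\<lambda>j x. F j x \<omega>", OF deriv finite_subset[OF Y(1) Z(2)] Y(2)])
           (use Y Z x0 bound in auto)
      also have "\<dots> = S \<omega> * (y ^ j / fact j)" by (simp add: y_def power_mult_distrib mult_ac)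
      also have "\<dots> \<le> S \<omega> * exp (- real j)"
        using j0 j(1) y S0 by (intro mult_left_mono power_over_fact_le_exp) auto
      finally show ?thesis using \<omega> by (simp add: A_def)
    qed
    have "(of_nat (card Z) :: ennreal) \<le> of_nat j0 + of_nat (card {j0..<card Z})"
      by (simp flip: of_nat_add)
    also have "of_nat (card {j0..<card Z}) = (\<Sum>j\<in>{j0..<card Z}. indicator (A j) \<omega> :: ennreal)"
      using inA by simp
    also have "\<dots> \<le> (\<Sum>j. indicator (A j) \<omega>)" by (intro sum_le_suminf) auto
    finally show "of_nat (card Z) \<le> of_nat j0 + (\<Sum>j. indicator (A j) \<omega> :: ennreal)" by simp
  qed
  have PA: "prob (A j) \<le> T * exp (- 1 / 2) ^ j" for j
  proof -
    define c where "c = exp (real j / 2)"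
    have c: "c > 0" "exp (- real j) = 1 / (c * c)" "exp (- 1 / 2) ^ j = 1 / c"
      by (auto simp: c_def exp_add[symmetric] exp_minus inverse_eq_divide exp_of_nat_mult[symmetric] power_divide
          power_inverse)
    have "prob (A j) \<le> prob ({\<omega> \<in> space M. c \<le> S \<omega>} \<union> {\<omega> \<in> space M. \<bar>F 0 x0 \<omega>\<bar> \<le> 1 / c})"
    proof (intro finite_measure_mono)
      show "A j \<subseteq> {\<omega> \<in> space M. c \<le> S \<omega>} \<union> {\<omega> \<in> space M. \<bar>F 0 x0 \<omega>\<bar> \<le> 1 / c}"
      proof
        fix \<omega> assume w: "\<omega> \<in> A j"
        show "\<omega> \<in> {\<omega> \<in> space M. c \<le> S \<omega>} \<union> {\<omega> \<in> space M. \<bar>F 0 x0 \<omega>\<bar> \<le> 1 / c}"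
        proof (cases "c \<le> S \<omega>")
          case False
          hence "S \<omega> * exp (- real j) \<le> c * (1 / (c * c))" unfolding c(2) using c(1) by (intro mult_right_mono) auto
          thus ?thesis using w c(1) by (auto simp: A_def)
        qed (use w in \<open>auto simp: A_def\<close>)
      qed
    qed measurable
    also have "\<dots> \<le> prob {\<omega> \<in> space M. c \<le> S \<omega>} + prob {\<omega> \<in> space M. \<bar>F 0 x0 \<omega>\<bar> \<le> 1 / c}"
      by (intro measure_Un_le) measurable
    also have "prob {\<omega> \<in> space M. c \<le> S \<omega>} \<le> expectation S / c"
      using integral_Markov_inequality_measure[OF S, of "{}" c] S0 c(1) by simp
    also have "prob {\<omega> \<in> space M. \<bar>F 0 x0 \<omega>\<bar> \<le> 1 / c} \<le> 1 / c / sqrt (ip (F 0 x0) (F 0 x0))"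
      using c(1) by (intro prob_abs_le FV var) auto
    finally show ?thesis unfolding c(3) T_def by (simp add: add_divide_distrib mult.commute)
  qed
  have geo: "(\<lambda>j. T * exp (- 1 / 2) ^ j) sums (T * (1 / (1 - exp (- 1 / 2 :: real))))"
    by (intro sums_mult geometric_sums) simp
  have "(\<integral>\<^sup>+\<omega>. num_zeros (\<lambda>x. F 0 x \<omega>) {u..v} \<partial>M) \<le> (\<integral>\<^sup>+\<omega>. of_nat j0 + (\<Sum>j. indicator (A j) \<omega>) \<partial>M)"
    using pointwise by (intro nn_integral_mono) auto
  also have "\<dots> = of_nat j0 + (\<Sum>j. emeasure M (A j))"
    by (subst nn_integral_add) (simp_all add: nn_integral_suminf emeasure_space_1)
  also have "(\<Sum>j. emeasure M (A j)) \<le> (\<Sum>j. ennreal (T * exp (- 1 / 2) ^ j))"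
    using PA by (intro suminf_le) (auto simp: emeasure_eq_measure intro: ennreal_leI)
  also have "\<dots> = ennreal (T * (1 / (1 - exp (- 1 / 2))))"
    using geo T0 by (subst suminf_ennreal2) (auto simp: sums_iff)
  also have "of_nat j0 + \<dots> \<le> ennreal (exp 2 * y + 1) + ennreal (T * (1 / (1 - exp (- 1 / 2))))"
    unfolding ennreal_of_nat_eq_real_of_nat using j0(2) by (intro add_right_mono ennreal_leI)
  also have "\<dots> = ennreal (exp 2 * y + 1 + T * (1 / (1 - exp (- 1 / 2))))"
    using y T0 by (intro ennreal_plus[symmetric]) auto
  finally show ?thesis by (simp add: y_def T_def mult.assoc)
qed

end

section \<open>The centred Dirichlet kernel\<close>

text \<open>The sum of \<open>e\<^sup>i\<^sup>k\<^sup>s\<close> over \<open>k = 1, \<dots>, n\<close> is \<open>e\<^sup>i\<^sup>N\<^sup>s \<surd>n D(s)\<close> with the carrier frequency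
  \<open>N = (n + 1) / 2\<close> and a real even factor \<open>D\<close>, which is \<open>dirichlet n\<close>. The factor \<open>\<surd>n\<close> makes
  \<open>D\<^sup>2\<close> the Fejer kernel, whose mass over a period is \<open>2\<pi>\<close>.\<close>
definition dirichlet :: "nat \<Rightarrow> real \<Rightarrow> real" where
  "dirichlet n s = (\<Sum>k=1..n. cos ((real k - (real n + 1) / 2) * s)) / sqrt (real n)"

definition dirichlet' :: "nat \<Rightarrow> real \<Rightarrow> real" where
  "dirichlet' n s = - (\<Sum>k=1..n. (real k - (real n + 1) / 2) * sin ((real k - (real n + 1) / 2) * s)) / sqrt (real n)"

lemma dirichlet_deriv: "(dirichlet n has_real_derivative dirichlet' n s) (at s)"
  unfolding dirichlet_def[abs_def] dirichlet'_def
  by (rule DERIV_cdivide) (auto intro!: derivative_eq_intros simp: sum_negf mult.commute)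

lemma sum_sin_symmetric: "(\<Sum>k=1..n. sin ((real k - (real n + 1) / 2) * s)) = 0"
proof -
  let ?g = "\<lambda>k. sin ((real k - (real n + 1) / 2) * s)"
  have "(\<Sum>k=1..n. ?g k) = (\<Sum>k=1..n. ?g (n + 1 - k))"
    by (rule sum.atLeastAtMost_rev)
  also have "\<dots> = (\<Sum>k=1..n. - ?g k)"
  proof (intro sum.cong refl)
    fix k assume "k \<in> {1..n}"
    hence "(real (n + 1 - k) - (real n + 1) / 2) * s = - ((real k - (real n + 1) / 2) * s)"
      by (simp add: of_nat_diff field_simps)
    thus "?g (n + 1 - k) = - ?g k" by simp
  qed
  finally show ?thesis by (simp add: sum_negf)
qed

lemma split_freq: "real k * s = (real n + 1) / 2 * s + (real k - (real n + 1) / 2) * s"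
  by (simp only: distrib_right[symmetric]) simp

lemma sum_cos_eq: "(\<Sum>k=1..n. cos (real k * s)) = sqrt (real n) * (cos ((real n + 1) / 2 * s) * dirichlet n s)"
proof -
  have "(\<Sum>k=1..n. cos (real k * s)) = (\<Sum>k=1..n. cos ((real n + 1) / 2 * s) * cos ((real k - (real n + 1) / 2) * s)
      - sin ((real n + 1) / 2 * s) * sin ((real k - (real n + 1) / 2) * s))"
    by (intro sum.cong refl) (simp only: split_freq[of _ s n] cos_add)
  also have "\<dots> = cos ((real n + 1) / 2 * s) * (\<Sum>k=1..n. cos ((real k - (real n + 1) / 2) * s))"
    by (simp only: sum_subtractf sum_distrib_left[symmetric] sum_sin_symmetric) 
  finally show ?thesis by (cases "n = 0") (simp_all add: dirichlet_def)
qed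

lemma sum_sin_eq: "(\<Sum>k=1..n. sin (real k * s)) = sqrt (real n) * (sin ((real n + 1) / 2 * s) * dirichlet n s)"
proof -
  have "(\<Sum>k=1..n. sin (real k * s)) = (\<Sum>k=1..n. sin ((real n + 1) / 2 * s) * cos ((real k - (real n + 1) / 2) * s)
      + cos ((real n + 1) / 2 * s) * sin ((real k - (real n + 1) / 2) * s))"
    by (intro sum.cong refl) (simp only: split_freq[of _ s n] sin_add)
  also have "\<dots> = sin ((real n + 1) / 2 * s) * (\<Sum>k=1..n. cos ((real k - (real n + 1) / 2) * s))"
    by (simp only: sum.distrib sum_distrib_left[symmetric] sum_sin_symmetric) 
  finally show ?thesis by (cases "n = 0") (simp_all add: dirichlet_def)
qed

lemma sum_k_sin_eq: "(\<Sum>k=1..n. real k * sin (real k * s)) =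
    sqrt (real n) * ((real n + 1) / 2 * sin ((real n + 1) / 2 * s) * dirichlet n s - cos ((real n + 1) / 2 * s) * dirichlet' n s)"
proof -
  have A: "((\<lambda>s. \<Sum>k=1..n. cos (real k * s)) has_real_derivative - (\<Sum>k=1..n. real k * sin (real k * s))) (at s)"
    by (auto intro!: derivative_eq_intros simp: sum_negf mult.commute)
  have B: "((\<lambda>s. q * (cos (N * s) * dirichlet n s)) has_real_derivative
    - (q * (N * sin (N * s) * dirichlet n s - cos (N * s) * dirichlet' n s))) (at s)" for q N
    by (auto intro!: derivative_eq_intros dirichlet_deriv simp: algebra_simps)
  from DERIV_unique[OF A[unfolded sum_cos_eq] B[of "sqrt (real n)" "(real n + 1) / 2"]] show ?thesis by linarith
qed

lemma sum_k_cos_eq: "(\<Sum>k=1..n. real k * cos (real k * s)) =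
    sqrt (real n) * ((real n + 1) / 2 * cos ((real n + 1) / 2 * s) * dirichlet n s + sin ((real n + 1) / 2 * s) * dirichlet' n s)"
proof -
  have A: "((\<lambda>s. \<Sum>k=1..n. sin (real k * s)) has_real_derivative (\<Sum>k=1..n. real k * cos (real k * s))) (at s)"
    by (auto intro!: derivative_eq_intros simp: mult.commute)
  have B: "((\<lambda>s. q * (sin (N * s) * dirichlet n s)) has_real_derivative
    q * (N * cos (N * s) * dirichlet n s + sin (N * s) * dirichlet' n s)) (at s)" for q N
    by (auto intro!: derivative_eq_intros dirichlet_deriv simp: algebra_simps)
  from DERIV_unique[OF A[unfolded sum_sin_eq] B[of "sqrt (real n)" "(real n + 1) / 2"]] show ?thesis .
qed

text \<open>Multiplication by the carrier \<open>e\<^sup>i\<^sup>N\<^sup>s\<close> is a rotation of the plane: it preserves squares and inner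
  products, and its derivative contributes the terms with \<open>N\<close>.\<close>
lemma rotate_square:
  fixes c s x y :: real
  assumes "s\<^sup>2 + c\<^sup>2 = 1"
  shows "(c * x)\<^sup>2 + (s * x)\<^sup>2 = x\<^sup>2"
    and "(N * s * x - c * y)\<^sup>2 + (N * c * x + s * y)\<^sup>2 = N\<^sup>2 * x\<^sup>2 + y\<^sup>2"
    and "(s * x) * (N * c * x + s * y) - (c * x) * (N * s * x - c * y) = x * y"
proof -
  have "(c * x)\<^sup>2 + (s * x)\<^sup>2 = (s\<^sup>2 + c\<^sup>2) * x\<^sup>2" by (simp add: power2_eq_square algebra_simps)
  thus "(c * x)\<^sup>2 + (s * x)\<^sup>2 = x\<^sup>2" by (simp add: assms)
  have "(N * s * x - c * y)\<^sup>2 + (N * c * x + s * y)\<^sup>2 = (s\<^sup>2 + c\<^sup>2) * (N\<^sup>2 * x\<^sup>2 + y\<^sup>2)"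
    by (simp add: power2_eq_square algebra_simps)
  thus "(N * s * x - c * y)\<^sup>2 + (N * c * x + s * y)\<^sup>2 = N\<^sup>2 * x\<^sup>2 + y\<^sup>2" by (simp add: assms)
  have "(s * x) * (N * c * x + s * y) - (c * x) * (N * s * x - c * y) = (s\<^sup>2 + c\<^sup>2) * (x * y)"
    by (simp add: power2_eq_square algebra_simps)
  thus "(s * x) * (N * c * x + s * y) - (c * x) * (N * s * x - c * y) = x * y" by (simp add: assms)
qed

text \<open>With \<open>k\<close> and \<open>l\<close> separated by the addition theorems, these are the inner products of the vector of
  the cosine and sine sums with its derivative.\<close>
lemma fejer_sums:
  assumes n: "n > 0"
  shows "(\<Sum>k=1..n. \<Sum>l=1..n. cos ((real k - real l) * s)) = real n * (dirichlet n s)\<^sup>2"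
    and "(\<Sum>k=1..n. \<Sum>l=1..n. real l * sin ((real k - real l) * s)) = real n * (dirichlet n s * dirichlet' n s)"
    and "(\<Sum>k=1..n. \<Sum>l=1..n. real k * real l * cos ((real k - real l) * s))
      = real n * (((real n + 1) / 2)\<^sup>2 * (dirichlet n s)\<^sup>2 + (dirichlet' n s)\<^sup>2)"
proof -
  let ?N = "(real n + 1) / 2" and ?D = "dirichlet n s" and ?D' = "dirichlet' n s"
  have sq: "sqrt (real n) * sqrt (real n) = real n" by simp
  have "(\<Sum>k=1..n. \<Sum>l=1..n. cos ((real k - real l) * s))
    = (\<Sum>k=1..n. cos (real k * s)) * (\<Sum>l=1..n. cos (real l * s)) + (\<Sum>k=1..n. sin (real k * s)) * (\<Sum>l=1..n. sin (real l * s))"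
    unfolding sum_product sum.distrib[symmetric]
    by (intro sum.cong refl) (simp add: cos_diff left_diff_distrib)
  also have "\<dots> = (sqrt (real n) * sqrt (real n)) * ((cos (?N * s) * ?D)\<^sup>2 + (sin (?N * s) * ?D)\<^sup>2)"
    unfolding sum_cos_eq sum_sin_eq power2_eq_square by (simp only: algebra_simps)
  finally show "(\<Sum>k=1..n. \<Sum>l=1..n. cos ((real k - real l) * s)) = real n * ?D\<^sup>2"
    unfolding sq rotate_square(1)[OF sin_cos_squared_add] .
  have "(\<Sum>k=1..n. \<Sum>l=1..n. real l * sin ((real k - real l) * s))
    = (\<Sum>k=1..n. sin (real k * s)) * (\<Sum>l=1..n. real l * cos (real l * s)) - (\<Sum>k=1..n. cos (real k * s)) * (\<Sum>l=1..n. real l * sin (real l * s))"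
    unfolding sum_product sum_subtractf[symmetric]
    by (intro sum.cong refl) (simp add: sin_diff left_diff_distrib right_diff_distrib)
  also have "\<dots> = (sqrt (real n) * sqrt (real n)) * ((sin (?N * s) * ?D) * (?N * cos (?N * s) * ?D + sin (?N * s) * ?D')
      - (cos (?N * s) * ?D) * (?N * sin (?N * s) * ?D - cos (?N * s) * ?D'))"
    unfolding sum_cos_eq sum_sin_eq sum_k_cos_eq sum_k_sin_eq by (simp only: algebra_simps)
  finally show "(\<Sum>k=1..n. \<Sum>l=1..n. real l * sin ((real k - real l) * s)) = real n * (?D * ?D')"
    unfolding sq rotate_square(3)[OF sin_cos_squared_add] .
  have "(\<Sum>k=1..n. \<Sum>l=1..n. real k * real l * cos ((real k - real l) * s))
    = (\<Sum>k=1..n. real k * sin (real k * s)) * (\<Sum>l=1..n. real l * sin (real l * s))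
      + (\<Sum>k=1..n. real k * cos (real k * s)) * (\<Sum>l=1..n. real l * cos (real l * s))"
    unfolding sum_product sum.distrib[symmetric]
    by (intro sum.cong refl) (simp add: cos_diff left_diff_distrib algebra_simps)
  also have "\<dots> = (sqrt (real n) * sqrt (real n)) * ((?N * sin (?N * s) * ?D - cos (?N * s) * ?D')\<^sup>2
      + (?N * cos (?N * s) * ?D + sin (?N * s) * ?D')\<^sup>2)"
    unfolding sum_k_cos_eq sum_k_sin_eq power2_eq_square by (simp only: algebra_simps)
  finally show "(\<Sum>k=1..n. \<Sum>l=1..n. real k * real l * cos ((real k - real l) * s))
      = real n * (?N\<^sup>2 * ?D\<^sup>2 + ?D'\<^sup>2)"
    unfolding sq rotate_square(2)[OF sin_cos_squared_add] .
qed

text \<open>Stated without division, so that it also holds where \<open>sin (s / 2)\<close> vanishes.\<close>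
lemma dirichlet_closed_form: "sqrt (real n) * (sin (s / 2) * dirichlet n s) = sin (real n * s / 2)"
proof (cases "n = 0")
  case False
  define h where "h k = sin ((real k - real n / 2) * s)" for k
  have "2 * (sin (s / 2) * (\<Sum>k=1..n. cos ((real k - (real n + 1) / 2) * s))) = (\<Sum>k=1..n. h k - h (k - 1))"
    unfolding sum_distrib_left
  proof (intro sum.cong refl)
    fix k assume k: "k \<in> {1..n}"
    let ?u = "(real k - (real n + 1) / 2) * s"
    have "h k = sin (?u + s / 2)" "h (k - 1) = sin (?u - s / 2)"
      using k by (auto simp: h_def of_nat_diff field_simps intro!: arg_cong[where f = sin])
    thus "2 * (sin (s / 2) * cos ?u) = h k - h (k - 1)" by (simp add: sin_add sin_diff)
  qed
  also have "\<dots> = h n - h 0" by (induction n) (simp_all add: sum.cl_ivl_Suc)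
  also have "\<dots> = 2 * sin (real n * s / 2)" by (simp add: h_def field_simps)
  finally show ?thesis using False by (simp add: dirichlet_def)
qed simp

lemma dirichlet'_closed_form:
  "sin (s / 2) * dirichlet' n s = sqrt (real n) / 2 * cos (real n * s / 2) - dirichlet n s * cos (s / 2) / 2"
proof (cases "n = 0")
  case True thus ?thesis by (simp add: dirichlet_def dirichlet'_def)
next
  case False
  have "((\<lambda>s. sqrt (real n) * (sin (s / 2) * dirichlet n s)) has_real_derivative
     sqrt (real n) * (cos (s / 2) / 2 * dirichlet n s + sin (s / 2) * dirichlet' n s)) (at s)"
    by (auto intro!: derivative_eq_intros dirichlet_deriv simp: algebra_simps)
  moreover have "((\<lambda>s. sin (real n * s / 2)) has_real_derivative cos (real n * s / 2) * (real n / 2)) (at s)"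
    by (auto intro!: derivative_eq_intros)
  ultimately have "sqrt (real n) * (cos (s / 2) / 2 * dirichlet n s + sin (s / 2) * dirichlet' n s) = cos (real n * s / 2) * (real n / 2)"
    unfolding dirichlet_closed_form using DERIV_unique by blast
  also have "\<dots> = sqrt (real n) * (sqrt (real n) / 2 * cos (real n * s / 2))" by simp
  finally have "cos (s / 2) / 2 * dirichlet n s + sin (s / 2) * dirichlet' n s = sqrt (real n) / 2 * cos (real n * s / 2)"
    using False by (metis mult_left_cancel of_nat_eq_0_iff real_sqrt_eq_zero_cancel_iff)
  thus ?thesis by (simp add: algebra_simps)
qed

lemma continuous_dirichlet [continuous_intros]:
  assumes "continuous_on A g"
  shows "continuous_on A (\<lambda>t. dirichlet n (g t))" "continuous_on A (\<lambda>t. dirichlet' n (g t))"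
proof -
  have "continuous_on UNIV (\<lambda>s. c * (\<Sum>k=1..n. cos ((real k - N) * s)))"
    "continuous_on UNIV (\<lambda>s. c * (\<Sum>k=1..n. (real k - N) * sin ((real k - N) * s)))" for c N
    by (intro continuous_intros)+
  from this(1)[of "1 / sqrt (real n)" "(real n + 1) / 2"] this(2)[of "- 1 / sqrt (real n)" "(real n + 1) / 2"]
  have "continuous_on UNIV (dirichlet n)" "continuous_on UNIV (dirichlet' n)"
    by (simp_all add: dirichlet_def[abs_def] dirichlet'_def[abs_def])
  thus "continuous_on A (\<lambda>t. dirichlet n (g t))" "continuous_on A (\<lambda>t. dirichlet' n (g t))"
    using assms continuous_on_compose2 by blast+
qed

lemma measurable_dirichlet [measurable]: "dirichlet n \<in> borel_measurable borel" "dirichlet' n \<in> borel_measurable borel"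
  by (intro borel_measurable_continuous_onI continuous_intros)+

text \<open>Lebesgue measure on one period, as a measure on the Borel sets of the whole line. Translates and
  restrictions then need no change of the underlying space.\<close>
definition circ :: "real measure" where
  "circ = density lborel (\<lambda>t. ennreal (indicator {-pi..pi} t))"

lemma sets_circ [simp, measurable_cong]: "sets circ = sets borel" and space_circ [simp]: "space circ = UNIV"
  by (simp_all add: circ_def)

lemma circ_emeasure: "emeasure circ UNIV = ennreal (2 * pi)"
proof -
  have "emeasure circ UNIV = (\<integral>\<^sup>+t. indicator {-pi..pi} t \<partial>lborel)"
    by (simp add: circ_def emeasure_density ennreal_indicator)
  thus ?thesis by simp
qed

lemma finite_measure_circ: "finite_measure circ"
  by standard (simp add: circ_emeasure)

lemma measure_circ: "measure circ UNIV = 2 * pi"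
  by (simp add: measure_def circ_emeasure)

lemma AE_circ: "AE t in circ. t \<in> {-pi..pi}"
proof -
  have m: "(\<lambda>t. ennreal (indicator {-pi..pi} t)) \<in> borel_measurable lborel" by measurable
  show ?thesis unfolding circ_def AE_density[OF m]
    by (rule AE_I2) (simp add: indicator_def split: if_splits)
qed

lemma integral_circ:
  fixes g :: "real \<Rightarrow> real"
  assumes "g \<in> borel_measurable borel"
  shows "(LINT t|circ. g t) = (LINT t|lborel. g t * indicator {-pi..pi} t)"
  unfolding circ_def using assms by (subst integral_density) (auto simp: mult.commute)

lemma integrable_circ_bounded:
  fixes g :: "real \<Rightarrow> real"
  assumes [measurable]: "g \<in> borel_measurable borel" and "\<And>t. t \<in> {-pi..pi} \<Longrightarrow> \<bar>g t\<bar> \<le> C"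
  shows "integrable circ g"
proof (rule finite_measure.integrable_const_bound[OF finite_measure_circ])
  show "AE t in circ. norm (g t) \<le> C" using AE_circ by eventually_elim (use assms(2) in simp)
qed measurable

lemma integrable_circ_continuous:
  fixes g :: "real \<Rightarrow> real"
  assumes "continuous_on UNIV g"
  shows "integrable circ g"
proof -
  have "continuous_on {-pi..pi} g" using assms continuous_on_subset by blast
  hence "compact (g ` {-pi..pi})" by (intro compact_continuous_image) auto
  then obtain C where "\<And>y. y \<in> g ` {-pi..pi} \<Longrightarrow> norm y \<le> C"
    using compact_imp_bounded bounded_iff by metis
  thus ?thesis
    using assms by (intro integrable_circ_bounded[where C = C]) (auto intro: borel_measurable_continuous_onI)
qed

lemma integral_circ_cos:
  assumes "m \<noteq> 0"
  shows "(LINT t|circ. cos (of_int m * (x - t))) = 0"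
proof -
  let ?F = "\<lambda>t. - sin (of_int m * (x - t)) / of_int m"
  have "(LINT t|circ. cos (of_int m * (x - t))) = (LINT t|lborel. cos (of_int m * (x - t)) * indicator {-pi..pi} t)"
    by (rule integral_circ) measurable
  also have "\<dots> = ?F pi - ?F (- pi)"
    by (rule integral_FTC_Icc_real) (use assms in \<open>auto intro!: derivative_eq_intros simp: field_simps\<close>)
  also have "\<dots> = 0"
    by (simp add: algebra_simps sin_add sin_diff)
  finally show ?thesis .
qed

lemma integral_circ_sin:
  assumes "m \<noteq> 0"
  shows "(LINT t|circ. sin (of_int m * (x - t))) = 0"
proof -
  let ?F = "\<lambda>t. cos (of_int m * (x - t)) / of_int m"
  have "(LINT t|circ. sin (of_int m * (x - t))) = (LINT t|lborel. sin (of_int m * (x - t)) * indicator {-pi..pi} t)"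
    by (rule integral_circ) measurable
  also have "\<dots> = ?F pi - ?F (- pi)"
    by (rule integral_FTC_Icc_real) (use assms in \<open>auto intro!: derivative_eq_intros simp: field_simps\<close>)
  also have "\<dots> = 0"
    by (simp add: algebra_simps cos_add cos_diff)
  finally show ?thesis .
qed

lemma integral_circ_trig:
  fixes k l :: nat
  shows "(LINT t|circ. cos ((real k - real l) * (x - t))) = (if k = l then 2 * pi else 0)"
    and "(LINT t|circ. sin ((real k - real l) * (x - t))) = 0"
proof -
  have eq: "real k - real l = of_int (int k - int l)" by simp
  show "(LINT t|circ. cos ((real k - real l) * (x - t))) = (if k = l then 2 * pi else 0)"
    unfolding eq using integral_circ_cos[of "int k - int l" x] by (auto simp: measure_circ)
  show "(LINT t|circ. sin ((real k - real l) * (x - t))) = 0"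
    unfolding eq using integral_circ_sin[of "int k - int l" x] by (cases "k = l") auto
qed

lemma sum_squares_real: "(\<Sum>k=1..n. (real k)\<^sup>2) = real n * (real n + 1) * (2 * real n + 1) / 6"
  by (induction n) (auto simp: field_simps power2_eq_square)

text \<open>Orthogonality of the characters leaves the diagonal \<open>k = l\<close> of the double sums. The third integral
  is asymptotic to \<open>2\<pi> n\<^sup>2 / 3\<close>; this is the origin of the \<open>3\<close> in the limit.\<close>
lemma dirichlet_masses:
  assumes n: "n > 0"
  shows "(LINT t|circ. (dirichlet n (x - t))\<^sup>2) = 2 * pi" (is ?A)
    and "(LINT t|circ. dirichlet n (x - t) * dirichlet' n (x - t)) = 0" (is ?B)
    and "(LINT t|circ. ((real n + 1) / 2)\<^sup>2 * (dirichlet n (x - t))\<^sup>2 + (dirichlet' n (x - t))\<^sup>2)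
      = 2 * pi * ((real n + 1) * (2 * real n + 1) / 6)" (is ?C)
proof -
  have swap: "(LINT t|circ. (\<Sum>k=1..n. \<Sum>l=1..n. g k l t)) = (\<Sum>k=1..n. \<Sum>l=1..n. LINT t|circ. g k l t)"
    if "\<And>k l. integrable circ (g k l)" for g :: "nat \<Rightarrow> nat \<Rightarrow> real \<Rightarrow> real"
    using that by (simp add: Bochner_Integration.integral_sum)
  have int: "integrable circ (\<lambda>t. c * cos ((real k - real l) * (x - t)))" "integrable circ (\<lambda>t. c * sin ((real k - real l) * (x - t)))" for c and k l :: nat
    by (intro integrable_circ_continuous continuous_intros)+
  have "real n * (LINT t|circ. (dirichlet n (x - t))\<^sup>2) = (\<Sum>k=1..n. \<Sum>l=1..n. LINT t|circ. cos ((real k - real l) * (x - t)))"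
    unfolding integral_mult_right_zero[symmetric] fejer_sums(1)[OF n, symmetric]
    by (rule swap) (use int(1)[of 1] in simp)
  also have "\<dots> = real n * (2 * pi)" by (simp add: integral_circ_trig)
  finally show ?A using n by simp
  have "real n * (LINT t|circ. dirichlet n (x - t) * dirichlet' n (x - t))
     = (\<Sum>k=1..n. \<Sum>l=1..n. LINT t|circ. real l * sin ((real k - real l) * (x - t)))"
    unfolding integral_mult_right_zero[symmetric] fejer_sums(2)[OF n, symmetric]
    by (rule swap) (rule int)
  also have "\<dots> = 0" by (simp add: integral_circ_trig)
  finally show ?B using n by simp
  have "real n * (LINT t|circ. ((real n + 1) / 2)\<^sup>2 * (dirichlet n (x - t))\<^sup>2 + (dirichlet' n (x - t))\<^sup>2)
     = (\<Sum>k=1..n. \<Sum>l=1..n. LINT t|circ. (real k * real l) * cos ((real k - real l) * (x - t)))"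
    unfolding integral_mult_right_zero[symmetric] fejer_sums(3)[OF n, symmetric]
    by (rule swap) (rule int)
  also have "\<dots> = (\<Sum>k=1..n. 2 * pi * (real k)\<^sup>2)"
  proof (rule sum.cong[OF refl])
    fix k assume k: "k \<in> {1..n}"
    have "(LINT t|circ. (real k * real l) * cos ((real k - real l) * (x - t))) = (if l = k then 2 * pi * (real k)\<^sup>2 else 0)" for l
      unfolding integral_mult_right_zero integral_circ_trig by (simp add: power2_eq_square)
    thus "(\<Sum>l=1..n. LINT t|circ. (real k * real l) * cos ((real k - real l) * (x - t))) = 2 * pi * (real k)\<^sup>2"
      using k by simp
  qed
  also have "\<dots> = real n * (2 * pi * ((real n + 1) * (2 * real n + 1) / 6))"
    unfolding sum_distrib_left[symmetric] sum_squares_real by simp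
  finally show ?C using n by simp
qed

section \<open>The speed where the spectral density is positive\<close>

text \<open>The squared speed has the form \<open>(a b - e\<^sup>2) / a\<^sup>2\<close>. Here \<open>a\<close> stays away from zero, but neither \<open>a\<close> nor
  \<open>b\<close> has to converge: it is enough that \<open>b\<close> is asymptotically proportional to \<open>a\<close>.\<close>
lemma ratio_tendsto:
  fixes a b e :: "nat \<Rightarrow> real"
  assumes ba: "(\<lambda>n. b n - \<kappa> * a n) \<longlonglongrightarrow> 0" and e: "e \<longlonglongrightarrow> 0"
    and c: "c > 0" and a: "eventually (\<lambda>n. c \<le> a n) sequentially"
  shows "(\<lambda>n. (a n * b n - (e n)\<^sup>2) / (a n)\<^sup>2) \<longlonglongrightarrow> \<kappa>"
proof -
  have "(\<lambda>n. \<bar>b n - \<kappa> * a n\<bar> / c + (e n / c)\<^sup>2) \<longlonglongrightarrow> \<bar>0\<bar> / c + (0 / c)\<^sup>2"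
    using c by (intro tendsto_intros ba e) auto
  hence lim: "(\<lambda>n. \<bar>b n - \<kappa> * a n\<bar> / c + (e n / c)\<^sup>2) \<longlonglongrightarrow> 0" by simp
  have "(\<lambda>n. (a n * b n - (e n)\<^sup>2) / (a n)\<^sup>2 - \<kappa>) \<longlonglongrightarrow> 0"
  proof (rule Lim_null_comparison[OF _ lim])
    show "eventually (\<lambda>n. norm ((a n * b n - (e n)\<^sup>2) / (a n)\<^sup>2 - \<kappa>) \<le> \<bar>b n - \<kappa> * a n\<bar> / c + (e n / c)\<^sup>2) sequentially"
      using a
    proof eventually_elim
      case (elim n)
      have pos: "a n > 0" using elim c by linarith
      have "(a n * b n - (e n)\<^sup>2) / (a n)\<^sup>2 - \<kappa> = (b n - \<kappa> * a n) / a n - (e n / a n)\<^sup>2"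
        using pos by (simp add: field_simps power2_eq_square)
      hence "norm ((a n * b n - (e n)\<^sup>2) / (a n)\<^sup>2 - \<kappa>) \<le> \<bar>b n - \<kappa> * a n\<bar> / a n + (e n / a n)\<^sup>2"
        using pos abs_triangle_ineq4[of "(b n - \<kappa> * a n) / a n" "(e n / a n)\<^sup>2"] by simp
      also have "\<dots> \<le> \<bar>b n - \<kappa> * a n\<bar> / c + (e n / c)\<^sup>2"
        unfolding power_divide using elim c pos
        by (intro add_mono divide_left_mono power_mono) auto
      finally show ?case .
    qed
  qed
  thus ?thesis by (rule LIM_zero_cancel)
qed

lemma sin_sq_half_ge:
  assumes "0 < \<eta>" "\<eta> \<le> \<bar>s\<bar>" "\<bar>s\<bar> \<le> 2 * pi - \<eta>"
  shows "(sin (\<eta> / 2))\<^sup>2 \<le> (sin (s / 2))\<^sup>2"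
proof -
  have "sin (\<eta> / 2) \<le> sin (\<bar>s\<bar> / 2)"
  proof (cases "\<bar>s\<bar> \<le> pi")
    case True thus ?thesis using assms by (intro sin_monotone_2pi_le) auto
  next
    case False
    have "sin (\<eta> / 2) \<le> sin (pi - \<bar>s\<bar> / 2)" using assms False by (intro sin_monotone_2pi_le) auto
    thus ?thesis by (simp add: sin_diff)
  qed
  moreover have "0 \<le> sin (\<eta> / 2)" using assms by (intro sin_ge_zero) auto
  ultimately have "(sin (\<eta> / 2))\<^sup>2 \<le> (sin (\<bar>s\<bar> / 2))\<^sup>2" by (intro power_mono)
  thus ?thesis by (cases "s \<ge> 0") (simp_all add: abs_if)
qed

lemma dirichlet_tail:
  assumes n: "n > 0" and \<sigma>: "0 < \<sigma>" "\<sigma> \<le> (sin (s / 2))\<^sup>2"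
  shows "(dirichlet n s)\<^sup>2 \<le> 1 / (real n * \<sigma>)"
    and "(dirichlet' n s)\<^sup>2 / (real n)\<^sup>2 \<le> (1 / \<sigma> + 1 / \<sigma>\<^sup>2) / real n"
proof -
  have "real n * ((sin (s / 2))\<^sup>2 * (dirichlet n s)\<^sup>2) = (sin (real n * s / 2))\<^sup>2"
    unfolding dirichlet_closed_form[symmetric] by (simp add: power_mult_distrib)
  hence le1: "real n * ((sin (s / 2))\<^sup>2 * (dirichlet n s)\<^sup>2) \<le> 1" using abs_sin_le_one by (simp add: abs_square_le_1)
  have "real n * (\<sigma> * (dirichlet n s)\<^sup>2) \<le> real n * ((sin (s / 2))\<^sup>2 * (dirichlet n s)\<^sup>2)"
    using \<sigma> by (intro mult_left_mono mult_right_mono) auto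
  hence "real n * \<sigma> * (dirichlet n s)\<^sup>2 \<le> 1" using le1 by simp
  thus D: "(dirichlet n s)\<^sup>2 \<le> 1 / (real n * \<sigma>)" using n \<sigma> by (simp add: field_simps)
  have sq: "(u - v)\<^sup>2 \<le> 2 * (u\<^sup>2 + v\<^sup>2)" for u v :: real
    using zero_le_power2[of "u + v"] by (simp add: power2_eq_square algebra_simps)
  have "\<sigma> * (dirichlet' n s)\<^sup>2 \<le> (sin (s / 2))\<^sup>2 * (dirichlet' n s)\<^sup>2"
    using \<sigma> by (intro mult_right_mono) auto
  also have "\<dots> = (sqrt (real n) / 2 * cos (real n * s / 2) - dirichlet n s * cos (s / 2) / 2)\<^sup>2"
    unfolding dirichlet'_closed_form[symmetric] by (simp add: power_mult_distrib)
  also have "\<dots> \<le> 2 * ((sqrt (real n) / 2 * cos (real n * s / 2))\<^sup>2 + (dirichlet n s * cos (s / 2) / 2)\<^sup>2)" by (rule sq)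
  also have "\<dots> = (real n * (cos (real n * s / 2))\<^sup>2 + (dirichlet n s)\<^sup>2 * (cos (s / 2))\<^sup>2) / 2"
    by (simp add: power_mult_distrib power_divide)
  also have "\<dots> \<le> (real n * 1 + (1 / (real n * \<sigma>)) * 1) / 2"
    using D n \<sigma> abs_cos_le_one by (intro divide_right_mono add_mono mult_mono) (auto simp: abs_square_le_1)
  also have "\<dots> \<le> real n + real n / \<sigma>"
  proof -
    have "1 / (real n * \<sigma>) \<le> real n / \<sigma>" using n \<sigma>(1) by (simp add: field_simps) (metis One_nat_def Suc_leI mult_le_mono1 nat_mult_1 of_nat_1 of_nat_le_iff of_nat_mult order_trans)
    moreover have l2: "0 \<le> real n / \<sigma>" using \<sigma>(1) by simp
    moreover have aux: "(N * 1 + t * 1) / 2 \<le> N + u" if "t \<le> u" "0 \<le> u" "0 \<le> N" for N t u :: real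
      using that by simp
    ultimately show ?thesis by (intro aux) auto
  qed
  finally have "(dirichlet' n s)\<^sup>2 \<le> (real n + real n / \<sigma>) / \<sigma>" using \<sigma>(1) by (simp add: field_simps)
  hence "(dirichlet' n s)\<^sup>2 / (real n)\<^sup>2 \<le> (real n + real n / \<sigma>) / \<sigma> / (real n)\<^sup>2" by (intro divide_right_mono) auto
  also have "\<dots> = (1 / \<sigma> + 1 / \<sigma>\<^sup>2) / real n" using n \<sigma>(1) by (simp add: field_simps power2_eq_square)
  finally show "(dirichlet' n s)\<^sup>2 / (real n)\<^sup>2 \<le> (1 / \<sigma> + 1 / \<sigma>\<^sup>2) / real n" .
qed

text \<open>Away from the diagonal the closed forms give \<open>n D\<^sup>2 = sin\<^sup>2 (n s / 2) / sin\<^sup>2 (s / 2)\<close> and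
  \<open>D'\<^sup>2 / n \<approx> cos\<^sup>2 (n s / 2) / (4 sin\<^sup>2 (s / 2))\<close>. The squared carrier frequency contributes another
  quarter of \<open>n D\<^sup>2\<close>, so up to terms oscillating with frequency \<open>n\<close> the third kernel divided by \<open>n\<close> is
  one half of \<open>n D\<^sup>2\<close>. This is the origin of the \<open>2\<close> in the limit.\<close>
lemma dirichlet_off_diagonal:
  assumes n: "n > 0" and \<sigma>: "0 < \<sigma>" "\<sigma> \<le> (sin (s / 2))\<^sup>2"
  shows "real n * (dirichlet n s)\<^sup>2 = (1 - cos (real n * s)) / (2 * (sin (s / 2))\<^sup>2)"
    and "\<bar>(((real n + 1) / 2)\<^sup>2 * (dirichlet n s)\<^sup>2 + (dirichlet' n s)\<^sup>2) / real n - real n * (dirichlet n s)\<^sup>2 / 2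
        - cos (real n * s) / (4 * (sin (s / 2))\<^sup>2)\<bar> \<le> 2 / \<sigma>\<^sup>2 / real n"
    and "\<bar>dirichlet n s * dirichlet' n s - sin (real n * s) / (4 * (sin (s / 2))\<^sup>2)\<bar> \<le> 1 / \<sigma>\<^sup>2 / real n"
proof -
  define p where "p = sin (real n * s / 2)"
  define c where "c = cos (real n * s / 2)"
  define q where "q = sin (s / 2)"
  define d where "d = cos (s / 2)"
  define r where "r = sqrt (real n)"
  have r: "r > 0" "r * r = real n" using n by (auto simp: r_def)
  have n1: "real n \<ge> 1" using n by simp
  have q0: "q \<noteq> 0" using \<sigma> by (auto simp: q_def)
  have pc: "p\<^sup>2 + c\<^sup>2 = 1" by (simp add: p_def c_def)
  have qd: "q\<^sup>2 + d\<^sup>2 = 1" by (simp add: q_def d_def)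
  have cosn: "cos (real n * s) = c\<^sup>2 - p\<^sup>2"
    using cos_double[of "real n * s / 2"] by (simp add: c_def p_def)
  have sinn: "sin (real n * s) = 2 * p * c"
    using sin_double[of "real n * s / 2"] by (simp add: c_def p_def)
  define i where "i = 1 / q"
  define R where "R = 1 / r"
  define L where "L = 1 / real n"
  have rR: "r * R = 1" and RR: "R * R = L" and nL: "real n * L = 1" and rr: "r * r = real n"
    using r n by (auto simp: R_def L_def)
  have D: "dirichlet n s = p * R * i"
    using dirichlet_closed_form[of n s] r q0 by (simp add: p_def q_def r_def R_def i_def field_simps)
  have D': "dirichlet' n s = (r * c / 2 - p * d * R * i / 2) * i"
    using dirichlet'_closed_form[of s n] q0 unfolding D
    by (simp add: c_def d_def q_def[symmetric] r_def[symmetric] i_def field_simps)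
  have s1: "\<sigma> \<le> q\<^sup>2" using \<sigma> by (simp add: q_def)
  have q1: "q\<^sup>2 \<le> 1" using qd zero_le_power2[of d] by linarith
  have ineq: "\<bar>p\<bar> \<le> 1" "\<bar>c\<bar> \<le> 1" "\<bar>d\<bar> \<le> 1" by (auto simp: p_def c_def d_def)
  have aq: "\<bar>q\<bar> \<le> 1" using q1 by (simp add: abs_square_le_1)
  have aq2: "\<sigma> \<le> \<bar>q\<bar>"
  proof -
    have "\<bar>q\<bar> * \<bar>q\<bar> \<le> 1 * \<bar>q\<bar>" using aq by (intro mult_right_mono) auto
    thus ?thesis using s1 by (simp add: power2_eq_square abs_mult_self_eq)
  qed
  have i2: "1 / q\<^sup>2 \<le> 1 / \<sigma>" using s1 \<sigma>(1) q0 by (intro divide_left_mono) auto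
  have sle1: "\<sigma> \<le> 1" using s1 q1 by linarith
  have i3: "1 / \<bar>q\<bar> ^ 3 \<le> 1 / \<sigma>\<^sup>2"
  proof -
    have "\<sigma> * \<sigma> \<le> \<bar>q\<bar> * q\<^sup>2" using aq2 s1 \<sigma>(1) by (intro mult_mono) auto
    also have "\<dots> = \<bar>q\<bar> ^ 3" by (simp add: power3_eq_cube power2_eq_square)
    finally show ?thesis using \<sigma>(1) q0 by (intro divide_left_mono) (auto simp: power2_eq_square)
  qed
  have i4: "1 / q ^ 4 \<le> 1 / \<sigma>\<^sup>2"
  proof -
    have "\<sigma> * \<sigma> \<le> q\<^sup>2 * q\<^sup>2" using s1 \<sigma>(1) by (intro mult_mono) auto
    also have "\<dots> = q ^ 4" by (simp flip: power_add)
    finally show ?thesis using \<sigma>(1) q0 by (intro divide_left_mono) (auto simp: power2_eq_square)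
  qed
  have i2': "1 / q\<^sup>2 \<le> 1 / \<sigma>\<^sup>2"
  proof -
    have "\<sigma>\<^sup>2 \<le> \<sigma>" using sle1 \<sigma>(1) by (simp add: power2_eq_square)
    hence "1 / \<sigma> \<le> 1 / \<sigma>\<^sup>2" using \<sigma>(1) by (intro divide_left_mono) auto
    thus ?thesis using i2 by linarith
  qed
  have nD: "real n * (dirichlet n s)\<^sup>2 = p\<^sup>2 * i\<^sup>2"
  proof -
    have "real n * (dirichlet n s)\<^sup>2 = (r * R) * (r * R) * (p\<^sup>2 * i\<^sup>2)"
      unfolding D rr[symmetric] by (simp add: power2_eq_square)
    thus ?thesis unfolding rR by simp
  qed
  show "real n * (dirichlet n s)\<^sup>2 = (1 - cos (real n * s)) / (2 * (sin (s / 2))\<^sup>2)"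
  proof -
    have two: "1 - (c\<^sup>2 - p\<^sup>2) = 2 * p\<^sup>2" using pc by simp
    show ?thesis unfolding nD cosn q_def[symmetric] two i_def by (simp add: power_divide)
  qed
  have i_sq: "i\<^sup>2 = 1 / q\<^sup>2" "i ^ 3 = 1 / q ^ 3" "i ^ 4 = 1 / q ^ 4" by (simp_all add: i_def power_divide)
  have cos_term: "cos (real n * s) / (4 * (sin (s / 2))\<^sup>2) = (c\<^sup>2 - p\<^sup>2) * i\<^sup>2 / 4"
    and sin_term: "sin (real n * s) / (4 * (sin (s / 2))\<^sup>2) = p * c * i\<^sup>2 / 2"
    unfolding cosn sinn q_def[symmetric] i_sq by (simp_all add: mult.commute)
  let ?e1 = "(2 * real n + 1) / (4 * (real n)\<^sup>2) * (p\<^sup>2 * (1 / q\<^sup>2))"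
  let ?e2 = "c * p * d / (2 * real n) * (1 / q ^ 3)"
  let ?e3 = "p\<^sup>2 * d\<^sup>2 / (4 * (real n)\<^sup>2) * (1 / q ^ 4)"
  have DD: "(dirichlet n s)\<^sup>2 = p\<^sup>2 * i\<^sup>2 * L"
    unfolding D RR[symmetric] by (simp add: power2_eq_square)
  have D'D': "(dirichlet' n s)\<^sup>2 = (real n * c\<^sup>2 / 4 - c * p * d * i / 2 + p\<^sup>2 * d\<^sup>2 * L * i\<^sup>2 / 4) * i\<^sup>2"
  proof -
    have "(dirichlet' n s)\<^sup>2 = ((r * r) * c\<^sup>2 / 4 - c * p * d * (r * R) * i / 2 + p\<^sup>2 * d\<^sup>2 * (R * R) * i\<^sup>2 / 4) * i\<^sup>2"
      unfolding D' by (simp add: power2_eq_square algebra_simps)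
    thus ?thesis unfolding rR RR rr by simp
  qed
  have E0: "(((real n + 1) / 2)\<^sup>2 * (dirichlet n s)\<^sup>2 + (dirichlet' n s)\<^sup>2) / real n - real n * (dirichlet n s)\<^sup>2 / 2
        - cos (real n * s) / (4 * (sin (s / 2))\<^sup>2) = ?e1 - ?e2 + ?e3"
  proof -
    have alg: "(((N + 1) / 2)\<^sup>2 * (p\<^sup>2 * i\<^sup>2 * L) + (N * c\<^sup>2 / 4 - c * p * d * i / 2 + p\<^sup>2 * d\<^sup>2 * L * i\<^sup>2 / 4) * i\<^sup>2) * L
        - p\<^sup>2 * i\<^sup>2 / 2 - (c\<^sup>2 - p\<^sup>2) * i\<^sup>2 / 4
      = (2 * N + 1) * L\<^sup>2 / 4 * (p\<^sup>2 * i\<^sup>2) - c * p * d * L / 2 * i ^ 3 + p\<^sup>2 * d\<^sup>2 * L\<^sup>2 / 4 * i ^ 4"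
      if NL: "N * L = 1" for N :: real
    proof -
      have "(((N + 1) / 2)\<^sup>2 * (p\<^sup>2 * i\<^sup>2 * L) + (N * c\<^sup>2 / 4 - c * p * d * i / 2 + p\<^sup>2 * d\<^sup>2 * L * i\<^sup>2 / 4) * i\<^sup>2) * L
          - p\<^sup>2 * i\<^sup>2 / 2 - (c\<^sup>2 - p\<^sup>2) * i\<^sup>2 / 4
        = (N * L) * (N * L) * (p\<^sup>2 * i\<^sup>2) / 4 + (N * L) * (c\<^sup>2 * i\<^sup>2) / 4 - p\<^sup>2 * i\<^sup>2 / 4 - c\<^sup>2 * i\<^sup>2 / 4
          + (2 * N + 1) * L\<^sup>2 / 4 * (p\<^sup>2 * i\<^sup>2) - c * p * d * L / 2 * i ^ 3 + p\<^sup>2 * d\<^sup>2 * L\<^sup>2 / 4 * i ^ 4"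
        by (simp add: power2_eq_square power3_eq_cube power4_eq_xxxx field_simps)
      thus ?thesis unfolding NL by simp
    qed
    have e: "?e1 = (2 * real n + 1) * L\<^sup>2 / 4 * (p\<^sup>2 * i\<^sup>2)" "?e2 = c * p * d * L / 2 * i ^ 3"
      "?e3 = p\<^sup>2 * d\<^sup>2 * L\<^sup>2 / 4 * i ^ 4"
      unfolding i_sq L_def by (simp_all add: power_divide)
    have z: "z / real n = z * L" for z by (simp add: L_def)
    show ?thesis unfolding e unfolding nD cos_term unfolding DD D'D' unfolding z by (rule alg[OF nL])
  qed
  have E1: "\<bar>?e1\<bar> \<le> 1 / \<sigma>\<^sup>2 / real n"
  proof -
    have h1: "p\<^sup>2 * (1 / q\<^sup>2) \<le> 1 * (1 / \<sigma>\<^sup>2)" using i2' ineq(1) by (intro mult_mono) (auto simp: abs_square_le_1)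
    have h2: "(2 * real n + 1) / (4 * (real n)\<^sup>2) \<le> 1 / real n" using n1 by (simp add: field_simps power2_eq_square)
    have "?e1 \<le> 1 / real n * (1 * (1 / \<sigma>\<^sup>2))" by (rule mult_mono[OF h2 h1]) auto
    thus ?thesis by (simp add: mult.commute)
  qed
  have E2: "\<bar>c * p * d / (2 * real n) * (1 / q ^ 3)\<bar> \<le> 1 / \<sigma>\<^sup>2 / real n / 2"
  proof -
    have "\<bar>c * p * d\<bar> \<le> 1 * 1 * 1" unfolding abs_mult using ineq by (intro mult_mono) auto
    hence "\<bar>c * p * d\<bar> / (2 * real n) * (1 / \<bar>q\<bar> ^ 3) \<le> 1 / (2 * real n) * (1 / \<sigma>\<^sup>2)"
      using i3 n by (intro mult_mono divide_right_mono) auto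
    thus ?thesis using n by (simp add: abs_mult power_abs mult_ac)
  qed
  have E3: "\<bar>?e3\<bar> \<le> 1 / \<sigma>\<^sup>2 / real n / 4"
  proof -
    have "p\<^sup>2 * d\<^sup>2 \<le> 1 * 1" using ineq by (intro mult_mono) (auto simp: abs_square_le_1)
    moreover have "1 / (4 * (real n)\<^sup>2) \<le> 1 / (4 * real n)" using n1 by (simp add: field_simps power2_eq_square)
    ultimately have "(p\<^sup>2 * d\<^sup>2) * (1 / (4 * (real n)\<^sup>2)) * (1 / q ^ 4) \<le> 1 * (1 / (4 * real n)) * (1 / \<sigma>\<^sup>2)"
      using i4 by (intro mult_mono) auto
    thus ?thesis by (simp add: mult_ac)
  qed
  have tri: "\<bar>x - y + z\<bar> \<le> 2 * m" if "\<bar>x\<bar> \<le> m" "\<bar>y\<bar> \<le> m / 2" "\<bar>z\<bar> \<le> m / 4" for x y z m :: real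
    using that by linarith
  show "\<bar>(((real n + 1) / 2)\<^sup>2 * (dirichlet n s)\<^sup>2 + (dirichlet' n s)\<^sup>2) / real n - real n * (dirichlet n s)\<^sup>2 / 2
        - cos (real n * s) / (4 * (sin (s / 2))\<^sup>2)\<bar> \<le> 2 / \<sigma>\<^sup>2 / real n"
    unfolding E0 using tri[OF E1 E2 E3] by simp
  have "dirichlet n s * dirichlet' n s - sin (real n * s) / (4 * (sin (s / 2))\<^sup>2) = - (p * p * d / (2 * real n) * (1 / q ^ 3))"
  proof -
    have "dirichlet n s * dirichlet' n s = (r * R) * (p * c * i\<^sup>2 / 2) - p * p * d * (R * R) / 2 * i ^ 3"
      unfolding D D' by (simp add: power2_eq_square power3_eq_cube algebra_simps)
    hence "dirichlet n s * dirichlet' n s - sin (real n * s) / (4 * (sin (s / 2))\<^sup>2) = - (p * p * d * L / 2 * i ^ 3)"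
      unfolding rR RR sin_term by simp
    thus ?thesis unfolding i_sq L_def by simp
  qed
  moreover have "\<bar>p * p * d / (2 * real n) * (1 / q ^ 3)\<bar> \<le> 1 / \<sigma>\<^sup>2 / real n"
  proof -
    have "\<bar>p * p * d\<bar> \<le> 1 * 1 * 1" unfolding abs_mult using ineq by (intro mult_mono) auto
    hence "\<bar>p * p * d\<bar> / (2 * real n) \<le> 1 / real n" using n by (intro frac_le) auto
    hence "\<bar>p * p * d\<bar> / (2 * real n) * (1 / \<bar>q\<bar> ^ 3) \<le> 1 / (real n) * (1 / \<sigma>\<^sup>2)"
      using i3 by (rule mult_mono) auto
    thus ?thesis using n by (simp add: abs_mult power_abs mult_ac)
  qed
  ultimately show "\<bar>dirichlet n s * dirichlet' n s - sin (real n * s) / (4 * (sin (s / 2))\<^sup>2)\<bar> \<le> 1 / \<sigma>\<^sup>2 / real n"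
    by simp
qed

locale spectral_density =
  fixes \<psi> :: "real \<Rightarrow> real" and C :: real and T :: "real set"
  assumes meas [measurable]: "\<psi> \<in> borel_measurable borel"
    and nonneg: "\<And>t. 0 \<le> \<psi> t"
    and bdd: "\<And>t. t \<in> {-pi..pi} \<Longrightarrow> \<psi> t \<le> C"
    and mass: "(LINT t|circ. \<psi> t) = 1"
    and finT: "finite T"
    and cont: "\<And>t. t \<in> {-pi<..<pi} - T \<Longrightarrow> isCont \<psi> t"
begin

text \<open>The variance of \<open>f\<^sub>n(x)\<close>, its covariance with \<open>f\<^sub>n'(x)\<close>, and the variance of \<open>f\<^sub>n'(x)\<close>, as integrals
  against the spectral density.\<close>
definition A :: "nat \<Rightarrow> real \<Rightarrow> real" where
  "A n x = (LINT t|circ. (dirichlet n (x - t))\<^sup>2 * \<psi> t)"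
definition E :: "nat \<Rightarrow> real \<Rightarrow> real" where
  "E n x = (LINT t|circ. (dirichlet n (x - t) * dirichlet' n (x - t)) * \<psi> t)"
definition B :: "nat \<Rightarrow> real \<Rightarrow> real" where
  "B n x = (LINT t|circ. (((real n + 1) / 2)\<^sup>2 * (dirichlet n (x - t))\<^sup>2 + (dirichlet' n (x - t))\<^sup>2) * \<psi> t)"

lemma integrable_bounded_psi:
  assumes [measurable]: "g \<in> borel_measurable borel" and "\<And>t. t \<in> {-pi..pi} \<Longrightarrow> \<bar>g t\<bar> \<le> G"
  shows "integrable circ (\<lambda>t. g t * \<psi> t)"
proof (rule integrable_circ_bounded)
  fix t :: real assume t: "t \<in> {-pi..pi}"
  show "\<bar>g t * \<psi> t\<bar> \<le> G * C"
    unfolding abs_mult using assms(2)[OF t] bdd[OF t] nonneg[of t] by (intro mult_mono) auto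
qed measurable

lemma integrable_continuous_psi:
  assumes "continuous_on UNIV g"
  shows "integrable circ (\<lambda>t. g t * \<psi> t)"
proof -
  have "continuous_on {-pi..pi} g" using assms continuous_on_subset by blast
  hence "compact (g ` {-pi..pi})" by (intro compact_continuous_image) auto
  then obtain G where "\<And>y. y \<in> g ` {-pi..pi} \<Longrightarrow> norm y \<le> G"
    using compact_imp_bounded bounded_iff by metis
  thus ?thesis
    using assms by (intro integrable_bounded_psi[where G = G]) (auto intro: borel_measurable_continuous_onI)
qed

lemma C_nonneg: "0 \<le> C"
  using bdd[of 0] nonneg[of 0] by simp

text \<open>The kernel has bounded mass and tends to zero uniformly away from the diagonal, so the integral only
  sees \<open>\<psi>\<close> near \<open>x n\<close>. The point is allowed to vary with \<open>n\<close>: a limit along all sequences of points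
  is the same as a uniform limit. The margin \<open>\<delta>\<close> keeps \<open>x n - t\<close> away from the nonzero multiples
  of \<open>2\<pi>\<close>, where the kernel concentrates as well.\<close>
lemma approximate_identity:
  fixes K :: "nat \<Rightarrow> real \<Rightarrow> real" and x :: "nat \<Rightarrow> real"
  assumes Kc: "\<And>n. continuous_on UNIV (K n)"
    and dom: "\<And>n s. n > 0 \<Longrightarrow> \<bar>K n s\<bar> \<le> 2 * (dirichlet n s)\<^sup>2 + (dirichlet' n s)\<^sup>2 / (real n)\<^sup>2"
    and total: "(\<lambda>n. LINT t|circ. K n (x n - t)) \<longlonglongrightarrow> \<kappa>"
    and \<delta>: "\<And>n. x n \<in> {-pi + \<delta>..pi - \<delta>}"
    and unif: "\<And>\<epsilon>. \<epsilon> > 0 \<Longrightarrow> \<exists>\<eta>>0. \<eta> < \<delta> \<and> (\<forall>n. \<forall>t\<in>{-pi..pi}. \<bar>t - x n\<bar> < \<eta> \<longrightarrow> \<bar>\<psi> t - \<psi> (x n)\<bar> \<le> \<epsilon>)"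
  shows "(\<lambda>n. (LINT t|circ. K n (x n - t) * \<psi> t) - \<kappa> * \<psi> (x n)) \<longlonglongrightarrow> 0"
proof -
  define J where "J n = (LINT t|circ. K n (x n - t) * (\<psi> t - \<psi> (x n)))" for n
  have Kc': "continuous_on UNIV (\<lambda>t. K n (x n - t))" for n
    by (rule continuous_on_compose2[OF Kc]) (auto intro!: continuous_intros)
  have Km [measurable]: "(\<lambda>t. K n (x n - t)) \<in> borel_measurable borel" for n
    by (rule borel_measurable_continuous_onI[OF Kc'])
  have Ki: "integrable circ (\<lambda>t. K n (x n - t))" for n by (rule integrable_circ_continuous[OF Kc'])
  have Kpi: "integrable circ (\<lambda>t. K n (x n - t) * \<psi> t)" for n by (rule integrable_continuous_psi[OF Kc'])
  have \<delta>pi: "\<delta> \<le> pi" using \<delta>[of 0] by auto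
  have \<delta>0: "\<delta> > 0" using unif[of 1] by auto
  have xin: "x n \<in> {-pi..pi}" for n using \<delta>[of n] \<delta>0 by auto
  have Jeq: "(LINT t|circ. K n (x n - t) * \<psi> t) = J n + (LINT t|circ. K n (x n - t)) * \<psi> (x n)" for n
    unfolding J_def right_diff_distrib using Ki Kpi by simp
  \<comment> \<open>\<open>4 \<pi>\<close> from the Fejer kernel and at most \<open>2 \<pi>\<close> from the derivative kernel\<close>
  have Kmass: "(LINT t|circ. \<bar>K n (x n - t)\<bar>) \<le> 6 * pi" if n: "n > 0" for n
  proof -
    let ?N = "(real n + 1) / 2"
    have cont_i: "integrable circ (\<lambda>t. (dirichlet n (x n - t))\<^sup>2)"
      "integrable circ (\<lambda>t. ?N\<^sup>2 * (dirichlet n (x n - t))\<^sup>2 + (dirichlet' n (x n - t))\<^sup>2)"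
      by (intro integrable_circ_continuous continuous_intros)+
    have "(LINT t|circ. \<bar>K n (x n - t)\<bar>) \<le> (LINT t|circ. 2 * (dirichlet n (x n - t))\<^sup>2
        + (?N\<^sup>2 * (dirichlet n (x n - t))\<^sup>2 + (dirichlet' n (x n - t))\<^sup>2) / (real n)\<^sup>2)"
    proof (rule integral_mono)
      fix t
      have "(dirichlet' n (x n - t))\<^sup>2 / (real n)\<^sup>2 \<le> (?N\<^sup>2 * (dirichlet n (x n - t))\<^sup>2 + (dirichlet' n (x n - t))\<^sup>2) / (real n)\<^sup>2"
        by (intro divide_right_mono) auto
      thus "\<bar>K n (x n - t)\<bar> \<le> 2 * (dirichlet n (x n - t))\<^sup>2
        + (?N\<^sup>2 * (dirichlet n (x n - t))\<^sup>2 + (dirichlet' n (x n - t))\<^sup>2) / (real n)\<^sup>2"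
        using dom[OF n, of "x n - t"] by linarith
    qed (use Ki cont_i in auto)
    also have "\<dots> = 2 * (2 * pi) + 2 * pi * ((real n + 1) * (2 * real n + 1) / 6) / (real n)\<^sup>2"
    proof -
      have "(LINT t|circ. 2 * (dirichlet n (x n - t))\<^sup>2
          + (?N\<^sup>2 * (dirichlet n (x n - t))\<^sup>2 + (dirichlet' n (x n - t))\<^sup>2) / (real n)\<^sup>2)
        = 2 * (LINT t|circ. (dirichlet n (x n - t))\<^sup>2)
          + (LINT t|circ. ?N\<^sup>2 * (dirichlet n (x n - t))\<^sup>2 + (dirichlet' n (x n - t))\<^sup>2) / (real n)\<^sup>2"
        using cont_i by simp
      thus ?thesis unfolding dirichlet_masses(1,3)[OF n] .
    qed
    also have "\<dots> \<le> 2 * (2 * pi) + 2 * pi"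
    proof -
      have n1: "real n \<ge> 1" using n by simp
      have "(real n + 1) * (2 * real n + 1) \<le> 6 * (real n)\<^sup>2"
      proof -
        have "real n * 1 \<le> real n * real n" using n1 by (intro mult_left_mono) auto
        moreover have "(real n + 1) * (2 * real n + 1) = 2 * (real n * real n) + 3 * real n + 1" by (simp add: algebra_simps)
        ultimately show ?thesis using n1 unfolding power2_eq_square by linarith
      qed
      hence "((real n + 1) * (2 * real n + 1) / 6) / (real n)\<^sup>2 \<le> 1" using n by (simp add: field_simps)
      hence "2 * pi * (((real n + 1) * (2 * real n + 1) / 6) / (real n)\<^sup>2) \<le> 2 * pi * 1"
        by (intro mult_left_mono) auto
      thus ?thesis by simp
    qed
    finally show ?thesis by simp
  qed
  have "J \<longlonglongrightarrow> 0"
  proof (rule LIMSEQ_I)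
    fix r :: real assume r: "r > 0"
    define \<epsilon> where "\<epsilon> = r / (12 * pi)"
    have \<epsilon>: "\<epsilon> > 0" "\<epsilon> * (6 * pi) = r / 2" using r by (auto simp: \<epsilon>_def)
    obtain \<eta> where \<eta>: "\<eta> > 0" "\<eta> < \<delta>"
      "\<And>n t. t \<in> {-pi..pi} \<Longrightarrow> \<bar>t - x n\<bar> < \<eta> \<Longrightarrow> \<bar>\<psi> t - \<psi> (x n)\<bar> \<le> \<epsilon>"
      using unif[OF \<epsilon>(1)] by blast
    \<comment> \<open>the lower bound of \<open>sin\<^sup>2\<close> outside the \<open>\<eta>\<close>-neighbourhood of the diagonal\<close>
    define \<sigma> where "\<sigma> = (sin (\<eta> / 2))\<^sup>2"
    have "sin (\<eta> / 2) > 0" using \<eta> \<delta>pi by (intro sin_gt_zero) auto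
    hence \<sigma>: "\<sigma> > 0" by (simp add: \<sigma>_def)
    define \<tau> where "\<tau> n = (3 / \<sigma> + 1 / \<sigma>\<^sup>2) / real n" for n :: nat
    have \<tau>0: "\<tau> n \<ge> 0" for n using \<sigma> by (simp add: \<tau>_def)
    have J_le: "\<bar>J n\<bar> \<le> r / 2 + 2 * pi * C * \<tau> n" if n: "n > 0" for n
    proof -
      have "\<bar>J n\<bar> \<le> (LINT t|circ. \<epsilon> * \<bar>K n (x n - t)\<bar> + C * \<tau> n)"
        unfolding J_def real_norm_def[symmetric]
      proof (rule order_trans[OF integral_norm_bound], rule integral_mono_AE)
        show "integrable circ (\<lambda>t. norm (K n (x n - t) * (\<psi> t - \<psi> (x n))))"
          unfolding right_diff_distrib using Ki Kpi by auto
        show "integrable circ (\<lambda>t. \<epsilon> * norm (K n (x n - t)) + C * \<tau> n)"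
          unfolding real_norm_def
          by (intro Bochner_Integration.integrable_add integrable_mult_right integrable_abs Ki
              finite_measure.integrable_const[OF finite_measure_circ])
        show "AE t in circ. norm (K n (x n - t) * (\<psi> t - \<psi> (x n))) \<le> \<epsilon> * norm (K n (x n - t)) + C * \<tau> n"
          using AE_circ
        proof eventually_elim
          case (elim t)
          show ?case
          proof (cases "\<bar>t - x n\<bar> < \<eta>")
            case True
            have "\<bar>K n (x n - t)\<bar> * \<bar>\<psi> t - \<psi> (x n)\<bar> \<le> \<bar>K n (x n - t)\<bar> * \<epsilon>"
              using \<eta>(3)[OF elim True] by (intro mult_left_mono) auto
            moreover have "0 \<le> C * \<tau> n" using C_nonneg \<tau>0[of n] by simp
            ultimately show ?thesis unfolding real_norm_def abs_mult mult.commute[of \<epsilon>] by linarith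
          next
            case False
            have "\<sigma> \<le> (sin ((x n - t) / 2))\<^sup>2"
              unfolding \<sigma>_def using False elim \<delta>[of n] \<eta> by (intro sin_sq_half_ge) auto
            note tail = dirichlet_tail[OF n \<sigma> this]
            have "\<bar>K n (x n - t)\<bar> \<le> 2 * (1 / (real n * \<sigma>)) + (1 / \<sigma> + 1 / \<sigma>\<^sup>2) / real n"
              using dom[OF n, of "x n - t"] tail by linarith
            also have "\<dots> = \<tau> n" using n \<sigma> by (simp add: \<tau>_def field_simps)
            finally have "\<bar>K n (x n - t)\<bar> \<le> \<tau> n" .
            moreover have "\<bar>\<psi> t - \<psi> (x n)\<bar> \<le> C"
              using bdd[OF elim] bdd[OF xin[of n]] nonneg[of t] nonneg[of "x n"] by linarith
            ultimately have "\<bar>K n (x n - t)\<bar> * \<bar>\<psi> t - \<psi> (x n)\<bar> \<le> \<tau> n * C" by (intro mult_mono \<tau>0) auto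
            moreover have "0 \<le> \<epsilon> * \<bar>K n (x n - t)\<bar>" using \<epsilon>(1) by simp
            ultimately show ?thesis unfolding real_norm_def abs_mult mult.commute[of C] by linarith
          qed
        qed
      qed
      also have "\<dots> = \<epsilon> * (LINT t|circ. \<bar>K n (x n - t)\<bar>) + 2 * pi * C * \<tau> n"
      proof -
        have "(LINT t|circ. \<epsilon> * \<bar>K n (x n - t)\<bar> + C * \<tau> n) = (LINT t|circ. \<epsilon> * \<bar>K n (x n - t)\<bar>) + (LINT t|circ. C * \<tau> n)"
          by (intro Bochner_Integration.integral_add integrable_mult_right integrable_abs Ki
              finite_measure.integrable_const[OF finite_measure_circ])
        thus ?thesis by (simp add: measure_circ)
      qed
      also have "\<epsilon> * (LINT t|circ. \<bar>K n (x n - t)\<bar>) \<le> \<epsilon> * (6 * pi)"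
        using Kmass[OF n] \<epsilon>(1) by (intro mult_left_mono) auto
      finally show ?thesis unfolding \<epsilon>(2) by simp
    qed
    have "(\<lambda>n. 2 * pi * C * \<tau> n) \<longlonglongrightarrow> 2 * pi * C * 0"
      unfolding \<tau>_def by (intro tendsto_mult tendsto_const lim_const_over_n)
    hence "eventually (\<lambda>n. 2 * pi * C * \<tau> n < r / 2) sequentially"
      using r by (intro order_tendstoD(2)) auto
    hence "eventually (\<lambda>n. norm (J n - 0) < r) sequentially"
      using eventually_gt_at_top[of 0]
    proof eventually_elim
      case (elim n)
      thus ?case using J_le[of n] by simp
    qed
    thus "\<exists>n0. \<forall>n\<ge>n0. norm (J n - 0) < r" by (simp add: eventually_sequentially)
  qed
  moreover have "(\<lambda>n. ((LINT t|circ. K n (x n - t)) - \<kappa>) * \<psi> (x n)) \<longlonglongrightarrow> 0"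
  proof (rule Lim_null_comparison)
    show "eventually (\<lambda>n. norm (((LINT t|circ. K n (x n - t)) - \<kappa>) * \<psi> (x n)) \<le> \<bar>(LINT t|circ. K n (x n - t)) - \<kappa>\<bar> * C) sequentially"
      using bdd[OF xin] nonneg by (intro always_eventually allI) (simp add: abs_mult mult_left_mono)
    have "(\<lambda>n. \<bar>(LINT t|circ. K n (x n - t)) - \<kappa>\<bar> * C) \<longlonglongrightarrow> \<bar>\<kappa> - \<kappa>\<bar> * C"
      by (intro tendsto_intros total)
    thus "(\<lambda>n. \<bar>(LINT t|circ. K n (x n - t)) - \<kappa>\<bar> * C) \<longlonglongrightarrow> 0" by simp
  qed
  ultimately have "(\<lambda>n. J n + ((LINT t|circ. K n (x n - t)) - \<kappa>) * \<psi> (x n)) \<longlonglongrightarrow> 0 + 0"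
    by (rule tendsto_add)
  thus ?thesis unfolding Jeq by (simp add: algebra_simps)
qed

text \<open>Divided by \<open>n\<^sup>2\<close>, the kernel of \<open>B\<close> has one third of the mass of the kernel of \<open>A\<close> in the limit, and the
  kernel of \<open>E\<close> has mass zero. Both kernels of \<open>A\<close> and \<open>B\<close> concentrate at the same point, so \<open>\<psi>\<close>
  cancels from the quotient.\<close>
lemma speed_limit_positive:
  fixes x :: "nat \<Rightarrow> real"
  assumes \<delta>: "\<And>n. x n \<in> {-pi + \<delta>..pi - \<delta>}"
    and unif: "\<And>\<epsilon>. \<epsilon> > 0 \<Longrightarrow> \<exists>\<eta>>0. \<eta> < \<delta> \<and> (\<forall>n. \<forall>t\<in>{-pi..pi}. \<bar>t - x n\<bar> < \<eta> \<longrightarrow> \<bar>\<psi> t - \<psi> (x n)\<bar> \<le> \<epsilon>)"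
    and m: "m > 0" "\<And>n. m \<le> \<psi> (x n)"
  shows "(\<lambda>n. (A n (x n) * B n (x n) - (E n (x n))\<^sup>2) / ((A n (x n))\<^sup>2 * (real n)\<^sup>2)) \<longlonglongrightarrow> 1 / 3"
    and "eventually (\<lambda>n. pi * m \<le> A n (x n)) sequentially"
proof -
  let ?N = "\<lambda>n::nat. (real n + 1) / 2"
  have Nle: "(?N n)\<^sup>2 / (real n)\<^sup>2 \<le> 1" if "n > 0" for n
  proof -
    have "(?N n / real n)\<^sup>2 \<le> 1\<^sup>2" using that by (intro power_mono) (auto simp: field_simps)
    thus ?thesis by (simp add: power_divide)
  qed
  have ev: "eventually (\<lambda>n::nat. n > 0) sequentially" by (rule eventually_gt_at_top)
  have "(\<lambda>n. (LINT t|circ. (dirichlet n (x n - t))\<^sup>2 * \<psi> t) - 2 * pi * \<psi> (x n)) \<longlonglongrightarrow> 0"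
  proof (rule approximate_identity[OF _ _ _ \<delta> unif])
    show "(\<lambda>n. LINT t|circ. (dirichlet n (x n - t))\<^sup>2) \<longlonglongrightarrow> 2 * pi"
      by (rule tendsto_eventually) (use ev in eventually_elim, simp add: dirichlet_masses)
    show "\<bar>(dirichlet n s)\<^sup>2\<bar> \<le> 2 * (dirichlet n s)\<^sup>2 + (dirichlet' n s)\<^sup>2 / (real n)\<^sup>2" for n s
      by simp
  qed (auto intro!: continuous_intros)
  hence Alim: "(\<lambda>n. A n (x n) - 2 * pi * \<psi> (x n)) \<longlonglongrightarrow> 0" by (simp add: A_def)
  have "eventually (\<lambda>n. - (pi * m) < A n (x n) - 2 * pi * \<psi> (x n)) sequentially"
    using Alim m by (intro order_tendstoD(1)) auto
  thus Alow: "eventually (\<lambda>n. pi * m \<le> A n (x n)) sequentially"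
  proof eventually_elim
    case (elim n)
    have "2 * pi * m \<le> 2 * pi * \<psi> (x n)" using m(2)[of n] by (intro mult_left_mono) auto
    thus ?case using elim by linarith
  qed
  have int1: "integrable circ (\<lambda>t. (dirichlet n (x n - t))\<^sup>2)"
    "integrable circ (\<lambda>t. (?N n)\<^sup>2 * (dirichlet n (x n - t))\<^sup>2 + (dirichlet' n (x n - t))\<^sup>2)"
    "integrable circ (\<lambda>t. dirichlet n (x n - t) * dirichlet' n (x n - t))" for n
    by (intro integrable_circ_continuous continuous_intros)+
  have int2: "integrable circ (\<lambda>t. (dirichlet n (x n - t))\<^sup>2 * \<psi> t)"
    "integrable circ (\<lambda>t. ((?N n)\<^sup>2 * (dirichlet n (x n - t))\<^sup>2 + (dirichlet' n (x n - t))\<^sup>2) * \<psi> t)"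
    "integrable circ (\<lambda>t. (dirichlet n (x n - t) * dirichlet' n (x n - t)) * \<psi> t)" for n
    by (intro integrable_continuous_psi continuous_intros)+
  \<comment> \<open>the kernel of \<open>B / n\<^sup>2 - A / 3\<close>, whose mass tends to zero\<close>
  define K2 where "K2 n s = ((?N n)\<^sup>2 * (dirichlet n s)\<^sup>2 + (dirichlet' n s)\<^sup>2) / (real n)\<^sup>2 - (dirichlet n s)\<^sup>2 / 3" for n s
  have "(\<lambda>n. (LINT t|circ. K2 n (x n - t) * \<psi> t) - 0 * \<psi> (x n)) \<longlonglongrightarrow> 0"
  proof (rule approximate_identity[OF _ _ _ \<delta> unif])
    show "continuous_on UNIV (K2 n)" for n
    proof (cases "n = 0")
      case True
      thus ?thesis unfolding K2_def by (auto intro!: continuous_intros)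
    next
      case False
      thus ?thesis unfolding K2_def by (intro continuous_intros) auto
    qed
    show "\<bar>K2 n s\<bar> \<le> 2 * (dirichlet n s)\<^sup>2 + (dirichlet' n s)\<^sup>2 / (real n)\<^sup>2" if "n > 0" for n s
    proof -
      have "(?N n)\<^sup>2 / (real n)\<^sup>2 * (dirichlet n s)\<^sup>2 \<le> 1 * (dirichlet n s)\<^sup>2"
        using Nle[OF that] by (intro mult_right_mono) auto
      moreover have "K2 n s = (?N n)\<^sup>2 / (real n)\<^sup>2 * (dirichlet n s)\<^sup>2 + (dirichlet' n s)\<^sup>2 / (real n)\<^sup>2 - (dirichlet n s)\<^sup>2 / 3"
        by (simp add: K2_def add_divide_distrib)
      moreover have "0 \<le> (?N n)\<^sup>2 / (real n)\<^sup>2 * (dirichlet n s)\<^sup>2" "0 \<le> (dirichlet' n s)\<^sup>2 / (real n)\<^sup>2" "0 \<le> (dirichlet n s)\<^sup>2" by auto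
      ultimately show ?thesis unfolding abs_le_iff by linarith
    qed
    have "(\<lambda>n::nat. 2 * pi * ((1 + 1 / real n) * (2 + 1 / real n) / 6) - 2 * pi / 3) \<longlonglongrightarrow> 2 * pi * ((1 + 0) * (2 + 0) / 6) - 2 * pi / 3"
      by (intro tendsto_intros lim_const_over_n) auto
    hence "(\<lambda>n::nat. 2 * pi * ((1 + 1 / real n) * (2 + 1 / real n) / 6) - 2 * pi / 3) \<longlonglongrightarrow> 0" by simp
    moreover have "eventually (\<lambda>n. 2 * pi * ((1 + 1 / real n) * (2 + 1 / real n) / 6) - 2 * pi / 3 = (LINT t|circ. K2 n (x n - t))) sequentially"
      using ev
    proof eventually_elim
      case (elim n)
      have "(LINT t|circ. K2 n (x n - t)) = 2 * pi * ((real n + 1) * (2 * real n + 1) / 6) / (real n)\<^sup>2 - 2 * pi / 3"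
      proof -
        have "(LINT t|circ. K2 n (x n - t)) = (LINT t|circ. (?N n)\<^sup>2 * (dirichlet n (x n - t))\<^sup>2 + (dirichlet' n (x n - t))\<^sup>2) / (real n)\<^sup>2
            - (LINT t|circ. (dirichlet n (x n - t))\<^sup>2) / 3"
          unfolding K2_def using int1 by simp
        thus ?thesis unfolding dirichlet_masses(1,3)[OF elim] .
      qed
      thus ?case using elim by (simp add: field_simps power2_eq_square)
    qed
    ultimately show "(\<lambda>n. LINT t|circ. K2 n (x n - t)) \<longlonglongrightarrow> 0"
      by (rule Lim_transform_eventually)
  qed
  moreover have "(LINT t|circ. K2 n (x n - t) * \<psi> t) = B n (x n) / (real n)\<^sup>2 - 1 / 3 * A n (x n)" for n
  proof -
    have "K2 n (x n - t) * \<psi> t = (((?N n)\<^sup>2 * (dirichlet n (x n - t))\<^sup>2 + (dirichlet' n (x n - t))\<^sup>2) * \<psi> t) / (real n)\<^sup>2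
       - ((dirichlet n (x n - t))\<^sup>2 * \<psi> t) / 3" for t
      by (simp add: K2_def left_diff_distrib)
    thus ?thesis unfolding A_def B_def using int2 by simp
  qed
  ultimately have b: "(\<lambda>n. B n (x n) / (real n)\<^sup>2 - 1 / 3 * A n (x n)) \<longlonglongrightarrow> 0" by simp
  define K3 where "K3 n s = dirichlet n s * dirichlet' n s / real n" for n s
  have "(\<lambda>n. (LINT t|circ. K3 n (x n - t) * \<psi> t) - 0 * \<psi> (x n)) \<longlonglongrightarrow> 0"
  proof (rule approximate_identity[OF _ _ _ \<delta> unif])
    show "continuous_on UNIV (K3 n)" for n
    proof (cases "n = 0")
      case True
      thus ?thesis unfolding K3_def by (auto intro!: continuous_intros)
    next
      case False
      thus ?thesis unfolding K3_def by (intro continuous_intros) auto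
    qed
    show "\<bar>K3 n s\<bar> \<le> 2 * (dirichlet n s)\<^sup>2 + (dirichlet' n s)\<^sup>2 / (real n)\<^sup>2" for n s
    proof -
      have "\<bar>u * v\<bar> \<le> 2 * u\<^sup>2 + v\<^sup>2" for u v :: real
      proof -
        have "2 * (u * v) \<le> u\<^sup>2 + v\<^sup>2" "- (2 * (u * v)) \<le> u\<^sup>2 + v\<^sup>2"
          using sum_squares_bound[of u v] sum_squares_bound[of u "- v"] by simp_all
        thus ?thesis using zero_le_power2[of u] zero_le_power2[of v] by linarith
      qed
      from this[of "dirichlet n s" "dirichlet' n s / real n"] show ?thesis by (simp add: K3_def power_divide)
    qed
    show "(\<lambda>n. LINT t|circ. K3 n (x n - t)) \<longlonglongrightarrow> 0"
    proof (rule tendsto_eventually)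
      show "eventually (\<lambda>n. (LINT t|circ. K3 n (x n - t)) = 0) sequentially"
        using ev by eventually_elim (simp add: K3_def dirichlet_masses)
    qed
  qed
  hence e: "(\<lambda>n. E n (x n) / real n) \<longlonglongrightarrow> 0"
    by (simp add: K3_def E_def)
  have "(\<lambda>n. (A n (x n) * (B n (x n) / (real n)\<^sup>2) - (E n (x n) / real n)\<^sup>2) / (A n (x n))\<^sup>2) \<longlonglongrightarrow> 1 / 3"
    using m by (intro ratio_tendsto[OF b e _ Alow]) auto
  moreover have "(A n (x n) * (B n (x n) / (real n)\<^sup>2) - (E n (x n) / real n)\<^sup>2) / (A n (x n))\<^sup>2
    = (A n (x n) * B n (x n) - (E n (x n))\<^sup>2) / ((A n (x n))\<^sup>2 * (real n)\<^sup>2)" for n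
    by (simp add: power_divide diff_divide_distrib mult.commute)
  ultimately show "(\<lambda>n. (A n (x n) * B n (x n) - (E n (x n))\<^sup>2) / ((A n (x n))\<^sup>2 * (real n)\<^sup>2)) \<longlonglongrightarrow> 1 / 3" by simp
qed

end

section \<open>The speed where the spectral density vanishes\<close>

lemma sin_sq_diff_le: "\<bar>(sin a)\<^sup>2 - (sin b)\<^sup>2\<bar> \<le> \<bar>a - b\<bar>" for a b :: real
proof -
  have "(sin a)\<^sup>2 - (sin b)\<^sup>2 = sin (a + b) * sin (a - b)"
  proof -
    have "sin (a + b) * sin (a - b) = (sin a)\<^sup>2 * (cos b)\<^sup>2 - (cos a)\<^sup>2 * (sin b)\<^sup>2"
      by (simp add: sin_add sin_diff power2_eq_square algebra_simps)
    thus ?thesis unfolding cos_squared_eq by (simp add: algebra_simps)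
  qed
  hence "\<bar>(sin a)\<^sup>2 - (sin b)\<^sup>2\<bar> = \<bar>sin (a + b)\<bar> * \<bar>sin (a - b)\<bar>" by (simp add: abs_mult)
  also have "\<dots> \<le> 1 * \<bar>a - b\<bar>" using abs_sin_x_le_abs_x by (intro mult_mono) auto
  finally show ?thesis by simp
qed

text \<open>Linearity in the exact shape in which it is used, as the simplifier normalises large integrands
  instead of splitting them.\<close>
lemma integral_divide_add_mult:
  fixes f g :: "'a \<Rightarrow> real"
  assumes "integrable M f" "integrable M g"
  shows "(LINT t|M. f t / c + d * g t) = (LINT t|M. f t) / c + d * (LINT t|M. g t)"
  using assms by simp

lemma
  fixes a b c :: "'a \<Rightarrow> real"
  assumes "integrable M a" "integrable M b" "integrable M c"
  shows integrable_divide_mult_diff: "integrable M (\<lambda>t. a t / k - k * b t / 2 - c t / 4)"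
    and integral_divide_mult_diff: "(LINT t|M. a t / k - k * b t / 2 - c t / 4)
      = (LINT t|M. a t) / k - k * (LINT t|M. b t) / 2 - (LINT t|M. c t) / 4"
  using assms by simp_all

lemma
  fixes a c :: "'a \<Rightarrow> real"
  assumes "integrable M a" "integrable M c"
  shows integrable_quarter_diff: "integrable M (\<lambda>t. a t - c t / 4)"
    and integral_quarter_diff: "(LINT t|M. a t - c t / 4) = (LINT t|M. a t) - (LINT t|M. c t) / 4"
  using assms by simp_all

lemma inverse_max_lipschitz:
  fixes y z \<sigma> :: real
  assumes "0 < \<sigma>"
  shows "\<bar>1 / max \<sigma> y - 1 / max \<sigma> z\<bar> \<le> \<bar>y - z\<bar> / \<sigma>\<^sup>2"
proof -
  have pos: "max \<sigma> y > 0" "max \<sigma> z > 0" using assms by auto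
  have "1 / max \<sigma> y - 1 / max \<sigma> z = (max \<sigma> z - max \<sigma> y) / (max \<sigma> y * max \<sigma> z)"
    using pos by (simp add: field_simps)
  hence "\<bar>1 / max \<sigma> y - 1 / max \<sigma> z\<bar> = \<bar>max \<sigma> z - max \<sigma> y\<bar> / (max \<sigma> y * max \<sigma> z)"
    using pos by (simp add: abs_divide abs_mult)
  also have "\<dots> \<le> \<bar>y - z\<bar> / (\<sigma> * \<sigma>)"
    using assms by (intro frac_le mult_mono) auto
  finally show ?thesis by (simp add: power2_eq_square)
qed

context spectral_density
begin

text \<open>The density cut off outside one period, so that it can be translated along the line.\<close>
definition w :: "real \<Rightarrow> real" where "w t = \<psi> t * indicator {-pi..pi} t"

lemma w_meas [measurable]: "w \<in> borel_measurable borel"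
  unfolding w_def[abs_def] by measurable

lemma w_bounds: "0 \<le> w t" "w t \<le> C"
  using nonneg[of t] bdd[of t] C_nonneg by (auto simp: w_def indicator_def)

lemma integral_w: "g \<in> borel_measurable borel \<Longrightarrow> (LINT t|circ. g t * \<psi> t) = (LINT t|lborel. g t * w t)"
  by (subst integral_circ) (auto simp: w_def mult.assoc)

lemma integrable_w: "integrable lborel w"
proof (rule Bochner_Integration.integrable_bound)
  show "integrable lborel (\<lambda>t::real. C * indicator {-pi..pi} t)" by simp
  show "AE t in lborel. norm (w t) \<le> norm (C * indicator {-pi..pi} t)"
  proof (rule AE_I2)
    fix t
    show "norm (w t) \<le> norm (C * indicator {-pi..pi} t)"
    proof (cases "t \<in> {-pi..pi}")
      case True
      thus ?thesis using w_bounds[of t] by simp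
    qed (auto simp: w_def)
  qed
qed measurable

lemma mass_w: "(LINT t|lborel. w t) = 1"
  using integral_w[of "\<lambda>_. 1"] mass by simp

lemma isCont_w:
  assumes "t \<notin> T \<union> {-pi, pi}"
  shows "isCont w t"
proof -
  consider "t \<in> {-pi<..<pi}" | "t < - pi" | "t > pi" using assms by fastforce
  thus ?thesis
  proof cases
    case 1
    have "eventually (\<lambda>y. y \<in> {-pi<..<pi}) (nhds t)" using 1 by (intro eventually_nhds_in_open) auto
    hence "eventually (\<lambda>y. w y = \<psi> y) (nhds t)" by eventually_elim (simp add: w_def)
    thus ?thesis using cont[of t] 1 assms by (subst isCont_cong) auto
  next
    case 2
    have "eventually (\<lambda>y. y \<in> {..<-pi}) (nhds t)" using 2 by (intro eventually_nhds_in_open) auto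
    hence "eventually (\<lambda>y. w y = 0) (nhds t)" by eventually_elim (simp add: w_def)
    thus ?thesis by (subst isCont_cong[where g = "\<lambda>_. 0"]) auto
  next
    case 3
    have "eventually (\<lambda>y. y \<in> {pi<..}) (nhds t)" using 3 by (intro eventually_nhds_in_open) auto
    hence "eventually (\<lambda>y. w y = 0) (nhds t)" by eventually_elim (simp add: w_def)
    thus ?thesis by (subst isCont_cong[where g = "\<lambda>_. 0"]) auto
  qed
qed

text \<open>Almost everywhere continuity suffices, by dominated convergence; for \<open>n = 0\<close> the translation is
  trivial because \<open>\<pi> / 0 = 0\<close>.\<close>
lemma translation_continuous: "(\<lambda>n. LINT t|lborel. \<bar>w t - w (t + pi / real n)\<bar>) \<longlonglongrightarrow> 0"
proof -
  have "(\<lambda>n. LINT t|lborel. \<bar>w t - w (t + pi / real n)\<bar>) \<longlonglongrightarrow> (LINT t|(lborel :: real measure). (0::real))"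
  proof (rule integral_dominated_convergence[where w = "\<lambda>t. C * indicator {-2*pi..pi} t"])
    show "integrable lborel (\<lambda>t::real. C * indicator {-2*pi..pi} t)" by simp
    show "AE t in lborel. (\<lambda>n. \<bar>w t - w (t + pi / real n)\<bar>) \<longlonglongrightarrow> 0"
    proof -
      have "AE t in lborel. t \<notin> T \<union> {-pi, pi}"
        using finT by (intro AE_not_in countable_imp_null_set_lborel) (auto intro: countable_finite)
      thus ?thesis
      proof eventually_elim
        case (elim t)
        have "(\<lambda>n. t + pi / real n) \<longlonglongrightarrow> t + 0" by (intro tendsto_intros lim_const_over_n)
        hence "(\<lambda>n. w (t + pi / real n)) \<longlonglongrightarrow> w t"
          using isCont_w[OF elim] by (intro isCont_tendsto_compose[of t w]) auto
        hence "(\<lambda>n. \<bar>w t - w (t + pi / real n)\<bar>) \<longlonglongrightarrow> \<bar>w t - w t\<bar>" by (intro tendsto_intros)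
        thus ?case by simp
      qed
    qed
    show "AE t in lborel. norm \<bar>w t - w (t + pi / real n)\<bar> \<le> C * indicator {-2*pi..pi} t" for n
    proof (rule AE_I2)
      fix t
      have e: "0 \<le> pi / real n" "pi / real n \<le> pi" by (cases "n = 0"; simp add: field_simps)+
      have "w t = 0 \<and> w (t + e) = 0" if "t \<notin> {-2*pi..pi}" "0 \<le> e" "e \<le> pi" for e
        using that by (auto simp: w_def indicator_def)
      from this[OF _ e] have "w t = 0 \<and> w (t + pi / real n) = 0" if "t \<notin> {-2*pi..pi}" using that by blast
      moreover have "\<bar>w t - w (t + pi / real n)\<bar> \<le> C"
        using w_bounds[of t] w_bounds[of "t + pi / real n"] by (simp add: abs_le_iff)
      ultimately show "norm \<bar>w t - w (t + pi / real n)\<bar> \<le> C * indicator {-2*pi..pi} t"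
        by (auto simp: indicator_def)
    qed
  qed measurable
  thus ?thesis by simp
qed

text \<open>The classical proof: a shift by half a period \<open>\<pi> / n\<close> flips the sign of the oscillating factor, so
  twice the integral is the integral of a difference of neighbouring values, which tends to zero by
  \<open>translation_continuous\<close>. The weight \<open>1 / max \<sigma> sin\<^sup>2\<close> is a Lipschitz function which agrees with the
  singular weight \<open>1 / sin\<^sup>2\<close> away from the diagonal, and its Lipschitz constant is uniform in the
  point \<open>x n\<close>.\<close>
lemma riemann_lebesgue:
  fixes x :: "nat \<Rightarrow> real"
  assumes \<sigma>: "0 < \<sigma>" and [measurable]: "g \<in> borel_measurable borel"
    and anti: "\<And>y. g (y - pi) = - g y" and g1: "\<And>y. \<bar>g y\<bar> \<le> 1"
  shows "(\<lambda>n. LINT t|circ. g (real n * (x n - t)) / max \<sigma> ((sin ((x n - t) / 2))\<^sup>2) * \<psi> t) \<longlonglongrightarrow> 0"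
proof (rule Lim_null_comparison)
  define W where "W s = max \<sigma> ((sin (s / 2))\<^sup>2)" for s :: real
  have W: "W s > 0" "1 / W s \<le> 1 / \<sigma>" for s using \<sigma> by (auto simp: W_def intro!: divide_left_mono)
  have [measurable]: "W \<in> borel_measurable borel" unfolding W_def[abs_def] by measurable
  have "(\<lambda>n. (LINT t|lborel. \<bar>w t - w (t + pi / real n)\<bar>) / \<sigma> + pi / real n / \<sigma>\<^sup>2) \<longlonglongrightarrow> 0 / \<sigma> + 0 / \<sigma>\<^sup>2"
    using \<sigma> by (intro tendsto_intros translation_continuous lim_const_over_n) auto
  thus "(\<lambda>n. (LINT t|lborel. \<bar>w t - w (t + pi / real n)\<bar>) / \<sigma> + pi / real n / \<sigma>\<^sup>2) \<longlonglongrightarrow> 0" by simp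
  show "eventually (\<lambda>n. norm (LINT t|circ. g (real n * (x n - t)) / max \<sigma> ((sin ((x n - t) / 2))\<^sup>2) * \<psi> t)
    \<le> (LINT t|lborel. \<bar>w t - w (t + pi / real n)\<bar>) / \<sigma> + pi / real n / \<sigma>\<^sup>2) sequentially"
    using eventually_gt_at_top[of 0]
  proof eventually_elim
    case (elim n)
    define \<eta> where "\<eta> = pi / real n"
    have \<eta>: "\<eta> \<ge> 0" "real n * \<eta> = pi" using elim by (auto simp: \<eta>_def)
    define h where "h t = g (real n * (x n - t)) / W (x n - t) * w t" for t
    have [measurable]: "h \<in> borel_measurable borel" unfolding h_def[abs_def] by measurable
    have ws: "integrable lborel (\<lambda>t. w (\<eta> + 1 * t))"
      using integrable_w by (rule lborel_integrable_real_affine) simp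
    have ws': "(LINT t|lborel. w (\<eta> + 1 * t)) = 1"
      using lborel_integral_real_affine[of 1 w \<eta>] mass_w by simp
    have hi: "integrable lborel h"
    proof (rule Bochner_Integration.integrable_bound)
      show "integrable lborel (\<lambda>t. w t / \<sigma>)" using integrable_w by simp
      show "AE t in lborel. norm (h t) \<le> norm (w t / \<sigma>)"
      proof (rule AE_I2)
        fix t
        have "\<bar>g (real n * (x n - t))\<bar> * (1 / W (x n - t)) \<le> 1 * (1 / \<sigma>)"
          using g1 W \<sigma> by (intro mult_mono) (auto intro: less_imp_le)
        hence "\<bar>g (real n * (x n - t))\<bar> * (1 / W (x n - t)) * w t \<le> 1 * (1 / \<sigma>) * w t"
          using w_bounds by (intro mult_right_mono) auto
        thus "norm (h t) \<le> norm (w t / \<sigma>)"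
          using W(1)[of "x n - t"] w_bounds(1)[of t] \<sigma> by (simp add: h_def abs_mult)
      qed
    qed measurable
    have his: "integrable lborel (\<lambda>t. h (\<eta> + 1 * t))"
      using hi by (rule lborel_integrable_real_affine) simp
    have sh: "(LINT t|lborel. h t) = (LINT t|lborel. h (\<eta> + 1 * t))"
      using lborel_integral_real_affine[of 1 h \<eta>] by simp
    \<comment> \<open>the half-period shift flips the sign of the oscillating factor\<close>
    have hs: "h (\<eta> + 1 * t) = - (g (real n * (x n - t)) / W (x n - t - \<eta>) * w (\<eta> + 1 * t))" for t
    proof -
      have "real n * (x n - (\<eta> + 1 * t)) = real n * (x n - t) - pi" using \<eta> by (simp add: algebra_simps)
      hence e1: "g (real n * (x n - (\<eta> + 1 * t))) = - g (real n * (x n - t))" using anti by simp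
      have e2: "x n - (\<eta> + 1 * t) = x n - t - \<eta>" by simp
      show ?thesis unfolding h_def e1 unfolding e2 by simp
    qed
    \<comment> \<open>the first term is the variation of the density, the second that of the weight\<close>
    have pw: "\<bar>h t + h (\<eta> + 1 * t)\<bar> \<le> \<bar>w t - w (t + \<eta>)\<bar> / \<sigma> + \<eta> / \<sigma>\<^sup>2 * w (\<eta> + 1 * t)" for t
    proof -
      let ?u = "1 / W (x n - t)" and ?v = "1 / W (x n - t - \<eta>)"
      have "h t + h (\<eta> + 1 * t) = g (real n * (x n - t)) * (?u * (w t - w (t + \<eta>)) + (?u - ?v) * w (t + \<eta>))"
        unfolding hs by (simp add: h_def algebra_simps)
      hence "\<bar>h t + h (\<eta> + 1 * t)\<bar> \<le> 1 * \<bar>?u * (w t - w (t + \<eta>)) + (?u - ?v) * w (t + \<eta>)\<bar>"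
        using g1 by (simp only: abs_mult) (intro mult_right_mono, auto)
      also have "\<dots> \<le> ?u * \<bar>w t - w (t + \<eta>)\<bar> + \<bar>?u - ?v\<bar> * w (t + \<eta>)"
        using abs_triangle_ineq[of "?u * (w t - w (t + \<eta>))" "(?u - ?v) * w (t + \<eta>)"] W(1)[of "x n - t"] w_bounds(1)[of "t + \<eta>"]
        by (simp add: abs_mult)
      also have "\<dots> \<le> 1 / \<sigma> * \<bar>w t - w (t + \<eta>)\<bar> + \<eta> / \<sigma>\<^sup>2 * w (t + \<eta>)"
      proof (intro add_mono mult_right_mono W)
        have "\<bar>?u - ?v\<bar> \<le> \<bar>(sin ((x n - t) / 2))\<^sup>2 - (sin ((x n - t - \<eta>) / 2))\<^sup>2\<bar> / \<sigma>\<^sup>2"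
          unfolding W_def by (rule inverse_max_lipschitz[OF \<sigma>])
        also have "\<dots> \<le> \<bar>(x n - t) / 2 - (x n - t - \<eta>) / 2\<bar> / \<sigma>\<^sup>2"
          by (intro divide_right_mono sin_sq_diff_le) auto
        also have "\<dots> \<le> \<eta> / \<sigma>\<^sup>2" using \<eta>(1) by (intro divide_right_mono) (auto simp: diff_divide_distrib)
        finally show "\<bar>?u - ?v\<bar> \<le> \<eta> / \<sigma>\<^sup>2" .
      qed (use w_bounds in auto)
      finally show ?thesis by (simp add: add.commute)
    qed
    have iw: "integrable lborel (\<lambda>t. \<bar>w t - w (t + \<eta>)\<bar>)"
      using integrable_w ws by (simp add: add.commute)
    have "(LINT t|circ. g (real n * (x n - t)) / max \<sigma> ((sin ((x n - t) / 2))\<^sup>2) * \<psi> t) = (LINT t|lborel. h t)"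
      unfolding h_def W_def[symmetric] by (subst integral_w) auto
    also have "\<dots> = (LINT t|lborel. h t + h (\<eta> + 1 * t)) / 2"
      using hi his sh by simp
    finally have val: "(LINT t|circ. g (real n * (x n - t)) / max \<sigma> ((sin ((x n - t) / 2))\<^sup>2) * \<psi> t)
      = (LINT t|lborel. h t + h (\<eta> + 1 * t)) / 2" .
    have "norm ((LINT t|lborel. h t + h (\<eta> + 1 * t)) / 2) \<le> (LINT t|lborel. \<bar>w t - w (t + \<eta>)\<bar> / \<sigma> + \<eta> / \<sigma>\<^sup>2 * w (\<eta> + 1 * t)) / 2"
    proof -
      have "norm (LINT t|lborel. h t + h (\<eta> + 1 * t)) \<le> (LINT t|lborel. norm (h t + h (\<eta> + 1 * t)))"
        by (rule integral_norm_bound)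
      also have "\<dots> \<le> (LINT t|lborel. \<bar>w t - w (t + \<eta>)\<bar> / \<sigma> + \<eta> / \<sigma>\<^sup>2 * w (\<eta> + 1 * t))"
        using pw hi his iw ws by (intro integral_mono) auto
      finally show ?thesis by simp
    qed
    also have "\<dots> = ((LINT t|lborel. \<bar>w t - w (t + \<eta>)\<bar>) / \<sigma> + \<eta> / \<sigma>\<^sup>2) / 2"
    proof -
      have "(LINT t|lborel. \<bar>w t - w (t + \<eta>)\<bar> / \<sigma> + \<eta> / \<sigma>\<^sup>2 * w (\<eta> + 1 * t))
        = (LINT t|lborel. \<bar>w t - w (t + \<eta>)\<bar>) / \<sigma> + \<eta> / \<sigma>\<^sup>2 * (LINT t|lborel. w (\<eta> + 1 * t))"
        by (rule integral_divide_add_mult[OF iw ws])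
      thus ?thesis unfolding ws' by (simp only: mult_1_right)
    qed
    also have "\<dots> \<le> (LINT t|lborel. \<bar>w t - w (t + \<eta>)\<bar>) / \<sigma> + \<eta> / \<sigma>\<^sup>2"
    proof -
      have "0 \<le> (LINT t|lborel. \<bar>w t - w (t + \<eta>)\<bar>) / \<sigma>" "0 \<le> \<eta> / \<sigma>\<^sup>2" using \<sigma> \<eta> by auto
      moreover have "(y + z) / 2 \<le> y + z" if "0 \<le> y" "0 \<le> z" for y z :: real using that by simp
      ultimately show ?thesis by blast
    qed
    finally show ?case unfolding val \<eta>_def .
  qed
qed

text \<open>Now only the kernels away from the diagonal matter, as \<open>\<psi>\<close> vanishes near \<open>x n\<close>. By
  \<open>dirichlet_off_diagonal\<close> and \<open>riemann_lebesgue\<close>, \<open>n A\<close> is of order one, \<open>B / n\<close> is asymptotically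
  \<open>n A / 2\<close>, and \<open>E\<close> tends to zero.\<close>
lemma speed_limit_zero:
  fixes x :: "nat \<Rightarrow> real"
  assumes \<delta>: "0 < \<delta>" "\<And>n. x n \<in> {-pi + \<delta>..pi - \<delta>}"
    and van: "\<And>n t. t \<in> {-pi..pi} \<Longrightarrow> \<bar>t - x n\<bar> < \<delta> \<Longrightarrow> \<psi> t = 0"
  shows "(\<lambda>n. (A n (x n) * B n (x n) - (E n (x n))\<^sup>2) / ((A n (x n))\<^sup>2 * (real n)\<^sup>2)) \<longlonglongrightarrow> 1 / 2"
    and "eventually (\<lambda>n. 1 / 4 \<le> real n * A n (x n)) sequentially"
proof -
  define \<sigma> where "\<sigma> = (sin (\<delta> / 2))\<^sup>2"
  have "\<delta> \<le> pi" using \<delta>(2)[of 0] by auto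
  hence "sin (\<delta> / 2) > 0" using \<delta>(1) by (intro sin_gt_zero) auto
  hence \<sigma>: "\<sigma> > 0" by (simp add: \<sigma>_def)
  have \<sigma>1: "\<sigma> \<le> 1" using abs_sin_le_one[of "\<delta> / 2"] by (simp add: \<sigma>_def abs_square_le_1)
  define W where "W s = max \<sigma> ((sin (s / 2))\<^sup>2)" for s :: real
  have W: "W s > 0" "W s \<le> 1" "1 / W s \<le> 1 / \<sigma>" for s
    using \<sigma> \<sigma>1 abs_sin_le_one[of "s / 2"] by (auto simp: W_def abs_square_le_1 intro!: divide_left_mono)
  have [measurable]: "W \<in> borel_measurable borel" unfolding W_def[abs_def] by measurable
  have supp: "\<sigma> \<le> (sin ((x n - t) / 2))\<^sup>2" if "t \<in> {-pi..pi}" "\<psi> t \<noteq> 0" for n t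
  proof -
    have "\<delta> \<le> \<bar>x n - t\<bar>"
      using van[of t n] that by (cases "\<bar>t - x n\<bar> < \<delta>") (auto simp: abs_minus_commute)
    thus ?thesis unfolding \<sigma>_def using that(1) \<delta>(1) \<delta>(2)[of n] by (intro sin_sq_half_ge) auto
  qed
  have WS: "W (x n - t) = (sin ((x n - t) / 2))\<^sup>2" if "t \<in> {-pi..pi}" "\<psi> t \<noteq> 0" for n t
    using supp[OF that, of n] by (simp add: W_def)
  \<comment> \<open>the oscillating integrals \<open>Rc\<close> and \<open>Rs\<close> vanish in the limit; \<open>H\<close> does not oscillate\<close>
  define Rc where "Rc n = (LINT t|circ. cos (real n * (x n - t)) / W (x n - t) * \<psi> t)" for n
  define Rs where "Rs n = (LINT t|circ. sin (real n * (x n - t)) / W (x n - t) * \<psi> t)" for n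
  define H where "H n = (LINT t|circ. 1 / W (x n - t) * \<psi> t)" for n
  have Rc0: "Rc \<longlonglongrightarrow> 0" unfolding Rc_def[abs_def] W_def
    by (rule riemann_lebesgue[OF \<sigma>]) (auto simp: cos_diff)
  have Rs0: "Rs \<longlonglongrightarrow> 0" unfolding Rs_def[abs_def] W_def
    by (rule riemann_lebesgue[OF \<sigma>]) (auto simp: sin_diff)
  have gi: "integrable circ (\<lambda>t. g (real n * (x n - t)) / W (x n - t) * \<psi> t)"
    if [measurable]: "g \<in> borel_measurable borel" and g1: "\<And>y. \<bar>g y\<bar> \<le> 1" for g :: "real \<Rightarrow> real" and n
  proof (rule integrable_bounded_psi)
    fix t
    have "\<bar>g (real n * (x n - t))\<bar> * (1 / W (x n - t)) \<le> 1 * (1 / \<sigma>)"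
      using g1 W by (intro mult_mono) (auto intro: less_imp_le)
    thus "\<bar>g (real n * (x n - t)) / W (x n - t)\<bar> \<le> 1 / \<sigma>" using W(1)[of "x n - t"] by simp
  qed measurable
  have ci: "integrable circ (\<lambda>t. cos (real n * (x n - t)) / W (x n - t) * \<psi> t)"
    and si: "integrable circ (\<lambda>t. sin (real n * (x n - t)) / W (x n - t) * \<psi> t)"
    and oi: "integrable circ (\<lambda>t. 1 / W (x n - t) * \<psi> t)" for n
    using gi[of cos n] gi[of sin n] gi[of "\<lambda>_. 1" n] by auto
  have psii: "integrable circ \<psi>" using integrable_bounded_psi[of "\<lambda>_. 1" 1] by simp
  have H1: "1 \<le> H n" for n
  proof -
    have "(LINT t|circ. \<psi> t) \<le> H n"
      unfolding H_def
    proof (rule integral_mono[OF psii oi])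
      fix t
      have "1 * \<psi> t \<le> 1 / W (x n - t) * \<psi> t"
        using W[of "x n - t"] nonneg[of t] by (intro mult_right_mono) (auto simp: field_simps)
      thus "\<psi> t \<le> 1 / W (x n - t) * \<psi> t" by simp
    qed
    thus ?thesis by (simp add: mass)
  qed
  let ?N = "\<lambda>n::nat. (real n + 1) / 2"
  have int2: "integrable circ (\<lambda>t. (dirichlet n (x n - t))\<^sup>2 * \<psi> t)"
    "integrable circ (\<lambda>t. ((?N n)\<^sup>2 * (dirichlet n (x n - t))\<^sup>2 + (dirichlet' n (x n - t))\<^sup>2) * \<psi> t)"
    "integrable circ (\<lambda>t. (dirichlet n (x n - t) * dirichlet' n (x n - t)) * \<psi> t)" for n
    by (intro integrable_continuous_psi continuous_intros)+
  have nA: "real n * A n (x n) = (H n - Rc n) / 2" if n: "n > 0" for n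
  proof -
    have "real n * A n (x n) = (LINT t|circ. real n * ((dirichlet n (x n - t))\<^sup>2 * \<psi> t))"
      unfolding A_def by simp
    also have "\<dots> = (LINT t|circ. (1 / W (x n - t) * \<psi> t - cos (real n * (x n - t)) / W (x n - t) * \<psi> t) / 2)"
    proof (rule integral_cong_AE)
      show "AE t in circ. real n * ((dirichlet n (x n - t))\<^sup>2 * \<psi> t)
        = (1 / W (x n - t) * \<psi> t - cos (real n * (x n - t)) / W (x n - t) * \<psi> t) / 2"
        using AE_circ
      proof eventually_elim
        case (elim t)
        show ?case
        proof (cases "\<psi> t = 0")
          case False
          have "real n * (dirichlet n (x n - t))\<^sup>2 = (1 - cos (real n * (x n - t))) / (2 * W (x n - t))"
            using dirichlet_off_diagonal(1)[OF n \<sigma> supp[OF elim False]] WS[OF elim False] by simp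
          hence "real n * (dirichlet n (x n - t))\<^sup>2 * \<psi> t = (1 - cos (real n * (x n - t))) / (2 * W (x n - t)) * \<psi> t" by simp
          thus ?thesis by (simp add: diff_divide_distrib left_diff_distrib mult.assoc)
        qed simp
      qed
    qed measurable
    also have "\<dots> = (H n - Rc n) / 2" unfolding H_def Rc_def using oi ci by simp
    finally show ?thesis .
  qed
  have bB: "\<bar>B n (x n) / real n - 1 / 2 * (real n * A n (x n)) - Rc n / 4\<bar> \<le> 2 / \<sigma>\<^sup>2 / real n" if n: "n > 0" for n
  proof -
    let ?F = "\<lambda>t. ((?N n)\<^sup>2 * (dirichlet n (x n - t))\<^sup>2 + (dirichlet' n (x n - t))\<^sup>2) / real n - real n * (dirichlet n (x n - t))\<^sup>2 / 2
        - cos (real n * (x n - t)) / (4 * W (x n - t))"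
    have eq: "?F t * \<psi> t = (((?N n)\<^sup>2 * (dirichlet n (x n - t))\<^sup>2 + (dirichlet' n (x n - t))\<^sup>2) * \<psi> t) / real n
        - real n * ((dirichlet n (x n - t))\<^sup>2 * \<psi> t) / 2 - (cos (real n * (x n - t)) / W (x n - t) * \<psi> t) / 4" for t
      by (simp add: left_diff_distrib)
    have Fi: "integrable circ (\<lambda>t. ?F t * \<psi> t)"
      unfolding eq by (rule integrable_divide_mult_diff[OF int2(2,1) ci])
    have val: "B n (x n) / real n - 1 / 2 * (real n * A n (x n)) - Rc n / 4 = (LINT t|circ. ?F t * \<psi> t)"
      unfolding eq B_def A_def Rc_def integral_divide_mult_diff[OF int2(2,1) ci] by simp
    have "norm (LINT t|circ. ?F t * \<psi> t) \<le> (LINT t|circ. norm (?F t * \<psi> t))" by (rule integral_norm_bound)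
    also have "\<dots> \<le> (LINT t|circ. 2 / \<sigma>\<^sup>2 / real n * \<psi> t)"
    proof (rule integral_mono_AE)
      show "AE t in circ. norm (?F t * \<psi> t) \<le> 2 / \<sigma>\<^sup>2 / real n * \<psi> t"
        using AE_circ
      proof eventually_elim
        case (elim t)
        show ?case
        proof (cases "\<psi> t = 0")
          case False
          have "\<bar>?F t\<bar> \<le> 2 / \<sigma>\<^sup>2 / real n"
            unfolding WS[OF elim False] by (rule dirichlet_off_diagonal(2)[OF n \<sigma> supp[OF elim False]])
          hence "\<bar>?F t\<bar> * \<psi> t \<le> 2 / \<sigma>\<^sup>2 / real n * \<psi> t" using nonneg by (intro mult_right_mono)
          thus ?thesis using nonneg[of t] by (simp only: real_norm_def abs_mult abs_of_nonneg)
        qed simp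
      qed
    qed (use Fi psii in auto)
    also have "\<dots> = 2 / \<sigma>\<^sup>2 / real n" by (simp add: mass)
    finally show ?thesis unfolding val real_norm_def .
  qed
  have eE: "\<bar>E n (x n) - Rs n / 4\<bar> \<le> 1 / \<sigma>\<^sup>2 / real n" if n: "n > 0" for n
  proof -
    let ?F = "\<lambda>t. dirichlet n (x n - t) * dirichlet' n (x n - t) - sin (real n * (x n - t)) / (4 * W (x n - t))"
    have eq: "?F t * \<psi> t = (dirichlet n (x n - t) * dirichlet' n (x n - t)) * \<psi> t
        - (sin (real n * (x n - t)) / W (x n - t) * \<psi> t) / 4" for t
      by (simp add: left_diff_distrib)
    have Fi: "integrable circ (\<lambda>t. ?F t * \<psi> t)"
      unfolding eq by (rule integrable_quarter_diff[OF int2(3) si])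
    have val: "E n (x n) - Rs n / 4 = (LINT t|circ. ?F t * \<psi> t)"
      unfolding eq E_def Rs_def integral_quarter_diff[OF int2(3) si] by simp
    have "norm (LINT t|circ. ?F t * \<psi> t) \<le> (LINT t|circ. norm (?F t * \<psi> t))" by (rule integral_norm_bound)
    also have "\<dots> \<le> (LINT t|circ. 1 / \<sigma>\<^sup>2 / real n * \<psi> t)"
    proof (rule integral_mono_AE)
      show "AE t in circ. norm (?F t * \<psi> t) \<le> 1 / \<sigma>\<^sup>2 / real n * \<psi> t"
        using AE_circ
      proof eventually_elim
        case (elim t)
        show ?case
        proof (cases "\<psi> t = 0")
          case False
          have "\<bar>?F t\<bar> \<le> 1 / \<sigma>\<^sup>2 / real n"
            unfolding WS[OF elim False] by (rule dirichlet_off_diagonal(3)[OF n \<sigma> supp[OF elim False]])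
          hence "\<bar>?F t\<bar> * \<psi> t \<le> 1 / \<sigma>\<^sup>2 / real n * \<psi> t" using nonneg by (intro mult_right_mono)
          thus ?thesis using nonneg[of t] by (simp only: real_norm_def abs_mult abs_of_nonneg)
        qed simp
      qed
    qed (use Fi psii in auto)
    also have "\<dots> = 1 / \<sigma>\<^sup>2 / real n" by (simp add: mass)
    finally show ?thesis unfolding val real_norm_def .
  qed
  have ev: "eventually (\<lambda>n::nat. n > 0) sequentially" by (rule eventually_gt_at_top)
  have b: "(\<lambda>n. B n (x n) / real n - 1 / 2 * (real n * A n (x n))) \<longlonglongrightarrow> 0"
  proof -
    have "(\<lambda>n. B n (x n) / real n - 1 / 2 * (real n * A n (x n)) - Rc n / 4) \<longlonglongrightarrow> 0"
      by (rule Lim_null_comparison[OF _ lim_const_over_n[of "2 / \<sigma>\<^sup>2"]]) (use ev in eventually_elim, use bB in simp)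
    from tendsto_add[OF this tendsto_divide[OF Rc0 tendsto_const[of 4]]] show ?thesis by simp
  qed
  have e: "(\<lambda>n. E n (x n)) \<longlonglongrightarrow> 0"
  proof -
    have "(\<lambda>n. E n (x n) - Rs n / 4) \<longlonglongrightarrow> 0"
      by (rule Lim_null_comparison[OF _ lim_const_over_n[of "1 / \<sigma>\<^sup>2"]]) (use ev in eventually_elim, use eE in simp)
    from tendsto_add[OF this tendsto_divide[OF Rs0 tendsto_const[of 4]]] show ?thesis by simp
  qed
  have "eventually (\<lambda>n. Rc n < 1 / 2) sequentially" using Rc0 by (rule order_tendstoD) simp
  thus Alow: "eventually (\<lambda>n. 1 / 4 \<le> real n * A n (x n)) sequentially"
    using ev
  proof eventually_elim
    case (elim n)
    thus ?case using nA[of n] H1[of n] by simp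
  qed
  have "(\<lambda>n. (real n * A n (x n) * (B n (x n) / real n) - (E n (x n))\<^sup>2) / (real n * A n (x n))\<^sup>2) \<longlonglongrightarrow> 1 / 2"
    by (rule ratio_tendsto[OF b e _ Alow]) simp
  moreover have "eventually (\<lambda>n. (real n * A n (x n) * (B n (x n) / real n) - (E n (x n))\<^sup>2) / (real n * A n (x n))\<^sup>2
    = (A n (x n) * B n (x n) - (E n (x n))\<^sup>2) / ((A n (x n))\<^sup>2 * (real n)\<^sup>2)) sequentially"
    using ev by eventually_elim (simp add: power_mult_distrib mult.commute)
  ultimately show "(\<lambda>n. (A n (x n) * B n (x n) - (E n (x n))\<^sup>2) / ((A n (x n))\<^sup>2 * (real n)\<^sup>2)) \<longlonglongrightarrow> 1 / 2"
    by (rule Lim_transform_eventually)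
qed

end

section \<open>Gaussian combinations of the two sequences\<close>

text \<open>Dirac masses count as Gaussian laws; a centered one is concentrated at \<open>0\<close>.\<close>
lemma (in prob_space) centered_gaussian:
  assumes G: "gaussian_rv M X" and zero: "expectation X = 0"
  shows "integrable M (\<lambda>\<omega>. (X \<omega>)\<^sup>2)" and "integrable M X"
    and "(LINT \<omega>|M. iexp (X \<omega>)) = of_real (exp (- (LINT \<omega>|M. (X \<omega>)\<^sup>2) / 2))"
proof -
  from G obtain m s where [measurable]: "X \<in> borel_measurable M" and s: "0 \<le> s"
    and D: "distr M borel X = gaussian_law m s"
    by (auto simp: gaussian_rv_def)
  have E: "(LINT \<omega>|M. g (X \<omega>)) = (LINT x|gaussian_law m s. g x)"
    if [measurable]: "g \<in> borel_measurable borel" for g :: "real \<Rightarrow> 'c::{banach, second_countable_topology}"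
    unfolding D[symmetric] by (subst integral_distr) auto
  have I: "integrable M (\<lambda>\<omega>. g (X \<omega>)) \<longleftrightarrow> integrable (gaussian_law m s) g"
    if [measurable]: "g \<in> borel_measurable borel" for g :: "real \<Rightarrow> real"
    unfolding D[symmetric] by (subst integrable_distr_eq) auto
  show "integrable M (\<lambda>\<omega>. (X \<omega>)\<^sup>2)" "integrable M X"
    "(LINT \<omega>|M. iexp (X \<omega>)) = of_real (exp (- (LINT \<omega>|M. (X \<omega>)\<^sup>2) / 2))"
  proof (atomize (full), cases "s = 0")
    case True
    have L: "gaussian_law m s = return borel m" by (simp add: gaussian_law_def True)
    interpret R: prob_space "return borel m" by (rule prob_space_return) simp
    have "AE x in return borel m. x = m" by (simp add: AE_return)
    hence AE: "AE \<omega> in M. X \<omega> = m"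
      unfolding L[symmetric] D[symmetric] by (subst (asm) AE_distr_iff) auto
    have "expectation X = (LINT \<omega>|M. m)" using AE by (intro integral_cong_AE) auto
    hence m: "m = 0" using zero by (simp add: prob_space)
    have i1: "integrable M (\<lambda>\<omega>. (X \<omega>)\<^sup>2)" "integrable M X"
      using AE by (intro integrable_const_bound[where B = 0]; auto simp: m elim!: eventually_mono)+
    have "(LINT \<omega>|M. (X \<omega>)\<^sup>2) = (LINT \<omega>|M. 0)" using AE m by (intro integral_cong_AE) (auto elim!: eventually_mono)
    moreover have "(LINT \<omega>|M. iexp (X \<omega>)) = (LINT \<omega>|M. 1)" using AE m by (intro integral_cong_AE) (auto elim!: eventually_mono)
    ultimately show "integrable M (\<lambda>\<omega>. (X \<omega>)\<^sup>2) \<and> integrable M X \<and>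
      (LINT \<omega>|M. iexp (X \<omega>)) = of_real (exp (- (LINT \<omega>|M. (X \<omega>)\<^sup>2) / 2))"
      using i1 by (simp add: prob_space)
  next
    case False
    hence s0: "s > 0" using s by simp
    have L: "gaussian_law m s = density lborel (\<lambda>x. ennreal (normal_density m s x))"
      using False by (simp add: gaussian_law_def)
    have "expectation X = (LINT x|lborel. normal_density m s x * x)"
      using E[of "\<lambda>x. x"] unfolding L by (simp add: integral_real_density)
    hence m: "m = 0" using zero integral_normal_moment_nz_1[OF s0, of m] by simp
    note L0 = L[unfolded m]
    have iX: "integrable M X"
      using I[of "\<lambda>x. x"] integrable_normal_moment_nz_1[OF s0, of m] unfolding L by (simp add: integrable_real_density)
    have iX2: "integrable M (\<lambda>\<omega>. (X \<omega>)\<^sup>2)"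
      using I[of "\<lambda>x. x\<^sup>2"] integrable_normal_moment[OF s0, of 0 2] unfolding m L0 by (simp add: integrable_real_density)
    have eX2: "(LINT \<omega>|M. (X \<omega>)\<^sup>2) = s\<^sup>2"
      using E[of "\<lambda>x. x\<^sup>2"] integral_normal_moment_even[OF s0, of 0 1] unfolding m L0
      by (simp add: integral_real_density fact_2 power2_eq_square)
    have "distributed M lborel X (normal_density 0 s)"
      unfolding distributed_def using D[unfolded m L0] by (auto cong: distr_cong)
    hence "distributed M lborel (\<lambda>x. (X x - 0) / s) std_normal_density"
      using normal_standard_normal_convert[OF s0, of X 0] by simp
    hence "distr M lborel (\<lambda>x. X x / s) = std_normal_distribution"
      by (simp add: distributed_def)
    hence std: "distr M borel (\<lambda>x. X x / s) = std_normal_distribution"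
      by (simp cong: distr_cong)
    have "(LINT \<omega>|M. iexp (X \<omega>)) = (LINT \<omega>|M. iexp (s * (X \<omega> / s)))" using s0 by simp
    also have "\<dots> = (LINT x|distr M borel (\<lambda>\<omega>. X \<omega> / s). iexp (s * x))"
      by (subst integral_distr) auto
    also have "\<dots> = char std_normal_distribution s" unfolding std char_def ..
    finally show "integrable M (\<lambda>\<omega>. (X \<omega>)\<^sup>2) \<and> integrable M X \<and>
      (LINT \<omega>|M. iexp (X \<omega>)) = of_real (exp (- (LINT \<omega>|M. (X \<omega>)\<^sup>2) / 2))"
      using iX iX2 unfolding eX2 char_std_normal_distribution by simp
  qed
qed

locale gaussian_pair = prob_space M for M :: "'w measure" +
  fixes \<mu> :: "real measure" and a b :: "nat \<Rightarrow> 'w \<Rightarrow> real"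
  assumes a: "stationary_gaussian_sequence M \<mu> a" and b: "stationary_gaussian_sequence M \<mu> b"
    and ab: "indep_sequences M a b"
begin

definition span :: "nat \<Rightarrow> ('w \<Rightarrow> real) set" where
  "span n = {T. \<exists>u v. T = (\<lambda>\<omega>. (\<Sum>k=1..n. u k * a k \<omega>) + (\<Sum>k=1..n. v k * b k \<omega>))}"

lemma sequence_facts:
  assumes X: "stationary_gaussian_sequence M \<mu> X"
  shows "k \<ge> 1 \<Longrightarrow> X k \<in> borel_measurable M" "k \<ge> 1 \<Longrightarrow> integrable M (X k)"
    and "gaussian_rv M (\<lambda>\<omega>. \<Sum>k=1..n. u k * X k \<omega>)"
    and "expectation (\<lambda>\<omega>. \<Sum>k=1..n. u k * X k \<omega>) = 0"
proof -
  have G: "gaussian_rv M (\<lambda>\<omega>. \<Sum>k\<in>I. u k * X k \<omega>)" if "finite I" "I \<subseteq> {1..}" for I u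
    using X that by (auto simp: stationary_gaussian_sequence_def gaussian_sequence_def)
  have E: "expectation (X k) = 0" if "k \<ge> 1" for k
    using X that by (auto simp: stationary_gaussian_sequence_def)
  have Gk: "gaussian_rv M (X k)" if "k \<ge> 1" for k
    using G[of "{k}" "\<lambda>_. 1"] that by simp
  show "X k \<in> borel_measurable M" if "k \<ge> 1" for k using Gk[OF that] by (simp add: gaussian_rv_def)
  show int: "integrable M (X k)" if "k \<ge> 1" for k using centered_gaussian(2)[OF Gk E] that by blast
  show "gaussian_rv M (\<lambda>\<omega>. \<Sum>k=1..n. u k * X k \<omega>)" by (rule G) auto
  show "expectation (\<lambda>\<omega>. \<Sum>k=1..n. u k * X k \<omega>) = 0"
    using int E by (subst Bochner_Integration.integral_sum) auto
qed

lemma indep_combinations: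
  "indep_var borel (\<lambda>\<omega>. \<Sum>k=1..n. u k * a k \<omega>) borel (\<lambda>\<omega>. \<Sum>k=1..n. v k * b k \<omega>)"
proof -
  let ?F = "\<lambda>u s. \<Sum>k=1..n. u k * s k :: real"
  have F: "?F u \<in> measurable (PiM {1..} (\<lambda>_. borel)) borel" for u :: "nat \<Rightarrow> real"
    by (intro borel_measurable_sum borel_measurable_times borel_measurable_const measurable_component_singleton) auto
  have "indep_var borel (?F u \<circ> (\<lambda>\<omega>. \<lambda>k\<in>{1..}. a k \<omega>)) borel (?F v \<circ> (\<lambda>\<omega>. \<lambda>k\<in>{1..}. b k \<omega>))"
    using ab unfolding indep_sequences_def by (rule indep_var_compose[OF _ F F])
  moreover have "?F u \<circ> (\<lambda>\<omega>. \<lambda>k\<in>{1..}. a k \<omega>) = (\<lambda>\<omega>. \<Sum>k=1..n. u k * a k \<omega>)"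
    "?F v \<circ> (\<lambda>\<omega>. \<lambda>k\<in>{1..}. b k \<omega>) = (\<lambda>\<omega>. \<Sum>k=1..n. v k * b k \<omega>)"
    by (auto simp: fun_eq_iff intro!: sum.cong)
  ultimately show ?thesis by simp
qed

text \<open>The characteristic function of a sum of independent variables is the product, so a combination of
  both sequences is Gaussian although only combinations within one sequence are assumed to be.\<close>
lemma gaussian_space_span: "gaussian_space M (span n)"
proof
  show "(\<lambda>_. 0) \<in> span n" unfolding span_def by (auto intro!: exI[of _ "\<lambda>_. 0"])
next
  fix X Y c d assume "X \<in> span n" "Y \<in> span n"
  then obtain u v u' v' where
    X: "X = (\<lambda>\<omega>. (\<Sum>k=1..n. u k * a k \<omega>) + (\<Sum>k=1..n. v k * b k \<omega>))" and
    Y: "Y = (\<lambda>\<omega>. (\<Sum>k=1..n. u' k * a k \<omega>) + (\<Sum>k=1..n. v' k * b k \<omega>))"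
    unfolding span_def by blast
  have "(\<lambda>\<omega>. c * X \<omega> + d * Y \<omega>) = (\<lambda>\<omega>. (\<Sum>k=1..n. (c * u k + d * u' k) * a k \<omega>) + (\<Sum>k=1..n. (c * v k + d * v' k) * b k \<omega>))"
    by (auto simp: X Y fun_eq_iff sum.distrib distrib_right distrib_left sum_distrib_left mult.assoc)
  thus "(\<lambda>\<omega>. c * X \<omega> + d * Y \<omega>) \<in> span n" unfolding span_def mem_Collect_eq by (intro exI)
next
  fix T assume "T \<in> span n"
  then obtain u v where T: "T = (\<lambda>\<omega>. (\<Sum>k=1..n. u k * a k \<omega>) + (\<Sum>k=1..n. v k * b k \<omega>))"
    unfolding span_def by blast
  define A where "A = (\<lambda>\<omega>. \<Sum>k=1..n. u k * a k \<omega>)"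
  define B where "B = (\<lambda>\<omega>. \<Sum>k=1..n. v k * b k \<omega>)"
  have TAB: "T = (\<lambda>\<omega>. A \<omega> + B \<omega>)" by (simp add: T A_def B_def)
  have GA: "gaussian_rv M A" "expectation A = 0" unfolding A_def by (rule sequence_facts[OF a])+
  have GB: "gaussian_rv M B" "expectation B = 0" unfolding B_def by (rule sequence_facts[OF b])+
  note A = centered_gaussian[OF GA] and B = centered_gaussian[OF GB]
  have [measurable]: "A \<in> borel_measurable M" "B \<in> borel_measurable M"
    using GA GB by (auto simp: gaussian_rv_def)
  have ind: "indep_var borel A borel B" unfolding A_def B_def by (rule indep_combinations)
  have AB: "expectation (\<lambda>\<omega>. A \<omega> * B \<omega>) = 0" "integrable M (\<lambda>\<omega>. A \<omega> * B \<omega>)"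
    using indep_var_lebesgue_integral[OF ind A(2) B(2)] indep_var_integrable[OF ind A(2) B(2)] GA by auto
  have sq: "(\<lambda>\<omega>. (T \<omega>)\<^sup>2) = (\<lambda>\<omega>. ((A \<omega>)\<^sup>2 + (B \<omega>)\<^sup>2) + 2 * (A \<omega> * B \<omega>))"
    by (simp add: TAB power2_sum fun_eq_iff)
  show "T \<in> borel_measurable M" unfolding TAB by measurable
  show "integrable M (\<lambda>\<omega>. (T \<omega>)\<^sup>2)" unfolding sq using A B AB by auto
  have ET: "(LINT \<omega>|M. (T \<omega>)\<^sup>2) = (LINT \<omega>|M. (A \<omega>)\<^sup>2) + (LINT \<omega>|M. (B \<omega>)\<^sup>2)"
    unfolding sq using A B AB by simp
  have ch: "char (distr M borel Y) 1 = (LINT \<omega>|M. iexp (Y \<omega>))" if [measurable]: "Y \<in> borel_measurable M" for Y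
    unfolding char_def by (subst integral_distr) auto
  have "(LINT \<omega>|M. iexp (T \<omega>)) = (LINT \<omega>|M. iexp (A \<omega>)) * (LINT \<omega>|M. iexp (B \<omega>))"
    using char_distr_add[OF ind, of 1] ch[of A] ch[of B] ch[of T] by (simp add: TAB)
  also have "\<dots> = of_real (exp (- (LINT \<omega>|M. (A \<omega>)\<^sup>2) / 2) * exp (- (LINT \<omega>|M. (B \<omega>)\<^sup>2) / 2))"
    unfolding A(3) B(3) by simp
  also have "exp (- (LINT \<omega>|M. (A \<omega>)\<^sup>2) / 2) * exp (- (LINT \<omega>|M. (B \<omega>)\<^sup>2) / 2) = exp (- (LINT \<omega>|M. (T \<omega>)\<^sup>2) / 2)"
    unfolding ET exp_add[symmetric] by (simp add: add_divide_distrib)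
  finally show "(LINT \<omega>|M. iexp (T \<omega>)) = of_real (exp (- (LINT \<omega>|M. (T \<omega>)\<^sup>2) / 2))" .
qed

lemma in_span: "1 \<le> k \<Longrightarrow> k \<le> n \<Longrightarrow> a k \<in> span n" "1 \<le> k \<Longrightarrow> k \<le> n \<Longrightarrow> b k \<in> span n"
proof -
  have pick: "(\<Sum>j=1..n. (if j = k then 1 else 0) * X j) = X k" if "1 \<le> k" "k \<le> n" for X :: "nat \<Rightarrow> real"
    using that by (subst sum.remove[of _ k]) auto
  show "a k \<in> span n" if "1 \<le> k" "k \<le> n"
    unfolding span_def mem_Collect_eq
    by (rule exI[of _ "\<lambda>j. if j = k then 1 else 0"], rule exI[of _ "\<lambda>_. 0"]) (use pick[OF that] in simp)
  show "b k \<in> span n" if "1 \<le> k" "k \<le> n"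
    unfolding span_def mem_Collect_eq
    by (rule exI[of _ "\<lambda>_. 0"], rule exI[of _ "\<lambda>j. if j = k then 1 else 0"]) (use pick[OF that] in simp)
qed

lemma uncorrelated:
  assumes k: "1 \<le> k" and l: "1 \<le> l"
  shows "expectation (\<lambda>\<omega>. a k \<omega> * b l \<omega>) = 0"
proof -
  define n where "n = max k l"
  have pick: "(\<Sum>j=1..n. (if j = i then 1 else 0) * X j) = X i" if "1 \<le> i" "i \<le> n" for i and X :: "nat \<Rightarrow> real"
    using that by (subst sum.remove[of _ i]) auto
  have pa: "(\<lambda>\<omega>. \<Sum>j=1..n. (if j = k then 1 else 0) * a j \<omega>) = a k"
    and pb: "(\<lambda>\<omega>. \<Sum>j=1..n. (if j = l then 1 else 0) * b j \<omega>) = b l"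
    by (rule ext, rule pick; use k l in \<open>simp add: n_def\<close>)+
  have "indep_var borel (a k) borel (b l)"
    using indep_combinations[where n = n and u = "\<lambda>j. if j = k then 1 else 0" and v = "\<lambda>j. if j = l then 1 else 0"] k l
    by (simp only: pa pb)
  from indep_var_lebesgue_integral[OF this sequence_facts(2)[OF a k] sequence_facts(2)[OF b l]]
  show ?thesis using a k by (simp add: stationary_gaussian_sequence_def)
qed

end

section \<open>The covariance structure of the trigonometric polynomials\<close>

locale spectral_gaussian_pair = gaussian_pair M \<mu> a b + spectral_density \<psi> C T
  for M :: "'w measure" and \<mu> :: "real measure" and a b :: "nat \<Rightarrow> 'w \<Rightarrow> real"
    and \<psi> :: "real \<Rightarrow> real" and C :: real and T :: "real set" +
  assumes prob_mu: "prob_space \<mu>" and mu: "\<mu> = density circ (\<lambda>t. ennreal (\<psi> t))"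
begin

definition \<rho> :: "nat \<Rightarrow> nat \<Rightarrow> real" where
  "\<rho> k l = (LINT t|circ. cos ((real k - real l) * t) * \<psi> t)"

lemma integral_mu:
  fixes g :: "real \<Rightarrow> real"
  assumes [measurable]: "g \<in> borel_measurable borel"
  shows "(LINT t|\<mu>. g t) = (LINT t|circ. g t * \<psi> t)"
  unfolding mu using nonneg by (subst integral_density) (auto simp: mult.commute)

text \<open>The spectral integral is complex, but it is the expectation of a real variable: its imaginary part
  vanishes. This expresses the symmetry of the spectral measure.\<close>
lemma covariance:
  assumes X: "stationary_gaussian_sequence M \<mu> X" and k: "1 \<le> k" and l: "1 \<le> l"
  shows "expectation (\<lambda>\<omega>. X k \<omega> * X l \<omega>) = \<rho> k l"
    and "(LINT t|circ. sin ((real k - real l) * t) * \<psi> t) = 0"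
proof -
  interpret P: prob_space \<mu> by (rule prob_mu)
  have [measurable_cong, simp]: "sets \<mu> = sets borel" by (simp add: mu)
  define m where "m = \<bar>int k - int l\<bar>"
  define z where "z t = exp (- \<i> * of_int m * complex_of_real t)" for t
  have zeq: "z t = iexp (- (real_of_int m * t))" for t
    by (simp add: z_def mult.assoc)
  have zi: "integrable \<mu> z"
  proof (rule P.integrable_unit_bound)
    show "z \<in> borel_measurable \<mu>" unfolding z_def[abs_def] by measurable
    show "norm (z t) \<le> 1" for t unfolding zeq norm_exp_i_times by simp
  qed
  have Re_z: "Re (z t) = cos (real_of_int m * t)" and Im_z: "Im (z t) = - sin (real_of_int m * t)" for t
    unfolding zeq by (simp_all add: exp_Euler Re_exp Im_exp)
  have c: "complex_of_real (expectation (\<lambda>\<omega>. X k \<omega> * X l \<omega>)) = (LINT t|\<mu>. z t)"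
    using X k l unfolding stationary_gaussian_sequence_def spectral_corr_def m_def z_def by blast
  have "expectation (\<lambda>\<omega>. X k \<omega> * X l \<omega>) = Re (LINT t|\<mu>. z t)" unfolding c[symmetric] by simp
  also have "\<dots> = (LINT t|\<mu>. cos (real_of_int m * t))"
    using integral_Re[OF zi] by (simp add: Re_z)
  also have "\<dots> = (LINT t|circ. cos (real_of_int m * t) * \<psi> t)" by (rule integral_mu) measurable
  finally have e1: "expectation (\<lambda>\<omega>. X k \<omega> * X l \<omega>) = (LINT t|circ. cos (real_of_int m * t) * \<psi> t)" .
  have "0 = Im (LINT t|\<mu>. z t)" unfolding c[symmetric] by simp
  also have "\<dots> = (LINT t|\<mu>. - sin (real_of_int m * t))"
    using integral_Im[OF zi] by (simp add: Im_z)
  also have "\<dots> = (LINT t|circ. - sin (real_of_int m * t) * \<psi> t)" by (rule integral_mu) measurable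
  finally have e2: "(LINT t|circ. sin (real_of_int m * t) * \<psi> t) = 0" by simp
  show "expectation (\<lambda>\<omega>. X k \<omega> * X l \<omega>) = \<rho> k l"
    and "(LINT t|circ. sin ((real k - real l) * t) * \<psi> t) = 0"
  proof -
    consider "real_of_int m = real k - real l" | "real_of_int m = - (real k - real l)"
      unfolding m_def by (cases "k \<ge> l") auto
    hence "(LINT t|circ. cos (real_of_int m * t) * \<psi> t) = \<rho> k l \<and> (LINT t|circ. sin ((real k - real l) * t) * \<psi> t) = 0"
    proof cases
      case 1 thus ?thesis using e2 unfolding \<rho>_def by metis
    next
      case 2
      have "cos (real_of_int m * t) = cos ((real k - real l) * t)" "sin (real_of_int m * t) = - sin ((real k - real l) * t)" for t
        unfolding 2 mult_minus_left cos_minus sin_minus by simp_all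
      thus ?thesis using e2 unfolding \<rho>_def by simp
    qed
    thus "expectation (\<lambda>\<omega>. X k \<omega> * X l \<omega>) = \<rho> k l"
      and "(LINT t|circ. sin ((real k - real l) * t) * \<psi> t) = 0" using e1 by auto
  qed
qed

text \<open>The vanishing sine integrals allow the point \<open>x\<close> to be absorbed into the spectral integral as a
  translation.\<close>
lemma rho_shift:
  assumes k: "1 \<le> k" and l: "1 \<le> l"
  shows "cos ((real k - real l) * x) * \<rho> k l = (LINT t|circ. cos ((real k - real l) * (x - t)) * \<psi> t)"
    and "sin ((real k - real l) * x) * \<rho> k l = (LINT t|circ. sin ((real k - real l) * (x - t)) * \<psi> t)"
proof -
  let ?m = "real k - real l"
  have int: "integrable circ (\<lambda>t. cos (?m * t) * \<psi> t)" "integrable circ (\<lambda>t. sin (?m * t) * \<psi> t)"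
    by (intro integrable_continuous_psi continuous_intros)+
  have zero: "(LINT t|circ. sin (?m * t) * \<psi> t) = 0" by (rule covariance(2)[OF a k l])
  have lin: "(LINT t|circ. p * (cos (?m * t) * \<psi> t) + q * (sin (?m * t) * \<psi> t)) = p * \<rho> k l" for p q
    using int zero by (simp add: \<rho>_def)
  have "cos (?m * (x - t)) * \<psi> t = cos (?m * x) * (cos (?m * t) * \<psi> t) + sin (?m * x) * (sin (?m * t) * \<psi> t)" for t
    unfolding right_diff_distrib cos_diff by (simp add: distrib_right)
  thus "cos (?m * x) * \<rho> k l = (LINT t|circ. cos (?m * (x - t)) * \<psi> t)" using lin by simp
  have "sin (?m * (x - t)) * \<psi> t = sin (?m * x) * (cos (?m * t) * \<psi> t) + (- cos (?m * x)) * (sin (?m * t) * \<psi> t)" for t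
    unfolding right_diff_distrib sin_diff by (simp add: left_diff_distrib)
  thus "sin (?m * x) * \<rho> k l = (LINT t|circ. sin (?m * (x - t)) * \<psi> t)" using lin[of "sin (?m * x)" "- cos (?m * x)"] by simp
qed

lemma rho_sums:
  assumes n: "n > 0"
  shows "(\<Sum>k=1..n. \<Sum>l=1..n. cos ((real k - real l) * x) * \<rho> k l) = real n * A n x"
    and "(\<Sum>k=1..n. \<Sum>l=1..n. real l * sin ((real k - real l) * x) * \<rho> k l) = real n * E n x"
    and "(\<Sum>k=1..n. \<Sum>l=1..n. real k * real l * cos ((real k - real l) * x) * \<rho> k l) = real n * B n x"
proof -
  have swap: "(\<Sum>k=1..n. \<Sum>l=1..n. LINT t|circ. g k l t * \<psi> t) = (LINT t|circ. (\<Sum>k=1..n. \<Sum>l=1..n. g k l t) * \<psi> t)"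
    if "\<And>k l. continuous_on UNIV (g k l)" for g :: "nat \<Rightarrow> nat \<Rightarrow> real \<Rightarrow> real"
    using that by (simp add: sum_distrib_right Bochner_Integration.integral_sum integrable_continuous_psi)
  have "(\<Sum>k=1..n. \<Sum>l=1..n. cos ((real k - real l) * x) * \<rho> k l) = (\<Sum>k=1..n. \<Sum>l=1..n. LINT t|circ. cos ((real k - real l) * (x - t)) * \<psi> t)"
    by (intro sum.cong refl rho_shift(1)) auto
  also have "\<dots> = (LINT t|circ. (\<Sum>k=1..n. \<Sum>l=1..n. cos ((real k - real l) * (x - t))) * \<psi> t)"
    by (rule swap) (intro continuous_intros)
  also have "\<dots> = real n * A n x" unfolding fejer_sums(1)[OF n] A_def by (simp add: mult.assoc)
  finally show "(\<Sum>k=1..n. \<Sum>l=1..n. cos ((real k - real l) * x) * \<rho> k l) = real n * A n x" .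
  have "(\<Sum>k=1..n. \<Sum>l=1..n. real l * sin ((real k - real l) * x) * \<rho> k l)
      = (\<Sum>k=1..n. \<Sum>l=1..n. LINT t|circ. (real l * sin ((real k - real l) * (x - t))) * \<psi> t)"
  proof (intro sum.cong refl)
    fix k l assume "k \<in> {1..n}" "l \<in> {1..n}"
    thus "real l * sin ((real k - real l) * x) * \<rho> k l = (LINT t|circ. (real l * sin ((real k - real l) * (x - t))) * \<psi> t)"
      using rho_shift(2)[of k l x] by (simp add: mult.assoc)
  qed
  also have "\<dots> = (LINT t|circ. (\<Sum>k=1..n. \<Sum>l=1..n. real l * sin ((real k - real l) * (x - t))) * \<psi> t)"
    by (rule swap) (intro continuous_intros)
  also have "\<dots> = real n * E n x" unfolding fejer_sums(2)[OF n] E_def by (simp add: mult.assoc)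
  finally show "(\<Sum>k=1..n. \<Sum>l=1..n. real l * sin ((real k - real l) * x) * \<rho> k l) = real n * E n x" .
  have "(\<Sum>k=1..n. \<Sum>l=1..n. real k * real l * cos ((real k - real l) * x) * \<rho> k l)
      = (\<Sum>k=1..n. \<Sum>l=1..n. LINT t|circ. (real k * real l * cos ((real k - real l) * (x - t))) * \<psi> t)"
  proof (intro sum.cong refl)
    fix k l assume "k \<in> {1..n}" "l \<in> {1..n}"
    thus "real k * real l * cos ((real k - real l) * x) * \<rho> k l = (LINT t|circ. (real k * real l * cos ((real k - real l) * (x - t))) * \<psi> t)"
      using rho_shift(1)[of k l x] by (simp add: mult.assoc)
  qed
  also have "\<dots> = (LINT t|circ. (\<Sum>k=1..n. \<Sum>l=1..n. real k * real l * cos ((real k - real l) * (x - t))) * \<psi> t)"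
    by (rule swap) (intro continuous_intros)
  also have "\<dots> = real n * B n x" unfolding fejer_sums(3)[OF n] B_def by (simp add: mult.assoc)
  finally show "(\<Sum>k=1..n. \<Sum>l=1..n. real k * real l * cos ((real k - real l) * x) * \<rho> k l) = real n * B n x" .
qed

text \<open>The kernel has countably many zeros, and \<open>\<psi>\<close> does not vanish almost everywhere as its mass is \<open>1\<close>.\<close>
lemma A_pos:
  assumes n: "n > 0"
  shows "0 < A n x"
proof (rule ccontr)
  assume "\<not> 0 < A n x"
  moreover have "0 \<le> A n x" unfolding A_def using nonneg by simp
  ultimately have zero: "(LINT t|circ. (dirichlet n (x - t))\<^sup>2 * \<psi> t) = 0" by (simp add: A_def)
  have int: "integrable circ (\<lambda>t. (dirichlet n (x - t))\<^sup>2 * \<psi> t)"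
    by (intro integrable_continuous_psi continuous_intros)
  have ae: "AE t in circ. (dirichlet n (x - t))\<^sup>2 * \<psi> t = 0"
    using zero integral_nonneg_eq_0_iff_AE[OF int] nonneg by simp
  have "AE t in circ. dirichlet n (x - t) \<noteq> 0"
  proof -
    let ?Z = "range (\<lambda>i::int. x - 2 * (of_int i * pi) / real n)"
    have "AE t in lborel. t \<notin> ?Z" by (intro AE_not_in countable_imp_null_set_lborel) auto
    hence "AE t in lborel. dirichlet n (x - t) \<noteq> 0"
    proof eventually_elim
      case (elim t)
      show ?case
      proof
        assume "dirichlet n (x - t) = 0"
        hence "sin (real n * (x - t) / 2) = 0" unfolding dirichlet_closed_form[symmetric] by simp
        then obtain i :: int where "real n * (x - t) / 2 = of_int i * pi" using sin_zero_iff_int2 by blast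
        hence "t = x - 2 * (of_int i * pi) / real n" using n by (simp add: field_simps)
        thus False using elim by blast
      qed
    qed
    moreover have m: "(\<lambda>t. ennreal (indicator {-pi..pi} t)) \<in> borel_measurable lborel" by measurable
    ultimately show ?thesis unfolding circ_def AE_density[OF m] by eventually_elim simp
  qed
  with ae have "AE t in circ. \<psi> t = 0" by eventually_elim simp
  hence "(LINT t|circ. \<psi> t) = (LINT t|circ. 0)" by (intro integral_cong_AE) auto
  thus False using mass by simp
qed

text \<open>By the Cauchy-Schwarz inequality the Gram determinant of \<open>dirichlet n\<close> and \<open>dirichlet' n\<close> is nonnegative;
  the carrier frequency adds the strictly positive term on the left.\<close>
lemma gram_ge: "n > 0 \<Longrightarrow> ((real n + 1) / 2 * A n x)\<^sup>2 \<le> A n x * B n x - (E n x)\<^sup>2"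
proof -
  assume n: "n > 0"
  define F where "F = (LINT t|circ. (dirichlet' n (x - t))\<^sup>2 * \<psi> t)"
  have int: "integrable circ (\<lambda>t. (dirichlet n (x - t))\<^sup>2 * \<psi> t)" "integrable circ (\<lambda>t. (dirichlet' n (x - t))\<^sup>2 * \<psi> t)"
    "integrable circ (\<lambda>t. (dirichlet n (x - t) * dirichlet' n (x - t)) * \<psi> t)"
    by (intro integrable_continuous_psi continuous_intros)+
  have quad: "(LINT t|circ. p * ((dirichlet n (x - t))\<^sup>2 * \<psi> t) + q * ((dirichlet' n (x - t))\<^sup>2 * \<psi> t)
      + r * ((dirichlet n (x - t) * dirichlet' n (x - t)) * \<psi> t)) = p * A n x + q * F + r * E n x" for p q r
    unfolding A_def F_def E_def using int by simp
  have "B n x = (LINT t|circ. ((real n + 1) / 2)\<^sup>2 * ((dirichlet n (x - t))\<^sup>2 * \<psi> t) + 1 * ((dirichlet' n (x - t))\<^sup>2 * \<psi> t)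
      + 0 * ((dirichlet n (x - t) * dirichlet' n (x - t)) * \<psi> t))"
    unfolding B_def by (simp add: distrib_right mult.assoc)
  hence B: "B n x = ((real n + 1) / 2)\<^sup>2 * A n x + F" unfolding quad by simp
  have "0 \<le> (LINT t|circ. (E n x * dirichlet n (x - t) - A n x * dirichlet' n (x - t))\<^sup>2 * \<psi> t)"
    using nonneg by simp
  also have "\<dots> = (LINT t|circ. (E n x)\<^sup>2 * ((dirichlet n (x - t))\<^sup>2 * \<psi> t) + (A n x)\<^sup>2 * ((dirichlet' n (x - t))\<^sup>2 * \<psi> t)
      + (- 2 * E n x * A n x) * ((dirichlet n (x - t) * dirichlet' n (x - t)) * \<psi> t))"
    by (intro Bochner_Integration.integral_cong refl) (simp add: power2_eq_square algebra_simps)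
  also have "\<dots> = A n x * (A n x * F - (E n x)\<^sup>2)"
    unfolding quad by (simp add: power2_eq_square algebra_simps)
  finally have "0 \<le> A n x * F - (E n x)\<^sup>2"
    using A_pos[OF n, of x] by (simp add: zero_le_mult_iff)
  moreover have "A n x * B n x = ((real n + 1) / 2 * A n x)\<^sup>2 + A n x * F"
    unfolding B by (simp add: power2_eq_square algebra_simps)
  ultimately show ?thesis by linarith
qed

definition coef :: "nat \<Rightarrow> nat + nat \<Rightarrow> real \<Rightarrow> real" where
  "coef n = case_sum (\<lambda>k x. cos (real k * x) / sqrt (real n)) (\<lambda>k x. sin (real k * x) / sqrt (real n))"
definition coef' :: "nat \<Rightarrow> nat + nat \<Rightarrow> real \<Rightarrow> real" where
  "coef' n = case_sum (\<lambda>k x. - (real k * sin (real k * x)) / sqrt (real n)) (\<lambda>k x. real k * cos (real k * x) / sqrt (real n))"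
definition coef'' :: "nat \<Rightarrow> nat + nat \<Rightarrow> real \<Rightarrow> real" where
  "coef'' n = case_sum (\<lambda>k x. - ((real k)\<^sup>2 * cos (real k * x)) / sqrt (real n)) (\<lambda>k x. - ((real k)\<^sup>2 * sin (real k * x)) / sqrt (real n))"

lemma gaussian_sum_trig:
  assumes n: "n > 0"
  shows "gaussian_sum M (span n) ({1..n} <+> {1..n}) (case_sum a b) (coef n) (coef' n) (coef'' n) ((real n)\<^sup>2)"
proof -
  interpret gaussian_space M "span n" by (rule gaussian_space_span)
  show ?thesis
  proof
    show "finite ({1..n} <+> {1..n})" by simp
    show "case_sum a b k \<in> span n" if "k \<in> {1..n} <+> {1..n}" for k using that in_span by auto
    fix k x
    show "(coef n k has_real_derivative coef' n k x) (at x)"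
    proof (cases k)
      case (Inl j)
      show ?thesis unfolding Inl coef_def coef'_def sum.case
        by (rule DERIV_cdivide) (auto intro!: derivative_eq_intros)
    next
      case (Inr j)
      show ?thesis unfolding Inr coef_def coef'_def sum.case
        by (rule DERIV_cdivide) (auto intro!: derivative_eq_intros)
    qed
    show "(coef' n k has_real_derivative coef'' n k x) (at x)"
    proof (cases k)
      case (Inl j)
      show ?thesis unfolding Inl coef'_def coef''_def sum.case
        by (rule DERIV_cdivide) (auto intro!: derivative_eq_intros simp: power2_eq_square)
    next
      case (Inr j)
      show ?thesis unfolding Inr coef'_def coef''_def sum.case
        by (rule DERIV_cdivide) (auto intro!: derivative_eq_intros simp: power2_eq_square)
    qed
    have bd: "\<bar>- ((real j)\<^sup>2 * c) / sqrt (real n)\<bar> \<le> (real n)\<^sup>2" if j: "1 \<le> j" "j \<le> n" and c: "\<bar>c\<bar> \<le> 1" for j c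
    proof -
      have "(real j)\<^sup>2 * \<bar>c\<bar> \<le> (real n)\<^sup>2 * 1" using j c by (intro mult_mono power_mono) auto
      hence "(real j)\<^sup>2 * \<bar>c\<bar> / sqrt (real n) \<le> (real n)\<^sup>2 / 1" using n by (intro frac_le) auto
      thus ?thesis by (simp add: abs_mult)
    qed
    show "\<bar>coef'' n k x\<bar> \<le> (real n)\<^sup>2" if "k \<in> {1..n} <+> {1..n}"
    proof (cases k)
      case (Inl j)
      show ?thesis unfolding Inl coef''_def sum.case using that Inl by (intro bd) auto
    next
      case (Inr j)
      show ?thesis unfolding Inr coef''_def sum.case using that Inr by (intro bd) auto
    qed
  qed
qed

lemma ip_expand:
  assumes n: "n > 0"
  shows "(\<Sum>k\<in>{1..n} <+> {1..n}. \<Sum>l\<in>{1..n} <+> {1..n}. c k * d l * gaussian_space.ip M (case_sum a b k) (case_sum a b l))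
    = (\<Sum>k=1..n. \<Sum>l=1..n. (c (Inl k) * d (Inl l) + c (Inr k) * d (Inr l)) * \<rho> k l)"
proof -
  interpret gaussian_space M "span n" by (rule gaussian_space_span)
  have aa: "ip (a k) (a l) = \<rho> k l" and bb: "ip (b k) (b l) = \<rho> k l" and ab: "ip (a k) (b l) = 0" and ba: "ip (b k) (a l) = 0"
    if "k \<in> {1..n}" "l \<in> {1..n}" for k l
    using that covariance(1)[OF a, of k l] covariance(1)[OF b, of k l] uncorrelated[of k l] uncorrelated[of l k]
    by (auto simp: ip_def mult.commute)
  have "(\<Sum>k\<in>{1..n} <+> {1..n}. \<Sum>l\<in>{1..n} <+> {1..n}. c k * d l * ip (case_sum a b k) (case_sum a b l))
    = (\<Sum>k=1..n. (\<Sum>l=1..n. c (Inl k) * d (Inl l) * ip (a k) (a l)) + (\<Sum>l=1..n. c (Inl k) * d (Inr l) * ip (a k) (b l)))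
      + (\<Sum>k=1..n. (\<Sum>l=1..n. c (Inr k) * d (Inl l) * ip (b k) (a l)) + (\<Sum>l=1..n. c (Inr k) * d (Inr l) * ip (b k) (b l)))"
    by (simp add: sum.Plus)
  also have "\<dots> = (\<Sum>k=1..n. \<Sum>l=1..n. c (Inl k) * d (Inl l) * \<rho> k l) + (\<Sum>k=1..n. \<Sum>l=1..n. c (Inr k) * d (Inr l) * \<rho> k l)"
    using aa bb ab ba by (intro arg_cong2[where f = "(+)"] sum.cong refl) auto
  finally show ?thesis by (simp add: sum.distrib distrib_right)
qed

text \<open>The double sums over the covariances are \<open>A\<close>, \<open>E\<close> and \<open>B\<close>, by \<open>rho_sums\<close>. This
  makes the general theory applicable: the trigonometric polynomial is a nondegenerate Gaussian sum
  whose speed is given by the three spectral integrals.\<close>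
lemma nondegenerate_trig:
  assumes n: "n > 0"
  shows "nondegenerate_gaussian_sum M (span n) ({1..n} <+> {1..n}) (case_sum a b) (coef n) (coef' n) (coef'' n) ((real n)\<^sup>2)"
    and "gaussian_sum.f ({1..n} <+> {1..n}) (case_sum a b) (coef n) x \<omega> = trig_poly a b n \<omega> x"
    and "gaussian_sum.speed M ({1..n} <+> {1..n}) (case_sum a b) (coef n) (coef' n) x
      = sqrt (A n x * B n x - (E n x)\<^sup>2) / A n x"
    and "gaussian_space.ip M (gaussian_sum.f ({1..n} <+> {1..n}) (case_sum a b) (coef n) x)
       (gaussian_sum.f ({1..n} <+> {1..n}) (case_sum a b) (coef n) x) = A n x"
proof -
  interpret G: gaussian_sum M "span n" "{1..n} <+> {1..n}" "case_sum a b" "coef n" "coef' n" "coef'' n" "(real n)\<^sup>2"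
    by (rule gaussian_sum_trig[OF n])
  have sq: "sqrt (real n) * sqrt (real n) = real n" by simp
  show f: "G.f x \<omega> = trig_poly a b n \<omega> x" for x \<omega>
    unfolding G.f_def by (simp add: sum.Plus coef_def trig_poly_def sum.distrib sum_divide_distrib distrib_left sum_distrib_left mult.commute)
  have ff: "G.ip (G.f x) (G.f x) = A n x" for x
  proof -
    have "G.ip (G.f x) (G.f x) = (\<Sum>k=1..n. \<Sum>l=1..n. (coef n (Inl k) x * coef n (Inl l) x + coef n (Inr k) x * coef n (Inr l) x) * \<rho> k l)"
      unfolding G.f_def G.ip_sum_sum ip_expand[OF n, of "\<lambda>k. coef n k x" "\<lambda>k. coef n k x"] ..
    also have "\<dots> = (\<Sum>k=1..n. \<Sum>l=1..n. (cos ((real k - real l) * x) * \<rho> k l) / real n)"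
      by (intro sum.cong refl)
        (simp add: coef_def left_diff_distrib cos_diff add_divide_distrib distrib_right)
    also have "\<dots> = (\<Sum>k=1..n. \<Sum>l=1..n. cos ((real k - real l) * x) * \<rho> k l) / real n"
      unfolding sum_divide_distrib ..
    finally show ?thesis unfolding rho_sums[OF n] using n by simp
  qed
  thus "G.ip (G.f x) (G.f x) = A n x" .
  have ff': "G.ip (G.f x) (G.f' x) = E n x" for x
  proof -
    have "G.ip (G.f x) (G.f' x) = (\<Sum>k=1..n. \<Sum>l=1..n. (coef n (Inl k) x * coef' n (Inl l) x + coef n (Inr k) x * coef' n (Inr l) x) * \<rho> k l)"
      unfolding G.f_def G.f'_def G.ip_sum_sum ip_expand[OF n, of "\<lambda>k. coef n k x" "\<lambda>k. coef' n k x"] ..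
    also have "\<dots> = (\<Sum>k=1..n. \<Sum>l=1..n. (real l * sin ((real k - real l) * x) * \<rho> k l) / real n)"
    proof (intro sum.cong refl)
      fix k l
      have "coef n (Inl k) x * coef' n (Inl l) x + coef n (Inr k) x * coef' n (Inr l) x = real l * sin ((real k - real l) * x) / real n"
        unfolding coef_def coef'_def sum.case left_diff_distrib sin_diff times_divide_times_eq sq add_divide_distrib[symmetric]
        by (simp add: right_diff_distrib mult_ac)
      thus "(coef n (Inl k) x * coef' n (Inl l) x + coef n (Inr k) x * coef' n (Inr l) x) * \<rho> k l = real l * sin ((real k - real l) * x) * \<rho> k l / real n"
        by simp
    qed
    also have "\<dots> = (\<Sum>k=1..n. \<Sum>l=1..n. real l * sin ((real k - real l) * x) * \<rho> k l) / real n"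
      unfolding sum_divide_distrib ..
    finally show ?thesis unfolding rho_sums[OF n] using n by simp
  qed
  have f'f': "G.ip (G.f' x) (G.f' x) = B n x" for x
  proof -
    have "G.ip (G.f' x) (G.f' x) = (\<Sum>k=1..n. \<Sum>l=1..n. (coef' n (Inl k) x * coef' n (Inl l) x + coef' n (Inr k) x * coef' n (Inr l) x) * \<rho> k l)"
      unfolding G.f'_def G.ip_sum_sum ip_expand[OF n, of "\<lambda>k. coef' n k x" "\<lambda>k. coef' n k x"] ..
    also have "\<dots> = (\<Sum>k=1..n. \<Sum>l=1..n. (real k * real l * cos ((real k - real l) * x) * \<rho> k l) / real n)"
    proof (intro sum.cong refl)
      fix k l
      have "coef' n (Inl k) x * coef' n (Inl l) x + coef' n (Inr k) x * coef' n (Inr l) x = real k * real l * cos ((real k - real l) * x) / real n"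
        unfolding coef'_def sum.case left_diff_distrib cos_diff times_divide_times_eq sq add_divide_distrib[symmetric]
        by (simp add: distrib_left mult_ac)
      thus "(coef' n (Inl k) x * coef' n (Inl l) x + coef' n (Inr k) x * coef' n (Inr l) x) * \<rho> k l = real k * real l * cos ((real k - real l) * x) * \<rho> k l / real n"
        by simp
    qed
    also have "\<dots> = (\<Sum>k=1..n. \<Sum>l=1..n. real k * real l * cos ((real k - real l) * x) * \<rho> k l) / real n"
      unfolding sum_divide_distrib ..
    finally show ?thesis unfolding rho_sums[OF n] using n by simp
  qed
  have gram: "G.gram x = A n x * B n x - (E n x)\<^sup>2" for x
    unfolding G.gram_def ff ff' f'f' ..
  show "G.speed x = sqrt (A n x * B n x - (E n x)\<^sup>2) / A n x"
    unfolding G.speed_def gram G.var_def ff ..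
  show "nondegenerate_gaussian_sum M (span n) ({1..n} <+> {1..n}) (case_sum a b) (coef n) (coef' n) (coef'' n) ((real n)\<^sup>2)"
  proof
    fix x
    have "0 < ((real n + 1) / 2 * A n x)\<^sup>2" using A_pos[OF n, of x] n by simp
    thus "0 < G.gram x" unfolding gram using gram_ge[OF n, of x] by linarith
  qed
qed

end

section \<open>Zeros between two bad points\<close>

lemma ennreal_tendsto_squeeze:
  fixes u :: "nat \<Rightarrow> ennreal" and lo hi :: "real \<Rightarrow> real"
  assumes lo: "(lo \<longlongrightarrow> L) (at_right 0)" and hi: "(hi \<longlongrightarrow> L) (at_right 0)" and e0: "0 < e0"
    and bounds: "\<And>e. 0 < e \<Longrightarrow> e < e0 \<Longrightarrow> eventually (\<lambda>n. ennreal (lo e) \<le> u n \<and> u n \<le> ennreal (hi e)) sequentially"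
  shows "u \<longlonglongrightarrow> ennreal L"
proof (rule order_tendstoI)
  have small: "eventually (\<lambda>e. 0 < e \<and> e < e0) (at_right 0)"
    using e0 by (auto simp: eventually_at_right_field)
  fix c :: ennreal
  show "eventually (\<lambda>n. c < u n) sequentially" if "c < ennreal L"
  proof -
    have "eventually (\<lambda>e. c < ennreal (lo e)) (at_right 0)"
      using tendsto_ennrealI[OF lo] that by (rule order_tendstoD)
    with small have "eventually (\<lambda>e. c < ennreal (lo e) \<and> 0 < e \<and> e < e0) (at_right 0)" by eventually_elim simp
    then obtain e where e: "c < ennreal (lo e)" "0 < e" "e < e0"
      using eventually_happens[of _ "at_right (0::real)"] by (auto simp: trivial_limit_at_right_real)
    from bounds[OF e(2,3)] show ?thesis by eventually_elim (use e(1) in auto)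
  qed
  show "eventually (\<lambda>n. u n < c) sequentially" if "ennreal L < c"
  proof -
    have "eventually (\<lambda>e. ennreal (hi e) < c) (at_right 0)"
      using tendsto_ennrealI[OF hi] that by (rule order_tendstoD)
    with small have "eventually (\<lambda>e. ennreal (hi e) < c \<and> 0 < e \<and> e < e0) (at_right 0)" by eventually_elim simp
    then obtain e where e: "ennreal (hi e) < c" "0 < e" "e < e0"
      using eventually_happens[of _ "at_right (0::real)"] by (auto simp: trivial_limit_at_right_real)
    from bounds[OF e(2,3)] show ?thesis by eventually_elim (use e(1) in auto)
  qed
qed

text \<open>Choosing for each \<open>n\<close> a point which violates the bound, whenever there is one, gives a sequence along which
  the convergence would fail.\<close>
lemma eventually_uniform_if_sequences:
  fixes q :: "nat \<Rightarrow> real \<Rightarrow> real"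
  assumes ne: "J \<noteq> {}" and seq: "\<And>x. (\<And>n. x n \<in> J) \<Longrightarrow> (\<lambda>n. q n (x n)) \<longlonglongrightarrow> \<kappa>" and e: "e > 0"
  shows "eventually (\<lambda>n. \<forall>t\<in>J. \<bar>q n t - \<kappa>\<bar> < e) sequentially"
proof -
  define x where "x n = (SOME t. t \<in> J \<and> ((\<exists>s\<in>J. \<not> \<bar>q n s - \<kappa>\<bar> < e) \<longrightarrow> \<not> \<bar>q n t - \<kappa>\<bar> < e))" for n
  have x: "x n \<in> J \<and> ((\<exists>s\<in>J. \<not> \<bar>q n s - \<kappa>\<bar> < e) \<longrightarrow> \<not> \<bar>q n (x n) - \<kappa>\<bar> < e)" for n
    unfolding x_def by (rule someI_ex) (use ne in blast)
  have "(\<lambda>n. q n (x n)) \<longlonglongrightarrow> \<kappa>" using x by (intro seq) blast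
  hence "eventually (\<lambda>n. dist (q n (x n)) \<kappa> < e) sequentially" using e by (rule tendstoD)
  thus ?thesis by eventually_elim (use x in \<open>auto simp: dist_real_def\<close>)
qed

text \<open>Induction on the number of exceptional points inside the interval.\<close>
lemma interval_chain:
  fixes Q :: "real \<Rightarrow> real \<Rightarrow> bool"
  assumes fin: "finite S"
    and trans: "\<And>x y z. u \<le> x \<Longrightarrow> x < y \<Longrightarrow> y < z \<Longrightarrow> z \<le> v \<Longrightarrow> Q x y \<Longrightarrow> Q y z \<Longrightarrow> Q x z"
    and gap: "\<And>x y. u \<le> x \<Longrightarrow> x < y \<Longrightarrow> y \<le> v \<Longrightarrow> {x<..<y} \<inter> S = {} \<Longrightarrow> Q x y"
    and "u < v"
  shows "Q u v"
proof -
  have "u \<le> x \<longrightarrow> x < y \<longrightarrow> y \<le> v \<longrightarrow> Q x y" for x y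
  proof (induction "card (S \<inter> {x<..<y})" arbitrary: x y rule: less_induct)
    case less
    show ?case
    proof (intro impI)
      assume xy: "u \<le> x" "x < y" "y \<le> v"
      show "Q x y"
      proof (cases "S \<inter> {x<..<y} = {}")
        case True
        thus ?thesis using gap xy by blast
      next
        case False
        then obtain s where s: "s \<in> S" "x < s" "s < y" by auto
        have "card (S \<inter> {x<..<s}) < card (S \<inter> {x<..<y})" "card (S \<inter> {s<..<y}) < card (S \<inter> {x<..<y})"
          using fin s by (auto intro!: psubset_card_mono)
        hence "Q x s" "Q s y" using less s xy by auto
        thus ?thesis using trans s xy by blast
      qed
    qed
  qed
  thus ?thesis using \<open>u < v\<close> by blast
qed

text \<open>One-sided limits give a bound near each point, and bisection a bound on the whole interval.\<close>
lemma piecewise_continuous_bounded: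
  assumes pc: "piecewise_continuous_on a b f" and ab: "a \<le> b"
  shows "\<exists>C. \<forall>t\<in>{a..b}. \<bar>f t\<bar> \<le> C"
proof -
  have side: "\<exists>d>0. \<exists>C. \<forall>t. 0 < s * (t - x) \<and> s * (t - x) < d \<longrightarrow> \<bar>f t\<bar> \<le> C"
    if lim: "(f \<longlongrightarrow> l) (at x within {t. 0 < s * (t - x)})" and s: "s = 1 \<or> s = -1" for s x l :: real
  proof -
    have "eventually (\<lambda>t. dist (f t) l < 1) (at x within {t. 0 < s * (t - x)})"
      using lim by (rule tendstoD) simp
    then obtain d where d: "d > 0" "\<And>t. 0 < s * (t - x) \<Longrightarrow> t \<noteq> x \<Longrightarrow> dist t x < d \<Longrightarrow> dist (f t) l < 1"
      unfolding eventually_at by auto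
    have "\<bar>f t\<bar> \<le> \<bar>l\<bar> + 1" if "0 < s * (t - x)" "s * (t - x) < d" for t
    proof -
      have "\<bar>t - x\<bar> < d" "t \<noteq> x" using that s by auto
      hence "dist (f t) l < 1" using d(2)[OF that(1)] by (simp add: dist_real_def)
      thus ?thesis unfolding dist_real_def by linarith
    qed
    thus ?thesis using d(1) by blast
  qed
  have lefts: "{t. 0 < -1 * (t - x)} = {..<x}" and rights: "{t. 0 < 1 * (t - x)} = {x<..}" for x :: real by auto
  have "(\<exists>C. \<forall>t\<in>{u..v}. a \<le> t \<and> t \<le> b \<longrightarrow> \<bar>f t\<bar> \<le> C)" if "u \<le> v" for u v
    using that
  proof (induction u v rule: Bolzano)
    case (trans u v w)
    then obtain C D where "\<forall>t\<in>{u..v}. a \<le> t \<and> t \<le> b \<longrightarrow> \<bar>f t\<bar> \<le> C" "\<forall>t\<in>{v..w}. a \<le> t \<and> t \<le> b \<longrightarrow> \<bar>f t\<bar> \<le> D" by blast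
    hence "\<forall>t\<in>{u..w}. a \<le> t \<and> t \<le> b \<longrightarrow> \<bar>f t\<bar> \<le> max C D" by fastforce
    thus ?case by blast
  next
    case (local x)
    have L: "\<exists>d>0. \<exists>C. \<forall>t. a \<le> t \<and> t \<le> b \<and> t < x \<and> x - t < d \<longrightarrow> \<bar>f t\<bar> \<le> C"
    proof (cases "x \<in> {a<..b}")
      case True
      then obtain l where "(f \<longlongrightarrow> l) (at_left x)" using pc True unfolding piecewise_continuous_on_def by blast
      from side[of l x "-1", unfolded lefts, OF this] show ?thesis by auto
    next
      case False
      show ?thesis
      proof (cases "x \<le> a")
        case True
        show ?thesis by (rule exI[of _ 1]) (use True in auto)
      next
        case F: False
        show ?thesis by (rule exI[of _ "x - b"]) (use False F in auto)
      qed
    qed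
    have R: "\<exists>d>0. \<exists>C. \<forall>t. a \<le> t \<and> t \<le> b \<and> x < t \<and> t - x < d \<longrightarrow> \<bar>f t\<bar> \<le> C"
    proof (cases "x \<in> {a..<b}")
      case True
      then obtain l where "(f \<longlongrightarrow> l) (at_right x)" using pc True unfolding piecewise_continuous_on_def by blast
      from side[of l x 1, unfolded rights, OF this] show ?thesis by auto
    next
      case False
      show ?thesis
      proof (cases "b \<le> x")
        case True
        show ?thesis by (rule exI[of _ 1]) (use True in auto)
      next
        case F: False
        show ?thesis by (rule exI[of _ "a - x"]) (use False F in auto)
      qed
    qed
    from L obtain d1 C1 where d1: "d1 > 0" "\<And>t. a \<le> t \<Longrightarrow> t \<le> b \<Longrightarrow> t < x \<Longrightarrow> x - t < d1 \<Longrightarrow> \<bar>f t\<bar> \<le> C1" by blast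
    from R obtain d2 C2 where d2: "d2 > 0" "\<And>t. a \<le> t \<Longrightarrow> t \<le> b \<Longrightarrow> x < t \<Longrightarrow> t - x < d2 \<Longrightarrow> \<bar>f t\<bar> \<le> C2" by blast
    show ?case
    proof (rule exI[of _ "min d1 d2"], intro conjI allI impI)
      fix u v assume uv: "u \<le> x \<and> x \<le> v \<and> v - u < min d1 d2"
      have "\<bar>f t\<bar> \<le> max \<bar>f x\<bar> (max C1 C2)" if t: "t \<in> {u..v}" "a \<le> t \<and> t \<le> b" for t
      proof -
        consider "t < x" | "t = x" | "x < t" by linarith
        thus ?thesis
        proof cases
          case 1
          thus ?thesis using d1(2)[of t] t uv by auto
        next
          case 3
          thus ?thesis using d2(2)[of t] t uv by auto
        qed auto
      qed
      thus "\<exists>C. \<forall>t\<in>{u..v}. a \<le> t \<and> t \<le> b \<longrightarrow> \<bar>f t\<bar> \<le> C" by blast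
    qed (use d1 d2 in auto)
  qed
  from this[OF ab] show ?thesis by auto
qed

context spectral_gaussian_pair
begin

definition zeros :: "nat \<Rightarrow> real \<Rightarrow> real \<Rightarrow> ennreal" where
  "zeros n u v = (\<integral>\<^sup>+\<omega>. num_zeros (trig_poly a b n \<omega>) {u..v} \<partial>M)"

text \<open>The square of the speed divided by \<open>n\<^sup>2\<close>.\<close>
definition q :: "nat \<Rightarrow> real \<Rightarrow> real" where
  "q n x = (A n x * B n x - (E n x)\<^sup>2) / ((A n x)\<^sup>2 * (real n)\<^sup>2)"

lemma zeros_upper:
  assumes n: "n > 0" and uv: "u < v" and c: "c > 0" and q: "\<And>x. x \<in> {u..v} \<Longrightarrow> q n x < c\<^sup>2"
  shows "zeros n u v \<le> ennreal (c * real n * (v - u) / pi)"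
proof -
  interpret G: nondegenerate_gaussian_sum M "span n" "{1..n} <+> {1..n}" "case_sum a b" "coef n" "coef' n" "coef'' n" "(real n)\<^sup>2"
    by (rule nondegenerate_trig[OF n])
  have eq: "G.expected_zeros u v = zeros n u v"
    unfolding G.expected_zeros_def zeros_def nondegenerate_trig(2)[OF n] ..
  have "G.speed x < c * real n" if x: "x \<in> {u..v}" for x
  proof -
    have "G.speed x = sqrt (q n x) * real n"
      using A_pos[OF n, of x] n unfolding nondegenerate_trig(3)[OF n] q_def
      by (simp add: real_sqrt_divide real_sqrt_mult)
    moreover have "sqrt (q n x) < c" using q[OF x] c by (simp add: real_less_lsqrt)
    ultimately show ?thesis using n by simp
  qed
  from G.expected_zeros_upper[OF uv this] show ?thesis unfolding eq .
qed

lemma zeros_lower: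
  assumes n: "n > 0" and uv: "u < v" and c: "c \<ge> 0" and q: "\<And>x. x \<in> {u..v} \<Longrightarrow> c\<^sup>2 < q n x"
  shows "ennreal (c * real n * (v - u) / pi) \<le> zeros n u v"
proof -
  interpret G: nondegenerate_gaussian_sum M "span n" "{1..n} <+> {1..n}" "case_sum a b" "coef n" "coef' n" "coef'' n" "(real n)\<^sup>2"
    by (rule nondegenerate_trig[OF n])
  have eq: "G.expected_zeros u v = zeros n u v"
    unfolding G.expected_zeros_def zeros_def nondegenerate_trig(2)[OF n] ..
  have "c * real n < G.speed x" if x: "x \<in> {u..v}" for x
  proof -
    have "G.speed x = sqrt (q n x) * real n"
      using A_pos[OF n, of x] n unfolding nondegenerate_trig(3)[OF n] q_def
      by (simp add: real_sqrt_divide real_sqrt_mult)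
    moreover have "c < sqrt (q n x)" using q[OF x] c by (simp add: real_less_rsqrt)
    ultimately show ?thesis using n by simp
  qed
  from G.expected_zeros_lower[OF uv this] show ?thesis using c unfolding eq by simp
qed

lemma zeros_additive:
  assumes n: "n > 0" and "u < v" "v < z"
  shows "zeros n u z = zeros n u v + zeros n v z"
proof -
  interpret G: nondegenerate_gaussian_sum M "span n" "{1..n} <+> {1..n}" "case_sum a b" "coef n" "coef' n" "coef'' n" "(real n)\<^sup>2"
    by (rule nondegenerate_trig[OF n])
  have eq: "G.expected_zeros u v = zeros n u v" for u v
    unfolding G.expected_zeros_def zeros_def nondegenerate_trig(2)[OF n] ..
  show ?thesis using G.expected_zeros_additive[OF assms(2,3)] unfolding eq .
qed

lemma expectation_abs_le_1:
  assumes X: "stationary_gaussian_sequence M \<mu> X" and k: "1 \<le> k"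
  shows "expectation (\<lambda>\<omega>. \<bar>X k \<omega>\<bar>) \<le> 1"
proof -
  have i: "integrable M (X k)" by (rule sequence_facts(2)[OF X k])
  have "gaussian_rv M (X k)"
  proof -
    have "\<forall>I u. finite I \<longrightarrow> I \<subseteq> {1..} \<longrightarrow> gaussian_rv M (\<lambda>\<omega>. \<Sum>k\<in>I. u k * X k \<omega>)"
      using X unfolding stationary_gaussian_sequence_def gaussian_sequence_def by blast
    from this[rule_format, of "{k}" "\<lambda>_. 1"] k show ?thesis by simp
  qed
  moreover have "expectation (X k) = 0" using X k by (simp add: stationary_gaussian_sequence_def)
  ultimately have i2: "integrable M (\<lambda>\<omega>. (X k \<omega>)\<^sup>2)" by (rule centered_gaussian)
  have "expectation (\<lambda>\<omega>. (X k \<omega>)\<^sup>2) = 1"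
    using covariance(1)[OF X k k] mass by (simp add: \<rho>_def power2_eq_square)
  hence "(LINT \<omega>|M. (1 + (X k \<omega>)\<^sup>2) / 2) = 1" using i2 by (simp add: prob_space)
  moreover have "expectation (\<lambda>\<omega>. \<bar>X k \<omega>\<bar>) \<le> (LINT \<omega>|M. (1 + (X k \<omega>)\<^sup>2) / 2)"
  proof (rule integral_mono)
    fix \<omega>
    show "\<bar>X k \<omega>\<bar> \<le> (1 + (X k \<omega>)\<^sup>2) / 2"
      using sum_squares_bound[of "\<bar>X k \<omega>\<bar>" 1] by simp
  qed (use i i2 in auto)
  ultimately show ?thesis by simp
qed

text \<open>All derivatives of the trigonometric polynomial obey \<open>expected_zeros_short_interval\<close> with \<open>d = n\<close>,
  and the random bound \<open>S\<close> has expectation of order \<open>\<surd>n\<close>.\<close>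
lemma zeros_short:
  assumes n: "n > 0" and x0: "x0 \<in> {u..v}"
  shows "zeros n u v \<le> ennreal (exp 2 * real n * (v - u) + 1
      + (2 * sqrt (real n) + 1 / sqrt (A n x0)) / (1 - exp (- 1 / 2)))"
proof -
  interpret G: nondegenerate_gaussian_sum M "span n" "{1..n} <+> {1..n}" "case_sum a b" "coef n" "coef' n" "coef'' n" "(real n)\<^sup>2"
    by (rule nondegenerate_trig[OF n])
  \<comment> \<open>the \<open>j\<close>-th derivative: differentiation is a phase shift by \<open>\<pi> / 2\<close> and a factor \<open>k\<close>\<close>
  define F where "F j x \<omega> = (\<Sum>k=1..n. real k ^ j * (a k \<omega> * cos (real k * x + real j * pi / 2)
      + b k \<omega> * sin (real k * x + real j * pi / 2))) / sqrt (real n)" for j x \<omega>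
  define S where "S \<omega> = (\<Sum>k=1..n. \<bar>a k \<omega>\<bar> + \<bar>b k \<omega>\<bar>) / sqrt (real n)" for \<omega>
  have F0: "F 0 x \<omega> = trig_poly a b n \<omega> x" for x \<omega> by (simp add: F_def trig_poly_def)
  have F0f: "F 0 x = G.f x" for x by (rule ext) (simp only: F0 nondegenerate_trig(2)[OF n])
  have ai: "integrable M (a k)" "integrable M (b k)" if "k \<in> {1..n}" for k
    using sequence_facts(2)[OF a, of k] sequence_facts(2)[OF b, of k] that by auto
  have Si: "integrable M S"
    unfolding S_def using ai by (intro integrable_divide Bochner_Integration.integrable_sum Bochner_Integration.integrable_add integrable_abs) auto
  have "expectation S = (\<Sum>k=1..n. expectation (\<lambda>\<omega>. \<bar>a k \<omega>\<bar>) + expectation (\<lambda>\<omega>. \<bar>b k \<omega>\<bar>)) / sqrt (real n)"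
    unfolding S_def using ai by (simp add: Bochner_Integration.integral_sum)
  also have "\<dots> \<le> (\<Sum>k=1..n. 1 + 1) / sqrt (real n)"
    using expectation_abs_le_1[OF a] expectation_abs_le_1[OF b] by (intro divide_right_mono sum_mono add_mono) auto
  also have "\<dots> = 2 * sqrt (real n)" using n by (simp add: field_simps)
  finally have ES: "expectation S \<le> 2 * sqrt (real n)" .
  have main: "(\<integral>\<^sup>+\<omega>. num_zeros (\<lambda>x. F 0 x \<omega>) {u..v} \<partial>M)
    \<le> ennreal (exp 2 * real n * (v - u) + 1 + (expectation S + 1 / sqrt (G.ip (F 0 x0) (F 0 x0))) / (1 - exp (- 1 / 2)))"
  proof (rule G.expected_zeros_short_interval[OF _ _ _ Si x0])
    show "((\<lambda>x. F j x \<omega>) has_real_derivative F (Suc j) x \<omega>) (at x)" for j x \<omega>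
    proof -
      have "((\<lambda>x. real k ^ j * (a k \<omega> * cos (real k * x + real j * pi / 2) + b k \<omega> * sin (real k * x + real j * pi / 2)))
        has_real_derivative real k ^ Suc j * (a k \<omega> * cos (real k * x + real (Suc j) * pi / 2) + b k \<omega> * sin (real k * x + real (Suc j) * pi / 2))) (at x)" for k
      proof -
        have "real k * x + real (Suc j) * pi / 2 = (real k * x + real j * pi / 2) + pi / 2" by (simp add: field_simps)
        hence "cos (real k * x + real (Suc j) * pi / 2) = - sin (real k * x + real j * pi / 2)"
          "sin (real k * x + real (Suc j) * pi / 2) = cos (real k * x + real j * pi / 2)"
          by (simp_all only: cos_add sin_add) simp_all
        thus ?thesis by (auto intro!: derivative_eq_intros simp: algebra_simps)
      qed
      thus ?thesis unfolding F_def by (intro DERIV_cdivide DERIV_sum) auto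
    qed
    show "\<bar>F j x \<omega>\<bar> \<le> real n ^ j * S \<omega>" for j x \<omega>
    proof -
      have "\<bar>\<Sum>k=1..n. real k ^ j * (a k \<omega> * cos (real k * x + real j * pi / 2) + b k \<omega> * sin (real k * x + real j * pi / 2))\<bar>
        \<le> (\<Sum>k=1..n. real n ^ j * (\<bar>a k \<omega>\<bar> + \<bar>b k \<omega>\<bar>))"
      proof (rule order_trans[OF sum_abs], rule sum_mono)
        fix k assume k: "k \<in> {1..n}"
        have le: "\<bar>y * z\<bar> \<le> \<bar>y\<bar>" if "\<bar>z\<bar> \<le> 1" for y z :: real
          using mult_left_mono[OF that, of "\<bar>y\<bar>"] by (simp add: abs_mult)
        have "\<bar>a k \<omega> * cos (real k * x + real j * pi / 2) + b k \<omega> * sin (real k * x + real j * pi / 2)\<bar> \<le> \<bar>a k \<omega>\<bar> + \<bar>b k \<omega>\<bar>"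
          by (rule order_trans[OF abs_triangle_ineq]) (intro add_mono le abs_cos_le_one abs_sin_le_one)
        thus "\<bar>real k ^ j * (a k \<omega> * cos (real k * x + real j * pi / 2) + b k \<omega> * sin (real k * x + real j * pi / 2))\<bar>
          \<le> real n ^ j * (\<bar>a k \<omega>\<bar> + \<bar>b k \<omega>\<bar>)"
          using k unfolding abs_mult[of "real k ^ j"] by (intro mult_mono) (auto intro: power_mono)
      qed
      thus ?thesis using n by (simp add: F_def S_def abs_divide sum_distrib_left divide_right_mono)
    qed
    show "F 0 x0 \<in> span n" unfolding F0f by (rule G.f_in)
    show "0 < G.ip (F 0 x0) (F 0 x0)" using G.var_pos[of x0] unfolding G.var_def F0f .
  qed simp
  have ip: "G.ip (F 0 x0) (F 0 x0) = A n x0" unfolding F0f by (rule nondegenerate_trig(4)[OF n])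
  have zs: "zeros n u v = (\<integral>\<^sup>+\<omega>. num_zeros (\<lambda>x. F 0 x \<omega>) {u..v} \<partial>M)"
    unfolding zeros_def F0 ..
  have "zeros n u v \<le> ennreal (exp 2 * real n * (v - u) + 1 + (expectation S + 1 / sqrt (A n x0)) / (1 - exp (- 1 / 2)))"
    unfolding zs using main unfolding ip .
  also have "\<dots> \<le> ennreal (exp 2 * real n * (v - u) + 1 + (2 * sqrt (real n) + 1 / sqrt (A n x0)) / (1 - exp (- 1 / 2)))"
    using ES by (intro ennreal_leI add_left_mono divide_right_mono add_right_mono) auto
  finally show ?thesis .
qed

text \<open>Near the bad points there is no information on the speed. There, short intervals are controlled by
  this bound, in which the length of the interval is the leading term: it needs only that the variance at
  one point is at least of order \<open>1 / n\<close>.\<close>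
lemma zeros_short_eventually:
  assumes x0: "x0 \<in> {u..v}" and c: "c > 0" and A: "eventually (\<lambda>n. c \<le> real n * A n x0) sequentially" and e: "e > 0"
  shows "eventually (\<lambda>n. zeros n u v \<le> ennreal (real n * (exp 2 * (v - u) + e))) sequentially"
proof -
  define D where "D = (2 + 1 / sqrt c) / (1 - exp (- 1 / 2))"
  have "(\<lambda>n. 1 / real n + D * (1 / sqrt (real n))) \<longlonglongrightarrow> 0 + D * 0"
  proof (intro tendsto_intros lim_const_over_n)
    show "(\<lambda>n. 1 / sqrt (real n)) \<longlonglongrightarrow> 0"
      by (rule tendsto_divide_0[OF tendsto_const])
         (auto intro!: filterlim_at_top_imp_at_infinity filterlim_compose[OF sqrt_at_top filterlim_real_sequentially])
  qed
  hence "eventually (\<lambda>n. 1 / real n + D * (1 / sqrt (real n)) < e) sequentially"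
    using e by (intro order_tendstoD(2)) auto
  thus ?thesis using A eventually_gt_at_top[of 0]
  proof eventually_elim
    case (elim n)
    have n: "real n > 0" using elim by simp
    have Ap: "A n x0 > 0" using A_pos elim(3) by blast
    have "c / real n \<le> A n x0" using elim(2) n by (simp add: field_simps)
    hence "sqrt (c / real n) \<le> sqrt (A n x0)" by simp
    hence "1 / sqrt (A n x0) \<le> 1 / sqrt (c / real n)" using c n Ap by (intro divide_left_mono) auto
    hence i: "1 / sqrt (A n x0) \<le> 1 / sqrt c * sqrt (real n)" by (simp add: real_sqrt_divide)
    have "(2 * sqrt (real n) + 1 / sqrt (A n x0)) / (1 - exp (- 1 / 2)) \<le> (2 * sqrt (real n) + 1 / sqrt c * sqrt (real n)) / (1 - exp (- 1 / 2))"
      using i by (intro divide_right_mono add_left_mono) auto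
    also have "\<dots> = D * sqrt (real n)" by (simp add: D_def distrib_right)
    finally have s: "(2 * sqrt (real n) + 1 / sqrt (A n x0)) / (1 - exp (- 1 / 2)) \<le> D * sqrt (real n)" .
    have "real n * (1 / real n + D * (1 / sqrt (real n))) \<le> real n * e"
      using elim(1) n by (intro mult_left_mono) auto
    moreover have "real n * (1 / real n + D * (1 / sqrt (real n))) = 1 + D * (real n / sqrt (real n))"
      using n by (simp only: distrib_left) simp
    moreover have "real n / sqrt (real n) = sqrt (real n)" by (rule real_div_sqrt) simp
    ultimately have De: "1 + D * sqrt (real n) \<le> real n * e" by metis
    have "real n * (exp 2 * (v - u) + e) = exp 2 * real n * (v - u) + real n * e" by (simp only: distrib_left mult_ac)
    hence "exp 2 * real n * (v - u) + 1 + (2 * sqrt (real n) + 1 / sqrt (A n x0)) / (1 - exp (- 1 / 2))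
        \<le> real n * (exp 2 * (v - u) + e)"
      using s De by linarith
    thus ?case using zeros_short[OF elim(3) x0] by (meson ennreal_leI order_trans)
  qed
qed

text \<open>Two end pieces of length \<open>e\<close> are cut off, where uniform convergence may fail; they contribute at
  most a multiple of \<open>e\<close>. On the compact middle piece the speed is almost constant. Then \<open>e\<close>
  tends to zero.\<close>
lemma gap_limit:
  assumes xy: "-pi \<le> x" "x < y" "y \<le> pi" and \<kappa>: "\<kappa> > 0"
    and unif: "\<And>\<alpha> \<beta> e. x < \<alpha> \<Longrightarrow> \<alpha> < \<beta> \<Longrightarrow> \<beta> < y \<Longrightarrow> e > 0 \<Longrightarrow>
      eventually (\<lambda>n. \<forall>t\<in>{\<alpha>..\<beta>}. \<bar>q n t - \<kappa>\<bar> < e) sequentially"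
    and low: "\<And>x0. x < x0 \<Longrightarrow> x0 < y \<Longrightarrow> \<exists>c>0. eventually (\<lambda>n. c \<le> real n * A n x0) sequentially"
  shows "(\<lambda>n. zeros n x y / of_nat n) \<longlonglongrightarrow> ennreal (sqrt \<kappa> * (y - x) / pi)"
proof (rule ennreal_tendsto_squeeze)
  let ?lo = "\<lambda>e. sqrt (\<kappa> - e) * (y - x - 2 * e) / pi"
  let ?hi = "\<lambda>e. sqrt (\<kappa> + e) * (y - x - 2 * e) / pi + 2 * (exp 2 * e + e)"
  have "(?lo \<longlongrightarrow> sqrt (\<kappa> - 0) * (y - x - 2 * 0) / pi) (at_right 0)" by (intro tendsto_intros) auto
  thus "(?lo \<longlongrightarrow> sqrt \<kappa> * (y - x) / pi) (at_right 0)" by simp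
  have "(?hi \<longlongrightarrow> sqrt (\<kappa> + 0) * (y - x - 2 * 0) / pi + 2 * (exp 2 * 0 + 0)) (at_right 0)" by (intro tendsto_intros) auto
  thus "(?hi \<longlongrightarrow> sqrt \<kappa> * (y - x) / pi) (at_right 0)" by simp
  show "0 < min \<kappa> ((y - x) / 2)" using xy \<kappa> by simp
  fix e assume e: "0 < e" "e < min \<kappa> ((y - x) / 2)"
  let ?\<alpha> = "x + e" and ?\<beta> = "y - e"
  have ab: "x < ?\<alpha>" "?\<alpha> < ?\<beta>" "?\<beta> < y" using e by auto
  obtain c1 where c1: "c1 > 0" "eventually (\<lambda>n. c1 \<le> real n * A n ?\<alpha>) sequentially"
    using low[of ?\<alpha>] ab by auto
  obtain c2 where c2: "c2 > 0" "eventually (\<lambda>n. c2 \<le> real n * A n ?\<beta>) sequentially"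
    using low[of ?\<beta>] ab by auto
  have left: "eventually (\<lambda>n. zeros n x ?\<alpha> \<le> ennreal (real n * (exp 2 * (?\<alpha> - x) + e))) sequentially"
    by (rule zeros_short_eventually[OF _ c1 e(1)]) (use ab in auto)
  have right: "eventually (\<lambda>n. zeros n ?\<beta> y \<le> ennreal (real n * (exp 2 * (y - ?\<beta>) + e))) sequentially"
    by (rule zeros_short_eventually[OF _ c2 e(1)]) (use ab in auto)
  show "eventually (\<lambda>n. ennreal (?lo e) \<le> zeros n x y / of_nat n \<and> zeros n x y / of_nat n \<le> ennreal (?hi e)) sequentially"
    using unif[OF ab e(1)] left right eventually_gt_at_top[of 0]
  proof eventually_elim
    case (elim n)
    have n: "real n > 0" using elim(4) by simp
    have split: "zeros n x y = zeros n x ?\<alpha> + (zeros n ?\<alpha> ?\<beta> + zeros n ?\<beta> y)"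
      using zeros_additive[OF elim(4), of x ?\<alpha> y] zeros_additive[OF elim(4), of ?\<alpha> ?\<beta> y] ab by simp
    have divn: "z / of_nat n \<le> ennreal r" if "z \<le> ennreal (real n * r)" "0 \<le> r" for z r
    proof -
      have "z / of_nat n \<le> ennreal (real n * r) / of_nat n" by (rule divide_right_mono_ennreal[OF that(1)])
      also have "\<dots> = ennreal (real n * r / real n)"
        unfolding ennreal_of_nat_eq_real_of_nat using n that(2) by (intro divide_ennreal) auto
      finally show ?thesis using n by simp
    qed
    have divn': "ennreal r \<le> z / of_nat n" if "ennreal (real n * r) \<le> z" "0 \<le> r" for z r
    proof -
      have "ennreal (real n * r / real n) = ennreal (real n * r) / of_nat n"
        unfolding ennreal_of_nat_eq_real_of_nat using n that(2) by (intro divide_ennreal[symmetric]) auto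
      also have "\<dots> \<le> z / of_nat n" by (rule divide_right_mono_ennreal[OF that(1)])
      finally show ?thesis using n by simp
    qed
    have q1: "(sqrt (\<kappa> - e))\<^sup>2 < q n t" "q n t < (sqrt (\<kappa> + e))\<^sup>2" if "t \<in> {?\<alpha>..?\<beta>}" for t
      using elim(1) that e \<kappa> by (auto simp: abs_less_iff algebra_simps)
    have len: "?\<beta> - ?\<alpha> = y - x - 2 * e" by simp
    have "ennreal (sqrt (\<kappa> - e) * real n * (?\<beta> - ?\<alpha>) / pi) \<le> zeros n ?\<alpha> ?\<beta>"
      by (rule zeros_lower[OF elim(4) ab(2) _ q1(1)]) (use e in auto)
    also have "\<dots> \<le> zeros n x y" unfolding split by (intro add_increasing add_increasing2) auto
    also have "sqrt (\<kappa> - e) * real n * (?\<beta> - ?\<alpha>) / pi = real n * ?lo e" unfolding len by simp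
    finally have "ennreal (real n * ?lo e) \<le> zeros n x y" .
    hence l: "ennreal (?lo e) \<le> zeros n x y / of_nat n" using e by (intro divn') auto
    have mid: "zeros n ?\<alpha> ?\<beta> \<le> ennreal (sqrt (\<kappa> + e) * real n * (?\<beta> - ?\<alpha>) / pi)"
      by (rule zeros_upper[OF elim(4) ab(2) _ q1(2)]) (use e \<kappa> in auto)
    have plus3: "ennreal r1 + (ennreal r2 + ennreal r3) = ennreal (r1 + (r2 + r3))" if "0 \<le> r1" "0 \<le> r2" "0 \<le> r3" for r1 r2 r3
      using that by (simp add: ennreal_plus[symmetric] del: ennreal_plus)
    have ends: "?\<alpha> - x = e" "y - ?\<beta> = e" by simp_all
    have "zeros n x y \<le> ennreal (real n * (exp 2 * e + e))
        + (ennreal (sqrt (\<kappa> + e) * real n * (y - x - 2 * e) / pi) + ennreal (real n * (exp 2 * e + e)))"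
      using elim(2,3) mid unfolding split ends len by (intro add_mono)
    also have "\<dots> = ennreal (real n * (exp 2 * e + e)
        + (sqrt (\<kappa> + e) * real n * (y - x - 2 * e) / pi + real n * (exp 2 * e + e)))"
      using e \<kappa> by (intro plus3) auto
    also have "real n * (exp 2 * e + e) + (sqrt (\<kappa> + e) * real n * (y - x - 2 * e) / pi + real n * (exp 2 * e + e)) = real n * ?hi e"
    proof -
      have "N * c + (s * N * l / p + N * c) = N * (s * l / p + 2 * c)" for N c s l p :: real
        by (simp add: distrib_left)
      thus ?thesis .
    qed
    finally have "zeros n x y / of_nat n \<le> ennreal (?hi e)" using e \<kappa> by (intro divn) (auto intro!: add_nonneg_nonneg)
    with l show ?case by blast
  qed
qed

lemma gap_limit_zero:
  assumes xy: "-pi \<le> x" "x < y" "y \<le> pi" and van: "\<And>t. x < t \<Longrightarrow> t < y \<Longrightarrow> \<psi> t = 0"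
  shows "(\<lambda>n. zeros n x y / of_nat n) \<longlonglongrightarrow> ennreal (sqrt (1 / 2) * (y - x) / pi)"
proof (rule gap_limit[OF xy])
  have base: "(\<lambda>n. q n (z n)) \<longlonglongrightarrow> 1 / 2 \<and> eventually (\<lambda>n. 1 / 4 \<le> real n * A n (z n)) sequentially"
    if "x < \<alpha>" "\<beta> < y" and z: "\<And>n. z n \<in> {\<alpha>..\<beta>}" for \<alpha> \<beta> and z :: "nat \<Rightarrow> real"
  proof -
    define \<delta> where "\<delta> = min (\<alpha> - x) (y - \<beta>)"
    have d0: "0 < \<delta>" "\<delta> \<le> \<alpha> - x" "\<delta> \<le> y - \<beta>" using that by (auto simp: \<delta>_def)
    have d: "z n \<in> {-pi + \<delta>..pi - \<delta>}" for n using z[of n] d0 xy by auto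
    have v: "\<psi> t = 0" if "t \<in> {-pi..pi}" "\<bar>t - z n\<bar> < \<delta>" for n t
      using that z[of n] d0 by (intro van) (auto simp: abs_less_iff)
    show ?thesis unfolding q_def using speed_limit_zero[OF d0(1) d v] by (intro conjI)
  qed
  show "eventually (\<lambda>n. \<forall>t\<in>{\<alpha>..\<beta>}. \<bar>q n t - 1 / 2\<bar> < e) sequentially"
    if "x < \<alpha>" "\<alpha> < \<beta>" "\<beta> < y" "e > 0" for \<alpha> \<beta> e
    using that base by (intro eventually_uniform_if_sequences) auto
  show "\<exists>c>0. eventually (\<lambda>n. c \<le> real n * A n x0) sequentially" if "x < x0" "x0 < y" for x0
    using base[of x0 x0 "\<lambda>_. x0"] that by (intro exI[of _ "1/4"]) auto
qed simp

text \<open>On a compact part of the gap \<open>\<psi>\<close> is uniformly continuous and bounded below, which gives the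
  hypotheses of \<open>speed_limit_positive\<close> along every sequence of points.\<close>
lemma gap_limit_positive:
  assumes xy: "-pi \<le> x" "x < y" "y \<le> pi" and pos: "\<And>t. x < t \<Longrightarrow> t < y \<Longrightarrow> 0 < \<psi> t \<and> isCont \<psi> t"
  shows "(\<lambda>n. zeros n x y / of_nat n) \<longlonglongrightarrow> ennreal (sqrt (1 / 3) * (y - x) / pi)"
proof (rule gap_limit[OF xy])
  have base: "(\<lambda>n. q n (z n)) \<longlonglongrightarrow> 1 / 3 \<and> (\<exists>c>0. eventually (\<lambda>n. c \<le> A n (z n)) sequentially)"
    if ab: "x < \<alpha>" "\<alpha> \<le> \<beta>" "\<beta> < y" and z: "\<And>n. z n \<in> {\<alpha>..\<beta>}" for \<alpha> \<beta> and z :: "nat \<Rightarrow> real"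
  proof -
    define \<delta> where "\<delta> = min (\<alpha> - x) (y - \<beta>)"
    have d0: "0 < \<delta>" "\<delta> \<le> \<alpha> - x" "\<delta> \<le> y - \<beta>" using ab by (auto simp: \<delta>_def)
    have d: "z n \<in> {-pi + \<delta>..pi - \<delta>}" for n using z[of n] d0 xy by auto
    have "continuous_on {\<alpha>..\<beta>} \<psi>" using pos ab by (auto intro!: continuous_at_imp_continuous_on)
    then obtain t0 where t0: "t0 \<in> {\<alpha>..\<beta>}" "\<And>t. t \<in> {\<alpha>..\<beta>} \<Longrightarrow> \<psi> t0 \<le> \<psi> t"
      using continuous_attains_inf[of "{\<alpha>..\<beta>}" \<psi>] ab by auto
    have m: "0 < \<psi> t0" using pos[of t0] t0(1) ab by auto
    let ?K = "{\<alpha> - \<delta> / 2..\<beta> + \<delta> / 2}"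
    have Kin: "x < t \<and> t < y" if "t \<in> ?K" for t using that d0 by auto
    have "continuous_on ?K \<psi>" using pos Kin by (auto intro!: continuous_at_imp_continuous_on)
    hence uc: "uniformly_continuous_on ?K \<psi>" by (intro compact_uniformly_continuous) auto
    have unif: "\<exists>\<eta>>0. \<eta> < \<delta> \<and> (\<forall>n. \<forall>t\<in>{-pi..pi}. \<bar>t - z n\<bar> < \<eta> \<longrightarrow> \<bar>\<psi> t - \<psi> (z n)\<bar> \<le> \<epsilon>)" if eps: "\<epsilon> > 0" for \<epsilon>
    proof -
      obtain h where h: "h > 0" "\<And>s t. s \<in> ?K \<Longrightarrow> t \<in> ?K \<Longrightarrow> dist t s < h \<Longrightarrow> dist (\<psi> t) (\<psi> s) < \<epsilon>"
        using uniformly_continuous_onE[OF uc eps] by metis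
      show ?thesis
      proof (intro exI[of _ "min h (\<delta> / 2)"] conjI allI ballI impI)
        fix n t assume "t \<in> {-pi..pi}" and close: "\<bar>t - z n\<bar> < min h (\<delta> / 2)"
        have "\<bar>t - z n\<bar> < \<delta> / 2" using close by simp
        hence zK: "z n \<in> ?K" and tK: "t \<in> ?K"
          using z[of n] d0 unfolding atLeastAtMost_iff by (intro conjI; linarith)+
        show "\<bar>\<psi> t - \<psi> (z n)\<bar> \<le> \<epsilon>" using h(2)[OF zK tK] close by (simp add: dist_real_def)
      qed (use h(1) d0 in auto)
    qed
    have "eventually (\<lambda>n. pi * \<psi> t0 \<le> A n (z n)) sequentially"
      by (rule speed_limit_positive(2)[OF d unif m t0(2)[OF z]])
    moreover have "(\<lambda>n. q n (z n)) \<longlonglongrightarrow> 1 / 3"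
      unfolding q_def by (rule speed_limit_positive(1)[OF d unif m t0(2)[OF z]])
    ultimately show ?thesis using m by (intro conjI exI[of _ "pi * \<psi> t0"]) auto
  qed
  show "eventually (\<lambda>n. \<forall>t\<in>{\<alpha>..\<beta>}. \<bar>q n t - 1 / 3\<bar> < e) sequentially"
    if "x < \<alpha>" "\<alpha> < \<beta>" "\<beta> < y" "e > 0" for \<alpha> \<beta> e
  proof (rule eventually_uniform_if_sequences)
    show "(\<lambda>n. q n (z n)) \<longlonglongrightarrow> 1 / 3" if "\<And>n. z n \<in> {\<alpha>..\<beta>}" for z
      using base[of \<alpha> \<beta> z] that \<open>x < \<alpha>\<close> \<open>\<alpha> < \<beta>\<close> \<open>\<beta> < y\<close> by simp
  qed (use that in auto)
  show "\<exists>c>0. eventually (\<lambda>n. c \<le> real n * A n x0) sequentially" if x0: "x < x0" "x0 < y" for x0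
  proof -
    obtain c where c: "c > 0" "eventually (\<lambda>n. c \<le> A n x0) sequentially"
      using base[of x0 x0 "\<lambda>_. x0"] x0 by auto
    have "eventually (\<lambda>n. c \<le> real n * A n x0) sequentially"
      using c(2) eventually_gt_at_top[of 0]
    proof eventually_elim
      case (elim n)
      have "1 * A n x0 \<le> real n * A n x0" using elim c(1) by (intro mult_right_mono) auto
      thus ?case using elim by simp
    qed
    thus ?thesis using c(1) by blast
  qed
qed simp

text \<open>The nodal set is described on \<open>[-\<pi>, \<pi>]\<close> whereas the zeros are counted on \<open>[0, 2\<pi>]\<close>.\<close>
lemma zeros_period:
  assumes n: "n > 0"
  shows "zeros n 0 (2 * pi) = zeros n (- pi) pi"
proof -
  have per: "trig_poly a b n \<omega> (x + 2 * pi) = trig_poly a b n \<omega> x" for \<omega> x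
  proof -
    have k: "real k * (x + 2 * pi) = real k * x + 2 * pi * of_int (int k)" for k by (simp add: algebra_simps)
    have "cos (real k * (x + 2 * pi)) = cos (real k * x)" "sin (real k * (x + 2 * pi)) = sin (real k * x)" for k
      unfolding k cos_add sin_add cos_int_2pin sin_int_2pin by simp_all
    thus ?thesis unfolding trig_poly_def by (simp only:)
  qed
  have "num_zeros (trig_poly a b n \<omega>) {pi..2 * pi} = num_zeros (trig_poly a b n \<omega>) {- pi..0}" for \<omega>
  proof -
    have "bij_betw (\<lambda>x. x + 2 * pi) {t \<in> {- pi..0}. trig_poly a b n \<omega> t = 0} {t \<in> {pi..2 * pi}. trig_poly a b n \<omega> t = 0}"
    proof (rule bij_betwI[where g = "\<lambda>x. x - 2 * pi"])
      show "(\<lambda>x. x - 2 * pi) \<in> {t \<in> {pi..2 * pi}. trig_poly a b n \<omega> t = 0} \<rightarrow> {t \<in> {- pi..0}. trig_poly a b n \<omega> t = 0}"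
        using per[of \<omega> "_ - 2 * pi"] by auto
    qed (auto simp: per)
    from bij_betw_finite[OF this] bij_betw_same_card[OF this]
    show ?thesis unfolding num_zeros_def by (simp add: emeasure_count_space)
  qed
  hence shift: "zeros n pi (2 * pi) = zeros n (- pi) 0" unfolding zeros_def by simp
  have "zeros n 0 (2 * pi) = zeros n 0 pi + zeros n pi (2 * pi)" by (rule zeros_additive[OF n]) auto
  also have "\<dots> = zeros n (- pi) 0 + zeros n 0 pi" unfolding shift by (rule add.commute)
  also have "\<dots> = zeros n (- pi) pi" by (rule zeros_additive[OF n, symmetric]) auto
  finally show ?thesis .
qed

end

section \<open>The asymptotic number of zeros\<close>

lemma density_eq_density_circ:
  assumes [measurable]: "\<psi>' \<in> borel_measurable borel" and eq: "\<And>x. \<psi>' x = \<psi> x * indicator {-pi..pi} x"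
  shows "density lborel (\<lambda>x. ennreal (\<psi> x) * indicator {-pi..pi} x) = density circ (\<lambda>t. ennreal (\<psi>' t))"
proof -
  have "density circ (\<lambda>t. ennreal (\<psi>' t)) = density lborel (\<lambda>t. ennreal (indicator {-pi..pi} t) * ennreal (\<psi>' t))"
    unfolding circ_def by (rule density_density_eq) measurable
  also have "(\<lambda>t. ennreal (indicator {-pi..pi} t) * ennreal (\<psi>' t)) = (\<lambda>x. ennreal (\<psi> x) * indicator {-pi..pi} x)"
    by (auto simp: eq indicator_def)
  finally show ?thesis by simp
qed

theorem theorem1p2:
  fixes M :: "'w measure"
    and \<mu> :: "real measure"
    and \<psi> :: "real \<Rightarrow> real"
    and a b :: "nat \<Rightarrow> 'w \<Rightarrow> real"
    and p q :: nat
    and \<alpha> \<beta> \<gamma> :: "nat \<Rightarrow> real"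
  assumes "prob_space M"
    and "prob_space \<mu>"
    and "distr \<mu> borel uminus = \<mu>"
    and "\<mu> = density lborel (\<lambda>x. ennreal (\<psi> x) * indicator {-pi..pi} x)"
    and "\<And>x. 0 \<le> \<psi> x"
    and "\<And>x. \<psi> (x + 2 * pi) = \<psi> x"
    and "piecewise_continuous_on (-pi) pi \<psi>"
    and "{x \<in> {-pi..pi}. \<psi> x = 0} = (\<Union>i\<in>{1..p}. {\<alpha> i..\<beta> i}) \<union> (\<Union>j\<in>{1..q}. {\<gamma> j})"
    and "stationary_gaussian_sequence M \<mu> a"
    and "stationary_gaussian_sequence M \<mu> b"
    and "indep_sequences M a b"
  shows "(\<lambda>n. (\<integral>\<^sup>+\<omega>. num_zeros (trig_poly a b n \<omega>) {0..2 * pi} \<partial>M) / of_nat n)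
           \<longlonglongrightarrow> ennreal (measure lborel {x \<in> {-pi..pi}. \<psi> x = 0} / (pi * sqrt 2)
               + (2 * pi - measure lborel {x \<in> {-pi..pi}. \<psi> x = 0}) / (pi * sqrt 3))"
proof -
  note pc = assms(7) and nodal = assms(8)
  obtain D where D: "finite D" "\<And>x. x \<in> {-pi<..<pi} - D \<Longrightarrow> isCont \<psi> x"
    using pc unfolding piecewise_continuous_on_def by blast
  obtain C where C: "\<And>t. t \<in> {-pi..pi} \<Longrightarrow> \<bar>\<psi> t\<bar> \<le> C"
    using piecewise_continuous_bounded[OF pc] pi_ge_zero by fastforce
  \<comment> \<open>the behaviour of \<open>\<psi>\<close> on one period decides about measurability and bounds, so \<open>\<psi>\<close> is cut off\<close>
  define \<psi>' where "\<psi>' x = \<psi> x * indicator {-pi..pi} x" for x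
  have inside: "\<psi>' x = \<psi> x" if "x \<in> {-pi..pi}" for x using that by (simp add: \<psi>'_def)
  have loc: "isCont \<psi>' t \<longleftrightarrow> isCont g t" if "eventually (\<lambda>y. \<psi>' y = g y) (nhds t)" for g t
    by (rule isCont_cong[OF that])
  have cont: "isCont \<psi>' t" if "t \<in> {-pi<..<pi} - D" for t
  proof -
    have "eventually (\<lambda>y. y \<in> {-pi<..<pi}) (nhds t)" using that by (intro eventually_nhds_in_open) auto
    hence "eventually (\<lambda>y. \<psi>' y = \<psi> y) (nhds t)" by eventually_elim (simp add: \<psi>'_def)
    from loc[OF this] show ?thesis using D(2)[OF that] by simp
  qed
  have cont_out: "isCont \<psi>' t" if "t \<notin> {-pi..pi}" for t
  proof -
    have "eventually (\<lambda>y. y \<in> - {-pi..pi}) (nhds t)" using that by (intro eventually_nhds_in_open) auto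
    hence "eventually (\<lambda>y. \<psi>' y = 0) (nhds t)" by eventually_elim (simp add: \<psi>'_def)
    from loc[OF this] show ?thesis by simp
  qed
  have meas [measurable]: "\<psi>' \<in> borel_measurable borel"
  proof (rule borel_measurable_continuous_countable_exceptions)
    show "countable (D \<union> {-pi, pi})" using D(1) by (simp add: countable_finite)
    show "continuous_on (- (D \<union> {-pi, pi})) \<psi>'"
    proof (intro continuous_at_imp_continuous_on ballI)
      fix t assume "t \<in> - (D \<union> {-pi, pi})"
      thus "isCont \<psi>' t" using cont[of t] cont_out[of t] by (cases "t \<in> {-pi..pi}") auto
    qed
  qed
  have nonneg: "0 \<le> \<psi>' t" for t using assms(5) by (simp add: \<psi>'_def)
  have mu: "\<mu> = density circ (\<lambda>t. ennreal (\<psi>' t))"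
    unfolding assms(4) by (rule density_eq_density_circ[OF meas \<psi>'_def])
  have bound: "\<psi>' t \<le> C" if "t \<in> {-pi..pi}" for t using C[OF that] inside[OF that] by simp
  have mass: "(LINT t|circ. \<psi>' t) = 1"
  proof -
    interpret P: prob_space \<mu> by (rule assms(2))
    have "(LINT t|\<mu>. (1::real)) = (LINT t|circ. \<psi>' t *\<^sub>R 1)"
      unfolding mu using nonneg by (subst integral_density) auto
    moreover have "(LINT t|\<mu>. (1::real)) = 1" using P.prob_space by simp
    ultimately show ?thesis by simp
  qed
  interpret S: spectral_gaussian_pair M \<mu> a b \<psi>' C D
    by (intro spectral_gaussian_pair.intro gaussian_pair.intro gaussian_pair_axioms.intro
        spectral_density.intro spectral_gaussian_pair_axioms.intro)
       (use assms meas nonneg bound mass D(1) cont mu in auto)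
  define Z where "Z = {x \<in> {-pi..pi}. \<psi> x = 0}"
  have Zm: "Z \<in> sets lborel" unfolding Z_def nodal by (intro sets.Un sets.finite_UN) auto
  \<comment> \<open>length of the nodal set and predicted limit, as functions of the interval\<close>
  define len where "len x y = measure lborel (Z \<inter> {x..y})" for x y
  define L where "L x y = len x y / (pi * sqrt 2) + (y - x - len x y) / (pi * sqrt 3)" for x y
  have em: "emeasure lborel (Z \<inter> {x..y}) \<noteq> \<infinity>" for x y
  proof -
    have "emeasure lborel (Z \<inter> {x..y}) \<le> emeasure lborel {x..y}" by (intro emeasure_mono) auto
    also have "\<dots> < \<infinity>" by (simp add: emeasure_lborel_Icc_eq)
    finally show ?thesis by simp
  qed
  have len_bounds: "0 \<le> len x y" "len x y \<le> y - x" if "x \<le> y" for x y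
  proof -
    have "len x y \<le> measure lborel {x..y}"
      unfolding len_def using Zm by (intro measure_mono_fmeasurable) (auto simp: fmeasurable_def emeasure_lborel_Icc_eq)
    thus "len x y \<le> y - x" using that by simp
  qed (simp add: len_def)
  have len_add: "len x z = len x y + len y z" if "x < y" "y < z" for x y z
  proof -
    have "len x z = measure lborel ((Z \<inter> {x..y}) \<union> (Z \<inter> {y..z}))"
      unfolding len_def using that by (intro arg_cong[where f = "measure lborel"]) auto
    also have "\<dots> = len x y + len y z"
      unfolding len_def
    proof (rule measure_Un_AE)
      have "AE t in lborel. t \<noteq> y" by (rule AE_lborel_singleton)
      thus "AE t in lborel. t \<notin> Z \<inter> {x..y} \<or> t \<notin> Z \<inter> {y..z}" by eventually_elim auto
    qed (use Zm em in \<open>auto simp: fmeasurable_def top.not_eq_extremum\<close>)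
    finally show ?thesis .
  qed
  \<comment> \<open>between consecutive points of \<open>F\<close> the density is continuous and either zero or positive throughout\<close>
  define F where "F = D \<union> \<alpha> ` {1..p} \<union> \<beta> ` {1..p} \<union> \<gamma> ` {1..q}"
  have "finite F" using D(1) by (simp add: F_def)
  have conv: "(\<lambda>n. S.zeros n (- pi) pi / of_nat n) \<longlonglongrightarrow> ennreal (L (- pi) pi)"
  proof (rule interval_chain[OF \<open>finite F\<close>, where Q = "\<lambda>x y. (\<lambda>n. S.zeros n x y / of_nat n) \<longlonglongrightarrow> ennreal (L x y)"])
    fix x y z :: real
    assume xyz: "x < y" "y < z"
      and xy: "(\<lambda>n. S.zeros n x y / of_nat n) \<longlonglongrightarrow> ennreal (L x y)"
      and yz: "(\<lambda>n. S.zeros n y z / of_nat n) \<longlonglongrightarrow> ennreal (L y z)"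
    have "ennreal (L x y) + ennreal (L y z) = ennreal (L x z)"
    proof -
      have "0 \<le> L x y" "0 \<le> L y z"
        unfolding L_def using len_bounds[of x y] len_bounds[of y z] xyz by (auto intro!: add_nonneg_nonneg)
      moreover have "L x y + L y z = L x z"
        unfolding L_def len_add[OF xyz] by (simp add: add_divide_distrib diff_divide_distrib)
      ultimately show ?thesis by (simp add: ennreal_plus[symmetric] del: ennreal_plus)
    qed
    hence "(\<lambda>n. S.zeros n x y / of_nat n + S.zeros n y z / of_nat n) \<longlonglongrightarrow> ennreal (L x z)"
      using tendsto_add[OF xy yz] by simp
    moreover have "eventually (\<lambda>n. S.zeros n x y / of_nat n + S.zeros n y z / of_nat n = S.zeros n x z / of_nat n) sequentially"
      using eventually_gt_at_top[of 0]
      by eventually_elim (simp add: S.zeros_additive[OF _ xyz] add_divide_distrib_ennreal)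
    ultimately show "(\<lambda>n. S.zeros n x z / of_nat n) \<longlonglongrightarrow> ennreal (L x z)"
      by (rule Lim_transform_eventually)
  next
    fix x y :: real
    assume xy: "- pi \<le> x" "x < y" "y \<le> pi" and gap: "{x<..<y} \<inter> F = {}"
    show "(\<lambda>n. S.zeros n x y / of_nat n) \<longlonglongrightarrow> ennreal (L x y)"
    proof (cases "\<exists>t\<in>{x<..<y}. \<psi> t = 0")
      case True
      then obtain t where t: "t \<in> {x<..<y}" "\<psi> t = 0" by blast
      hence "t \<in> {x \<in> {-pi..pi}. \<psi> x = 0}" using xy by auto
      moreover have "t \<noteq> \<gamma> j" if "j \<in> {1..q}" for j using that gap t by (auto simp: F_def)
      ultimately obtain i where i: "i \<in> {1..p}" "t \<in> {\<alpha> i..\<beta> i}" unfolding nodal by auto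
      have "\<alpha> i \<notin> {x<..<y}" "\<beta> i \<notin> {x<..<y}" using gap i(1) by (auto simp: F_def)
      hence sub: "{x<..<y} \<subseteq> {\<alpha> i..\<beta> i}" using t(1) i(2) by auto
      have van: "\<psi> s = 0" if "s \<in> {x<..<y}" for s
      proof -
        have "s \<in> {x \<in> {-pi..pi}. \<psi> x = 0}" unfolding nodal using that sub i(1) by blast
        thus ?thesis by simp
      qed
      have "len x y = y - x"
      proof (rule antisym)
        have "measure lborel {x<..<y} \<le> len x y"
          unfolding len_def
        proof (rule measure_mono_fmeasurable)
          show "{x<..<y} \<subseteq> Z \<inter> {x..y}" using van xy by (auto simp: Z_def)
        qed (use Zm em in \<open>auto simp: fmeasurable_def top.not_eq_extremum\<close>)
        thus "y - x \<le> len x y" using xy by simp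
      qed (use len_bounds[of x y] xy in simp)
      hence "L x y = sqrt (1 / 2) * (y - x) / pi" by (simp add: L_def real_sqrt_divide)
      moreover have "\<psi>' s = 0" if "x < s" "s < y" for s using van[of s] that by (simp add: \<psi>'_def)
      ultimately show ?thesis using S.gap_limit_zero[OF xy] by simp
    next
      case False
      have pos: "0 < \<psi>' s \<and> isCont \<psi>' s" if "x < s" "s < y" for s
      proof -
        have "\<psi> s \<noteq> 0" using False that by auto
        moreover have "s \<in> {-pi..pi}" "s \<in> {-pi<..<pi} - D" using that xy gap by (auto simp: F_def)
        ultimately show ?thesis using assms(5)[of s] inside[of s] cont[of s] by (auto simp: less_le)
      qed
      have "len x y \<le> measure lborel {x, y}"
        unfolding len_def
      proof (rule measure_mono_fmeasurable)
        show "Z \<inter> {x..y} \<subseteq> {x, y}"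
        proof
          fix s assume s: "s \<in> Z \<inter> {x..y}"
          hence "s \<notin> {x<..<y}" using False by (auto simp: Z_def)
          thus "s \<in> {x, y}" using s by auto
        qed
      qed (use Zm in \<open>auto simp: fmeasurable_def emeasure_lborel_countable\<close>)
      also have "measure lborel {x, y} = 0" by (simp add: measure_def emeasure_lborel_countable)
      finally have "len x y = 0" using len_bounds[of x y] xy by simp
      hence "L x y = sqrt (1 / 3) * (y - x) / pi" by (simp add: L_def real_sqrt_divide)
      thus ?thesis using S.gap_limit_positive[OF xy pos] by simp
    qed
  qed simp
  have "len (- pi) pi = measure lborel Z" unfolding len_def
    by (rule arg_cong[where f = "measure lborel"]) (auto simp: Z_def)
  hence Lval: "L (- pi) pi = measure lborel Z / (pi * sqrt 2) + (2 * pi - measure lborel Z) / (pi * sqrt 3)"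
    by (simp add: L_def)
  have "eventually (\<lambda>n. S.zeros n (- pi) pi / of_nat n
      = (\<integral>\<^sup>+\<omega>. num_zeros (trig_poly a b n \<omega>) {0..2 * pi} \<partial>M) / of_nat n) sequentially"
    using eventually_gt_at_top[of 0]
  proof eventually_elim
    case (elim n)
    show ?case unfolding S.zeros_period[OF elim, symmetric] unfolding S.zeros_def ..
  qed
  from Lim_transform_eventually[OF conv this] show ?thesis
    unfolding Lval Z_def .
qed

end
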